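(* A finite group $G$ is isomorphic to a subgroup of $A(E)$ for some elliptic curve $E$ over $\mathbb{C}$ if and only if $G$ is isomorphic to one of the following: (1) abelian case: (1.1) $Z_m$ ($m\ge 1$) or $Z_m\oplus Z_{mn}$ ($m\ge 2$, $n\ge 1$); (1.2) $Z_2$, $Z_2^{\oplus 2}$, $Z_2^{\oplus 3}$, $Z_3$, $Z_3^{\oplus 2}$, $Z_4$, $Z_2\oplus Z_4$ or $Z_6$; (2) non-abelian case: (2.1) $D_n$ or $BD_{mn}$ ($n\ge 3$); (2.2) $E(k,l)$ or $E(m,k,l)$. The cases (1.1), (1.2), (2.1) and (2.2) appear in the cases where $|G_0|=1$, $|G_0|>1$, $|G_0|=2$ and $|G_0|>2$ respectively; that is, for a finite subgroup $G\subset A(E)$: if $|G_0|=1$ then $G$ is as in (1.1); if $G$ is abelian and $|G_0|>1$ then $G$ is as in (1.2); if $G$ is non-abelian and $|G_0|=2$ then $G$ is as in (2.1); if $G$ is non-abelian and $|G_0|>2$ then $G$ is as in (2.2).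
   Context: The ground field is $\mathbb{C}$. $E=\mathbb{C}/\mathcal{L}$ is an elliptic curve, with lattice $\mathcal{L}=\mathbb{Z}+\mathbb{Z}\omega$, $\Im\omega>0$, and $A(E)$ is the group of automorphisms of $E$ as a variety (not necessarily fixing the origin). Each $\sigma\in A(E)$ has a lift $\widetilde\sigma:\mathbb{C}\to\mathbb{C}$, $\widetilde\sigma(z)=\alpha(\sigma)z+\beta(\sigma)$, with constants $\alpha(\sigma),\beta(\sigma)\in\mathbb{C}$ and $\alpha(\sigma)\mathcal{L}=\mathcal{L}$; $\alpha$ is a group homomorphism from $A(E)$ to the roots of unity. For a subgroup $G\subset A(E)$, put $G_T=\{\sigma\in G: \alpha(\sigma)=1\}$ (translations) and $G_0=\alpha(G)$. Notation: $Z_n=\mathbb{Z}/n\mathbb{Z}$; $D_n$ is the dihedral group of order $2n$. Bidihedral group: a finite group is called a bidihedral group, denoted $BD_{mn}$, if it is generated by elements $a,b,c$ satisfying: (1) the orders of $a,b,c$ are $2,m,n$ respectively; (2) $n\ge m\ge 2$ and $n\ge 3$; (3) $aba=b^{-1}$, $aca=c^{-1}$ and $bc=cb$. Exceptional elliptic group: a finite non-abelian group $G$ of order $m^2kl$ is called an exceptional elliptic group if: (1) $G$ is the semi-direct product $H\rtimes K$ with some action of $K$ on $H$, where $K\cong Z_l$ and $H$ is a normal subgroup of $G$ such that $H\cong Z_k$ or $H\cong Z_m\oplus Z_{mk}$; (2) $l=3,4$ or $6$, and $m$ is any positive integer; (3) the positive integer $k$ is a factor of $h^2+\varepsilon h+1$,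 where $h$ is an integer and $\varepsilon=0$ if $l=4$, $\varepsilon=1$ if $l=3$ or $6$. These groups are denoted $E(k,l)$ if $H$ has one generator ($H\cong Z_k$) and $E(m,k,l)$ if $H$ has two generators ($H\cong Z_m\oplus Z_{mk}$).
   Formalization: In E(k,l), E(m,k,l), "some action of K on H" is restricted: a generator of K acts as a primitive l-th root of unity (killed by its cyclotomic polynomial) and one K-orbit generates H. For arbitrary actions the "if" part fails: Z_5⋊Z_4 acting by inversion (k=5, l=4). *)

theory Defs
  imports "HOL-Analysis.Analysis" "HOL-Algebra.Algebra"
begin

definition period_lattice :: "complex \<Rightarrow> complex set" where
  "period_lattice \<omega> = {of_int a + of_int b * \<omega> | a b :: int. True}"

definition torus_proj :: "complex \<Rightarrow> complex \<Rightarrow> complex set" where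
  "torus_proj \<omega> z = {w. w - z \<in> period_lattice \<omega>}"

definition torus :: "complex \<Rightarrow> complex set set" where
  "torus \<omega> = range (torus_proj \<omega>)"

text \<open>
  The charts of the quotient are the local inverses of the projection. So a self-map is
  holomorphic iff near every point it is induced by a holomorphic function on an open subset
  of the complex plane. Only local lifts are required: the existence of a global affine lift
  is a theorem, not part of the definition.
\<close>

definition torus_holomorphic :: "complex \<Rightarrow> (complex set \<Rightarrow> complex set) \<Rightarrow> bool" where
  "torus_holomorphic \<omega> f \<longleftrightarrow>
     (\<forall>z0. \<exists>U g. open U \<and> z0 \<in> U \<and> g holomorphic_on U \<and>
        (\<forall>z\<in>U. f (torus_proj \<omega> z) = torus_proj \<omega> (g z)))"

text \<open>
  Automorphisms as a variety are the biholomorphic self-maps; the origin need not be fixed.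
  Composition is that of \<^const>\<open>BijGroup\<close>, whose elements are extensional on the torus.
\<close>

definition torus_aut :: "complex \<Rightarrow> (complex set \<Rightarrow> complex set) monoid" where
  "torus_aut \<omega> = BijGroup (torus \<omega>)
     \<lparr>carrier := {\<sigma> \<in> Bij (torus \<omega>).
        torus_holomorphic \<omega> \<sigma> \<and> torus_holomorphic \<omega> (inv_into (torus \<omega>) \<sigma>)}\<rparr>"

definition lift_multiplier :: "complex \<Rightarrow> (complex set \<Rightarrow> complex set) \<Rightarrow> complex" where
  "lift_multiplier \<omega> \<sigma> =
     (THE \<alpha>. \<exists>\<beta>. \<forall>z. \<sigma> (torus_proj \<omega> z) = torus_proj \<omega> (\<alpha> * z + \<beta>))"

text \<open>The pair \<open>(i, s)\<close> is the \<open>i\<close>-th power of the rotation, followed on the right by the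
  reflection if \<open>s\<close> holds. The order is \<open>2 n\<close>.\<close>

definition dihedral_group :: "nat \<Rightarrow> (int \<times> bool) monoid" where
  "dihedral_group n =
     \<lparr>carrier = {0..<int n} \<times> UNIV,
      monoid.mult = (\<lambda>(i, s) (j, t). ((if s then i - j else i + j) mod int n, s \<noteq> t)),
      one = (0, False)\<rparr>"

definition bidihedral :: "nat \<Rightarrow> nat \<Rightarrow> ('a, 'b) monoid_scheme \<Rightarrow> bool" where
  "bidihedral m n G \<longleftrightarrow>
     group G \<and> finite (carrier G) \<and> n \<ge> m \<and> m \<ge> 2 \<and> n \<ge> 3 \<and>
     (\<exists>a\<in>carrier G. \<exists>b\<in>carrier G. \<exists>c\<in>carrier G.
        generate G {a, b, c} = carrier G \<and>
        group.ord G a = 2 \<and> group.ord G b = m \<and> group.ord G c = n \<and>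
        a \<otimes>\<^bsub>G\<^esub> b \<otimes>\<^bsub>G\<^esub> a = inv\<^bsub>G\<^esub> b \<and>
        a \<otimes>\<^bsub>G\<^esub> c \<otimes>\<^bsub>G\<^esub> a = inv\<^bsub>G\<^esub> c \<and>
        b \<otimes>\<^bsub>G\<^esub> c = c \<otimes>\<^bsub>G\<^esub> b)"

definition semidirect_product :: "('a, 'b) monoid_scheme \<Rightarrow> 'a set \<Rightarrow> 'a set \<Rightarrow> bool" where
  "semidirect_product G H K \<longleftrightarrow>
     H \<lhd> G \<and> subgroup K G \<and> H \<inter> K = {\<one>\<^bsub>G\<^esub>} \<and> H <#>\<^bsub>G\<^esub> K = carrier G"

definition conj_by :: "('a, 'b) monoid_scheme \<Rightarrow> 'a \<Rightarrow> 'a \<Rightarrow> 'a" where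
  "conj_by G s y = s \<otimes>\<^bsub>G\<^esub> y \<otimes>\<^bsub>G\<^esub> inv\<^bsub>G\<^esub> s"

text \<open>
  The action of \<open>K\<close> on \<open>H\<close> in an exceptional elliptic group: some generator \<open>s\<close> of \<open>K\<close> acts on
  the abelian group \<open>H\<close> as multiplication by a primitive \<open>l\<close>-th root of unity \<open>\<zeta>\<close>, i.e. it is
  annihilated by the cyclotomic polynomial \<open>X^2 + e X + 1\<close>, where \<open>e = 1, 0, -1\<close> for
  \<open>l = 3, 4, 6\<close>; and \<open>H\<close> is generated by one \<open>K\<close>-orbit, i.e. it is a cyclic module over the ring
  of integers \<open>\<int>[\<zeta>]\<close>.
  If \<open>H\<close> is cyclic of order \<open>k\<close>, the second condition is automatic, and the first one says that
  \<open>s\<close> acts as multiplication by \<open>h\<close> (\<open>l = 3, 4\<close>) or \<open>-h\<close> (\<open>l = 6\<close>), where \<open>h\<close> is an integer as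
  in the divisibility condition of the definition of exceptional elliptic groups.

  An arbitrary action of \<open>K\<close> on \<open>H\<close> cannot be allowed. For \<open>k = 5\<close>, \<open>l = 4\<close>, let a generator of
  \<open>K\<close> act by inversion: the resulting dicyclic group of order 20 does not act faithfully on any
  elliptic curve. For \<open>m = 5\<close>, \<open>k = 1\<close>, \<open>l = 4\<close>, let it act as the scalar 2: this is annihilated
  by \<open>X^2 + 1\<close>, but the resulting group of order 100 does not act faithfully either.
\<close>

definition root_of_unity_action :: "nat \<Rightarrow> ('a, 'b) monoid_scheme \<Rightarrow> 'a set \<Rightarrow> 'a set \<Rightarrow> bool" where
  "root_of_unity_action l G H K \<longleftrightarrow>
     (\<exists>s\<in>K. generate G {s} = K \<and>
        (let e = (if l = 3 then 1 else if l = 4 then 0 else - 1 :: int) in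
          \<forall>y\<in>H. conj_by G s (conj_by G s y) \<otimes>\<^bsub>G\<^esub> (conj_by G s y [^]\<^bsub>G\<^esub> e) \<otimes>\<^bsub>G\<^esub> y
                 = \<one>\<^bsub>G\<^esub>)) \<and>
     (\<exists>x\<in>H. generate G ((\<lambda>g. conj_by G g x) ` K) = H)"

definition exceptional_elliptic ::
    "nat \<Rightarrow> nat \<Rightarrow> nat \<Rightarrow> ('a, 'b) monoid_scheme \<Rightarrow> 'a set \<Rightarrow> bool" where
  "exceptional_elliptic m k l G H \<longleftrightarrow>
     group G \<and> finite (carrier G) \<and> \<not> comm_group G \<and> order G = m\<^sup>2 * k * l \<and>
     (\<exists>K. semidirect_product G H K \<and> G\<lparr>carrier := K\<rparr> \<cong> integer_mod_group l \<and>
          root_of_unity_action l G H K) \<and>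
     l \<in> {3, 4, 6} \<and> m > 0 \<and> k > 0 \<and>
     (\<exists>h::int. int k dvd h\<^sup>2 + (if l = 4 then 0 else 1) * h + 1)"

text \<open>For cyclic \<open>H\<close> of order \<open>k\<close>, the order formula forces \<open>m = 1\<close>.\<close>

definition exceptional_elliptic_one :: "nat \<Rightarrow> nat \<Rightarrow> ('a, 'b) monoid_scheme \<Rightarrow> bool" where
  "exceptional_elliptic_one k l G \<longleftrightarrow>
     (\<exists>m H. exceptional_elliptic m k l G H \<and> G\<lparr>carrier := H\<rparr> \<cong> integer_mod_group k)"

definition exceptional_elliptic_two :: "nat \<Rightarrow> nat \<Rightarrow> nat \<Rightarrow> ('a, 'b) monoid_scheme \<Rightarrow> bool" where
  "exceptional_elliptic_two m k l G \<longleftrightarrow>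
     (\<exists>H. exceptional_elliptic m k l G H \<and>
          G\<lparr>carrier := H\<rparr> \<cong> integer_mod_group m \<times>\<times> integer_mod_group (m * k))"

definition abelian_general_list :: "('a, 'b) monoid_scheme \<Rightarrow> bool" where
  "abelian_general_list G \<longleftrightarrow>
     (\<exists>m\<ge>1. G \<cong> integer_mod_group m) \<or>
     (\<exists>m\<ge>2. \<exists>n\<ge>1. G \<cong> integer_mod_group m \<times>\<times> integer_mod_group (m * n))"

definition abelian_special_list :: "('a, 'b) monoid_scheme \<Rightarrow> bool" where
  "abelian_special_list G \<longleftrightarrow>
     G \<cong> integer_mod_group 2 \<or>
     G \<cong> integer_mod_group 2 \<times>\<times> integer_mod_group 2 \<or>
     G \<cong> integer_mod_group 2 \<times>\<times> (integer_mod_group 2 \<times>\<times> integer_mod_group 2) \<or>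
     G \<cong> integer_mod_group 3 \<or>
     G \<cong> integer_mod_group 3 \<times>\<times> integer_mod_group 3 \<or>
     G \<cong> integer_mod_group 4 \<or>
     G \<cong> integer_mod_group 2 \<times>\<times> integer_mod_group 4 \<or>
     G \<cong> integer_mod_group 6"

definition dihedral_list :: "('a, 'b) monoid_scheme \<Rightarrow> bool" where
  "dihedral_list G \<longleftrightarrow> (\<exists>n\<ge>3. G \<cong> dihedral_group n) \<or> (\<exists>m n. bidihedral m n G)"

definition exceptional_list :: "('a, 'b) monoid_scheme \<Rightarrow> bool" where
  "exceptional_list G \<longleftrightarrow>
     (\<exists>k l. exceptional_elliptic_one k l G) \<or> (\<exists>m k l. exceptional_elliptic_two m k l G)"

end

theory Submission
  imports Defs "HOL-Complex_Analysis.Complex_Analysis"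
begin

text \<open>By Liouville's theorem every automorphism of \<open>\<complex> / \<L>\<close> is induced by an affine map
  \<open>z \<mapsto> \<alpha> z + \<beta>\<close>. The multipliers of a finite group \<open>S\<close> are the \<open>d\<close>-th roots of unity, and
  \<open>d \<in> {1, 2, 3, 4, 6}\<close> because they preserve a lattice. An element of \<open>S\<close> with multiplier
  \<open>\<zeta> = exp (2 \<pi> i / d)\<close> has a fixed point, so \<open>S\<close> is a semidirect product of its translations
  \<open>\<Lambda> / \<L>\<close> and a cyclic group of order \<open>d\<close>, where \<open>\<Lambda> \<supseteq> \<L>\<close> are lattices closed under
  multiplication by \<open>\<zeta>\<close>. In a basis \<open>u, v\<close> of \<open>\<Lambda>\<close> with \<open>\<L> = \<int> m u + \<int> m k v\<close> the lists can be
  read off. Conversely, a group in the lists is generated by two commuting elements \<open>x, y\<close> and a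
  \<open>d\<close>-th root of the identity \<open>s\<close>. It is presented by the same lattice data, where now \<open>\<Lambda>\<close> is
  \<open>\<int>[i]\<close> or \<open>\<int>[\<zeta>]\<close> and \<open>\<L>\<close> is its sublattice of relations between \<open>x\<close> and \<open>y\<close>.\<close>

section \<open>Lattices in the plane\<close>

text \<open>A rotation with multiplier \<zeta> \<noteq> 1 has a fixed point because 1 - \<zeta> is
  invertible in \<complex>. The obstacle is that \<Lambda> carries two structures that no single
  basis displays. A basis \<open>u, v\<close> adapted to \<L> diagonalizes the inclusion, but not
  the multiplication by \<zeta>. A basis \<open>w, \<zeta> w\<close>, found by Euclidean division,
  shows that \<Lambda> is cyclic over \<int>[\<zeta>], but tells nothing about \<L>. The
  divisibility condition on k comes from the matrix of \<zeta> in the basis \<open>u, v\<close>: one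
  off-diagonal entry is divisible by k because \<zeta> preserves \<L>, so a diagonal entry solves
  the quadratic equation of \<zeta> modulo k. The short abelian list has its origin in the criterion
  that the group is abelian iff (\<zeta> - 1) \<Lambda> \<subseteq> \<L>. The translations then form
  a quotient of \<Lambda> / (\<zeta> - 1) \<Lambda>, which has order 4, 3, 2, 1 for d = 2, 3, 4,
  6.\<close>

definition zspan :: "complex \<Rightarrow> complex \<Rightarrow> complex set" where
  "zspan u v = {of_int a * u + of_int b * v | a b :: int. True}"

definition add_subgroup :: "complex set \<Rightarrow> bool" where
  "add_subgroup L \<longleftrightarrow> 0 \<in> L \<and> (\<forall>x\<in>L. \<forall>y\<in>L. x - y \<in> L)"

lemma add_subgroup_0: "add_subgroup L \<Longrightarrow> 0 \<in> L"
  and add_subgroup_diff: "add_subgroup L \<Longrightarrow> x \<in> L \<Longrightarrow> y \<in> L \<Longrightarrow> x - y \<in> L"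
  by (auto simp: add_subgroup_def)

lemma add_subgroup_uminus: "add_subgroup L \<Longrightarrow> x \<in> L \<Longrightarrow> - x \<in> L"
  using add_subgroup_diff[of L 0 x] add_subgroup_0 by simp

lemma add_subgroup_add: "add_subgroup L \<Longrightarrow> x \<in> L \<Longrightarrow> y \<in> L \<Longrightarrow> x + y \<in> L"
  using add_subgroup_diff[of L x "- y"] add_subgroup_uminus by simp

lemma add_subgroup_of_nat_mult:
  assumes "add_subgroup L" "x \<in> L" shows "of_nat n * x \<in> L"
  by (induction n) (use assms in \<open>auto simp: ring_distribs intro: add_subgroup_add add_subgroup_0\<close>)

lemma add_subgroup_of_int_mult:
  assumes "add_subgroup L" "x \<in> L" shows "of_int a * x \<in> L"
  by (cases a)
    (use add_subgroup_of_nat_mult[OF assms] add_subgroup_uminus[OF assms(1)] in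
      \<open>auto simp flip: of_nat_Suc\<close>)

lemma zspanI: "x = of_int a * u + of_int b * v \<Longrightarrow> x \<in> zspan u v"
  by (auto simp: zspan_def)

lemma zspanE:
  assumes "x \<in> zspan u v" obtains a b where "x = of_int a * u + of_int b * v"
  using assms by (auto simp: zspan_def)

lemma zspan_gens: "u \<in> zspan u v" "v \<in> zspan u v"
  by (rule zspanI[of _ 1 _ 0], simp) (rule zspanI[of _ 0 _ 1], simp)

lemma add_subgroup_zspan: "add_subgroup (zspan u v)"
proof -
  have "0 \<in> zspan u v" by (rule zspanI[of _ 0 _ 0]) simp
  moreover have "x - y \<in> zspan u v" if xy: "x \<in> zspan u v" "y \<in> zspan u v" for x y
  proof -
    obtain a b where "x = of_int a * u + of_int b * v" using xy(1) by (rule zspanE)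
    moreover obtain c d where "y = of_int c * u + of_int d * v" using xy(2) by (rule zspanE)
    ultimately show ?thesis by (intro zspanI[of _ "a - c" _ "b - d"]) (simp add: algebra_simps)
  qed
  ultimately show ?thesis by (simp add: add_subgroup_def)
qed

lemma zspan_least:
  assumes "add_subgroup L" "u \<in> L" "v \<in> L" shows "zspan u v \<subseteq> L"
  using assms by (auto simp: zspan_def intro!: add_subgroup_add add_subgroup_of_int_mult)

lemma zspan_swap: "zspan v u = zspan u v"
  by (intro equalityI zspan_least add_subgroup_zspan zspan_gens)

lemma zspan_shear: "zspan (u + of_int c * v) v = zspan u v"
proof (intro equalityI zspan_least add_subgroup_zspan zspan_gens)
  show "u + of_int c * v \<in> zspan u v" by (rule zspanI[of _ 1 _ c]) simp
  show "u \<in> zspan (u + of_int c * v) v" by (rule zspanI[of _ 1 _ "- c"]) simp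
qed

lemma zspan_uminus: "zspan u (- v) = zspan u v"
proof (intro equalityI zspan_least add_subgroup_zspan zspan_gens)
  show "- v \<in> zspan u v" "v \<in> zspan u (- v)"
    by (rule zspanI[of _ 0 _ "- 1"], simp)+
qed

lemma zspan_scale: "zspan (c * u) (c * v) = (\<lambda>x. c * x) ` zspan u v"
proof (intro equalityI subsetI)
  fix x assume "x \<in> zspan (c * u) (c * v)"
  then obtain a b where "x = of_int a * (c * u) + of_int b * (c * v)" by (rule zspanE)
  then have "x = c * (of_int a * u + of_int b * v)" by (simp add: algebra_simps)
  then show "x \<in> (\<lambda>x. c * x) ` zspan u v" by (auto intro: zspanI)
next
  fix x assume "x \<in> (\<lambda>x. c * x) ` zspan u v"
  then obtain y where y: "y \<in> zspan u v" "x = c * y" by blast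
  obtain a b where "y = of_int a * u + of_int b * v" using y(1) by (rule zspanE)
  then show "x \<in> zspan (c * u) (c * v)"
    by (intro zspanI[of _ a _ b]) (simp add: y(2) algebra_simps)
qed

lemma period_lattice_eq_zspan: "period_lattice \<omega> = zspan 1 \<omega>"
  by (simp add: period_lattice_def zspan_def)

section \<open>Bases and elementary divisors\<close>

lemma zspan_coords_unique:
  assumes "Im (cnj u * v) \<noteq> 0"
    and "of_int a * u + of_int b * v = of_int a' * u + of_int b' * v"
  shows "a = a' \<and> b = b'"
proof -
  have *: "of_int (a - a') * u = of_int (b' - b) * v"
    using assms(2) by (simp add: algebra_simps)
  have "Im (cnj u * (of_int (a - a') * u)) = 0"
    by (simp add: algebra_simps)
  then have "of_int (b' - b) * Im (cnj u * v) = 0"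
    unfolding * by (simp add: algebra_simps)
  then have "b' = b" using assms(1) by simp
  moreover have "u \<noteq> 0" using assms(1) by auto
  ultimately show ?thesis using * by simp
qed

text \<open>Take for \<open>m\<close> the least positive coordinate that an element of \<open>L\<close> has with respect to some
  basis of the big lattice.\<close>

lemma zspan_elementary_divisors:
  assumes nd: "Im (cnj u0 * v0) \<noteq> 0" and L: "add_subgroup L" "L \<subseteq> zspan u0 v0"
    and N: "N > 0" "\<And>x. x \<in> zspan u0 v0 \<Longrightarrow> of_nat N * x \<in> L"
  obtains u v and m k :: nat where "Im (cnj u * v) \<noteq> 0" "zspan u v = zspan u0 v0"
    "m > 0" "k > 0" "L = zspan (of_nat m * u) (of_nat (m * k) * v)"
proof -
  define basis where "basis p q \<longleftrightarrow> Im (cnj p * q) \<noteq> 0 \<and> zspan p q = zspan u0 v0" for p q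
  define coord where
    "coord n \<longleftrightarrow> n > 0 \<and> (\<exists>p q (b::int). basis p q \<and> of_nat n * p + of_int b * q \<in> L)" for n :: nat
  define m where "m = (LEAST n. coord n)"
  have basis_swap: "basis q p" if "basis p q" for p q
    using that zspan_swap[of p q] by (auto simp: basis_def mult.commute)
  have basis_shear: "basis (p + of_int c * q) q" if "basis p q" for p q c
    using that zspan_shear[of p c q] by (auto simp: basis_def algebra_simps)
  have "coord N"
    unfolding coord_def
    using N nd zspan_gens(1)[of u0 v0]
    by (intro conjI N(1) exI[of _ u0] exI[of _ v0] exI[of _ "0::int"]) (auto simp: basis_def)
  then have m: "coord m" and least: "\<And>n. coord n \<Longrightarrow> m \<le> n"
    unfolding m_def using LeastI[of coord N] Least_le[of coord] by blast+
  have mpos: "m > 0" using m by (simp add: coord_def)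
  have small: "r = 0" if "basis p q" "of_int r * p + of_int b * q \<in> L" "0 \<le> r" "r < int m" for p q r b
  proof (rule ccontr)
    assume "r \<noteq> 0"
    with that have "coord (nat r)" by (auto simp: coord_def)
    from least[OF this] that \<open>r \<noteq> 0\<close> show False by simp
  qed
  have dvd2: "int m dvd b" if "basis p q" "of_nat m * p + of_int b * q \<in> L" for p q b
  proof -
    \<comment> \<open>In the basis \<open>q, p + c q\<close> the same vector has leading coordinate
      \<open>?r\<close>, so the minimality of \<open>m\<close> forces this remainder to
      vanish.\<close>
    let ?c = "b div int m" and ?r = "b mod int m"
    have "of_nat m * p + of_int b * q = of_int ?r * q + of_int (int m) * (p + of_int ?c * q)"
    proof -
      have "(of_int b :: complex) = of_int (int m * ?c + ?r)" by simp
      then show ?thesis by (simp only: of_int_add of_int_mult) (simp add: algebra_simps)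
    qed
    then have "?r = 0"
      using small[OF basis_swap[OF basis_shear[OF that(1)]], of ?r "int m" ?c] that(2) mpos by simp
    then show ?thesis by auto
  qed
  obtain p v b where b: "basis p v" "of_nat m * p + of_int b * v \<in> L"
    using m by (auto simp: coord_def)
  \<comment> \<open>The shear absorbs the second coordinate \<open>b\<close>, a multiple of
    \<open>m\<close>, so that \<open>m u\<close> itself lies in \<open>L\<close>.\<close>
  define u where "u = p + of_int (b div int m) * v"
  have uv: "basis u v" unfolding u_def by (intro basis_shear b)
  have "of_int b = (of_nat m * of_int (b div int m) :: complex)"
    using dvd2[OF b] by (metis dvd_mult_div_cancel of_int_mult of_int_of_nat_eq)
  then have muL: "of_nat m * u \<in> L"
    using b(2) by (simp add: u_def algebra_simps)
  have coords: "int m dvd a \<and> int m dvd b \<and> of_int b * v \<in> L"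
    if "of_int a * u + of_int b * v \<in> L" for a b
  proof -
    let ?c = "a div int m" and ?r = "a mod int m"
    have "of_int a * u + of_int b * v - of_int ?c * (of_nat m * u) = of_int ?r * u + of_int b * v"
    proof -
      have "(of_int a :: complex) = of_int (int m * ?c + ?r)" by simp
      then show ?thesis by (simp only: of_int_add of_int_mult) (simp add: algebra_simps)
    qed
    then have "of_int ?r * u + of_int b * v \<in> L"
      by (metis L(1) muL that add_subgroup_diff add_subgroup_of_int_mult)
    moreover from small[OF uv this] have r: "?r = 0" using mpos by simp
    ultimately have bv: "of_int b * v \<in> L" by simp
    \<comment> \<open>\<open>dvd2\<close> speaks of vectors with leading coordinate exactly
      \<open>m\<close>; adding \<open>m u\<close> to \<open>b v\<close> produces one.\<close>
    have "int m dvd b"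
      using dvd2[OF uv, of b] add_subgroup_add[OF L(1) muL bv] by simp
    with r bv show ?thesis by auto
  qed
  \<comment> \<open>The order of \<open>v\<close> modulo \<open>L\<close>, finite because of
    \<open>N\<close>. It is the second elementary divisor, and \<open>coords\<close> makes it a
    multiple of \<open>m\<close>.\<close>
  define kk where "kk = (LEAST n. n > 0 \<and> of_nat n * v \<in> L)"
  have uv_span: "zspan u v = zspan u0 v0" using uv by (simp add: basis_def)
  have "N > 0 \<and> of_nat N * v \<in> L"
    using N zspan_gens(2)[of v u] uv_span by simp
  then have kk: "kk > 0" "of_nat kk * v \<in> L" "\<And>n. n > 0 \<Longrightarrow> of_nat n * v \<in> L \<Longrightarrow> kk \<le> n"
    unfolding kk_def
    using LeastI[of "\<lambda>n. n > 0 \<and> of_nat n * v \<in> L" N]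
      Least_le[of "\<lambda>n. n > 0 \<and> of_nat n * v \<in> L"] by blast+
  have "int m dvd int kk" using coords[of 0 "int kk"] kk by simp
  then have "m dvd kk" by simp
  then obtain k where k: "kk = m * k" by (rule dvdE)
  have kkdvd: "int kk dvd b" if "of_int b * v \<in> L" for b
  proof -
    have "of_int (b mod int kk) * v = of_int b * v - of_int (b div int kk) * (of_nat kk * v)"
    proof -
      have "(of_int b :: complex) = of_int (int kk * (b div int kk) + b mod int kk)" by simp
      then show ?thesis by (simp only: of_int_add of_int_mult) (simp add: algebra_simps)
    qed
    then have "of_int (b mod int kk) * v \<in> L"
      using that kk L by (metis add_subgroup_diff add_subgroup_of_int_mult)
    moreover have "0 \<le> b mod int kk" "b mod int kk < int kk" using kk(1) by auto
    ultimately have "b mod int kk = 0"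
      using kk(3)[of "nat (b mod int kk)"] by force
    then show ?thesis by auto
  qed
  have "L = zspan (of_nat m * u) (of_nat (m * k) * v)"
  proof (intro equalityI subsetI)
    fix x assume x: "x \<in> L"
    with L(2) uv_span have "x \<in> zspan u v" by blast
    then obtain a b where ab: "x = of_int a * u + of_int b * v" by (rule zspanE)
    from coords x ab have "int m dvd a" "int kk dvd b" using kkdvd by auto
    then obtain c e where "a = int m * c" "b = int (m * k) * e" unfolding k by (elim dvdE)
    then show "x \<in> zspan (of_nat m * u) (of_nat (m * k) * v)"
      by (intro zspanI[of _ c _ e]) (simp add: ab algebra_simps)
  next
    show "x \<in> L" if "x \<in> zspan (of_nat m * u) (of_nat (m * k) * v)" for x
      using that zspan_least[OF L(1) muL] kk(2) by (auto simp: k)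
  qed
  moreover have "k > 0" using k kk by (cases k) auto
  ultimately show ?thesis using uv mpos that by (auto simp: basis_def)
qed

section \<open>Discreteness and shortest vectors\<close>

lemma finite_zspan_cball:
  assumes "Im (cnj u * v) \<noteq> 0"
  shows "finite (zspan u v \<inter> cball 0 R)"
proof -
  define D where "D = \<bar>Im (cnj u * v)\<bar>"
  have D: "D > 0" using assms by (simp add: D_def)
  define M where "M = \<lceil>(norm u + norm v) * R / D\<rceil>"
  have bound: "\<bar>b\<bar> \<le> M" if "\<bar>of_int b\<bar> * D \<le> norm w * norm x" "norm x \<le> R" "norm w \<le> norm u + norm v"
    for b :: int and w x :: complex
  proof -
    have "norm w * norm x \<le> (norm u + norm v) * R" using that by (intro mult_mono) auto
    then have "of_int \<bar>b\<bar> \<le> (norm u + norm v) * R / D" using that D by (simp add: field_simps)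
    then show ?thesis unfolding M_def by linarith
  qed
  have "zspan u v \<inter> cball 0 R \<subseteq> (\<lambda>(a, b). of_int a * u + of_int b * v) ` ({-M..M} \<times> {-M..M})"
  proof
    fix x assume "x \<in> zspan u v \<inter> cball 0 R"
    then have "x \<in> zspan u v" "norm x \<le> R" by auto
    moreover from this(1) obtain a b where "x = of_int a * u + of_int b * v" by (rule zspanE)
    ultimately have x: "x = of_int a * u + of_int b * v" "norm x \<le> R" by auto
    \<comment> \<open>Cramer's rule: \<open>Im (cnj p * q)\<close> is the determinant of
      \<open>p\<close> and \<open>q\<close>. Pairing \<open>x\<close> with \<open>u\<close> or
      \<open>v\<close> isolates one coordinate, which is therefore bounded by a multiple of
      \<open>norm x\<close>.\<close>
    have "Im (cnj u * x) = of_int b * Im (cnj u * v)" "Im (cnj v * x) = - of_int a * Im (cnj u * v)"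
      unfolding x by (simp_all add: algebra_simps)
    then have "\<bar>of_int b\<bar> * D \<le> norm u * norm x" "\<bar>of_int a\<bar> * D \<le> norm v * norm x"
      using abs_Im_le_cmod[of "cnj u * x"] abs_Im_le_cmod[of "cnj v * x"]
      by (simp_all add: D_def abs_mult norm_mult)
    then have "\<bar>b\<bar> \<le> M" "\<bar>a\<bar> \<le> M" using x(2) by (auto intro!: bound)
    then show "x \<in> (\<lambda>(a, b). of_int a * u + of_int b * v) ` ({-M..M} \<times> {-M..M})"
      unfolding x(1) by (intro image_eqI[of _ _ "(a, b)"]) auto
  qed
  then show ?thesis by (rule finite_subset) auto
qed

lemma zspan_shortest_vector:
  assumes "Im (cnj u * v) \<noteq> 0"
  obtains w where "w \<in> zspan u v" "w \<noteq> 0" "\<And>x. x \<in> zspan u v \<Longrightarrow> x \<noteq> 0 \<Longrightarrow> norm w \<le> norm x"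
proof -
  define A where "A = (zspan u v \<inter> cball 0 (norm u)) - {0}"
  have A: "finite A" "u \<in> A"
    using finite_zspan_cball[OF assms] zspan_gens assms by (auto simp: A_def)
  define w where "w = arg_min_on norm A"
  have w: "w \<in> A" "\<And>x. x \<in> A \<Longrightarrow> norm w \<le> norm x"
    using arg_min_if_finite(1)[of A norm] arg_min_least[of A _ norm] A by (auto simp: w_def)
  have "norm w \<le> norm x" if "x \<in> zspan u v" "x \<noteq> 0" for x
    using that w w(2)[OF A(2)] by (cases "norm x \<le> norm u") (auto simp: A_def)
  with w(1) that show ?thesis by (auto simp: A_def)
qed

text \<open>Any shortest vector \<open>w\<close> will do, because the open unit discs around the points of \<open>\<int>[\<zeta>]\<close>
  cover the plane.\<close>

lemma zspan_principal:
  assumes nd: "Im (cnj u * v) \<noteq> 0" and \<zeta>: "0 < Im \<zeta>" "Im \<zeta> \<le> 1"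
    and cl: "\<And>x. x \<in> zspan u v \<Longrightarrow> \<zeta> * x \<in> zspan u v"
  obtains w where "zspan u v = zspan w (\<zeta> * w)"
proof -
  obtain w where w: "w \<in> zspan u v" "w \<noteq> 0"
    and short: "\<And>x. x \<in> zspan u v \<Longrightarrow> x \<noteq> 0 \<Longrightarrow> norm w \<le> norm x"
    using zspan_shortest_vector[OF nd] by metis
  have "x \<in> zspan w (\<zeta> * w)" if x: "x \<in> zspan u v" for x
  proof -
    define q where "q = x / w"
    \<comment> \<open>Rounding the coordinates of \<open>q\<close> with respect to 1 and \<zeta>
      leaves a remainder \<open>r\<close> whose real and imaginary parts are at most 1/2 in absolute
      value, the latter because \<open>Im \<zeta> \<le> 1\<close>. Hence \<open>norm r < 1\<close>,
      and \<open>r * w\<close>, a lattice vector shorter than \<open>w\<close>, is 0.\<close>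
    define b where "b = round (Im q / Im \<zeta>)"
    define a where "a = round (Re q - of_int b * Re \<zeta>)"
    define r where "r = q - (of_int a + of_int b * \<zeta>)"
    have "Im r = (Im q / Im \<zeta> - of_int b) * Im \<zeta>" using \<zeta> by (simp add: r_def field_simps)
    moreover have "\<bar>Im q / Im \<zeta> - of_int b\<bar> \<le> 1/2"
      using of_int_round_abs_le[of "Im q / Im \<zeta>"] by (simp add: b_def abs_minus_commute)
    ultimately have "\<bar>Im r\<bar> \<le> 1/2 * 1" using \<zeta> by (simp only: abs_mult) (intro mult_mono, auto)
    moreover have "\<bar>Re r\<bar> \<le> 1/2"
      using of_int_round_abs_le[of "Re q - of_int b * Re \<zeta>"]
      by (simp add: r_def a_def abs_minus_commute algebra_simps)
    ultimately have "(Re r)\<^sup>2 \<le> (1/2)\<^sup>2" "(Im r)\<^sup>2 \<le> (1/2)\<^sup>2"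
      by (auto simp only: abs_le_square_iff[symmetric])
    then have "(norm r)\<^sup>2 < 1\<^sup>2" unfolding cmod_power2 by (simp add: power_divide)
    then have r1: "norm r < 1" by (rule power_less_imp_less_base) simp
    have rw: "r * w = x - (of_int a * w + of_int b * (\<zeta> * w))"
      using w(2) by (simp add: r_def q_def field_simps)
    have "r * w \<in> zspan u v"
      unfolding rw by (intro add_subgroup_diff add_subgroup_add add_subgroup_of_int_mult
          add_subgroup_zspan x w cl)
    moreover have "norm (r * w) < norm w" using r1 w(2) by (simp add: norm_mult)
    ultimately have "r * w = 0" using short by fastforce
    then show ?thesis by (intro zspanI[of _ a _ b]) (simp add: rw)
  qed
  moreover have "zspan w (\<zeta> * w) \<subseteq> zspan u v"
    by (intro zspan_least add_subgroup_zspan w cl)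
  ultimately show ?thesis using that by blast
qed

section \<open>Affine lifts of the automorphisms of a torus\<close>

lemma add_subgroup_period_lattice: "add_subgroup (period_lattice \<omega>)"
  by (simp add: period_lattice_eq_zspan add_subgroup_zspan)

lemma torus_proj_eq_iff: "torus_proj \<omega> z = torus_proj \<omega> w \<longleftrightarrow> z - w \<in> period_lattice \<omega>"
proof
  assume "torus_proj \<omega> z = torus_proj \<omega> w"
  moreover have "z \<in> torus_proj \<omega> z"
    by (simp add: torus_proj_def add_subgroup_0 add_subgroup_period_lattice)
  ultimately show "z - w \<in> period_lattice \<omega>" by (auto simp: torus_proj_def)
next
  assume zw: "z - w \<in> period_lattice \<omega>"
  have "x - z \<in> period_lattice \<omega> \<longleftrightarrow> x - w \<in> period_lattice \<omega>" for x
    using add_subgroup_add[OF add_subgroup_period_lattice _ zw, of "x - z"]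
      add_subgroup_diff[OF add_subgroup_period_lattice _ zw, of "x - w"] by auto
  then show "torus_proj \<omega> z = torus_proj \<omega> w" by (simp add: torus_proj_def)
qed

lemma period_lattice_discrete:
  assumes "Im \<omega> \<noteq> 0"
  obtains e where "e > 0" "\<And>x. x \<in> period_lattice \<omega> \<Longrightarrow> norm x < e \<Longrightarrow> x = 0"
proof -
  have "Im (cnj 1 * \<omega>) \<noteq> 0" using assms by simp
  then show ?thesis
  proof (rule zspan_shortest_vector)
    fix w :: complex assume "w \<noteq> 0" "\<And>x. x \<in> zspan 1 \<omega> \<Longrightarrow> x \<noteq> 0 \<Longrightarrow> norm w \<le> norm x"
    then show ?thesis by (intro that[of "norm w"]) (force simp: period_lattice_eq_zspan)+
  qed
qed

text \<open>A nonconstant affine map is onto the plane, whereas 0 is isolated in the lattice. The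
  uniqueness of multipliers rests on this.\<close>

lemma affine_into_period_lattice:
  assumes "Im \<omega> \<noteq> 0" and aff: "\<And>z. a * z + b \<in> period_lattice \<omega>"
  shows "a = 0"
proof (rule ccontr)
  assume a: "a \<noteq> 0"
  obtain e where e: "e > 0" "\<And>x. x \<in> period_lattice \<omega> \<Longrightarrow> norm x < e \<Longrightarrow> x = 0"
    using period_lattice_discrete[OF assms(1)] by metis
  define x where "x = (of_real (e / 2) :: complex)"
  have "(a * (x / a) + b) - (a * 0 + b) \<in> period_lattice \<omega>"
    by (intro add_subgroup_diff add_subgroup_period_lattice aff)
  then have "x \<in> period_lattice \<omega>" using a by simp
  moreover have "norm x < e" "x \<noteq> 0" using e(1) by (auto simp: x_def)
  ultimately show False using e(2) by blast
qed

text \<open>A continuous function with values in a discrete set is locally constant.\<close>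

lemma eventually_diff_const:
  assumes "Im \<omega> \<noteq> 0" "isCont g z0" "isCont h z0"
    and "\<forall>\<^sub>F z in nhds z0. g z - h z \<in> period_lattice \<omega>"
  shows "\<forall>\<^sub>F z in nhds z0. g z = h z + (g z0 - h z0)"
proof -
  obtain e where e: "e > 0" "\<And>x. x \<in> period_lattice \<omega> \<Longrightarrow> norm x < e \<Longrightarrow> x = 0"
    using period_lattice_discrete[OF assms(1)] by metis
  have "isCont (\<lambda>z. g z - h z) z0" using assms by (intro continuous_intros)
  then have "filterlim (\<lambda>z. g z - h z) (nhds (g z0 - h z0)) (nhds z0)"
    using tendsto_at_iff_tendsto_nhds[of "\<lambda>z. g z - h z" z0] by (simp add: isCont_def)
  then have "\<forall>\<^sub>F z in nhds z0. dist (g z - h z) (g z0 - h z0) < e"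
    using e(1) by (rule tendstoD)
  with assms(4) show ?thesis
  proof eventually_elim
    case (elim z)
    have "g z0 - h z0 \<in> period_lattice \<omega>" using assms(4) by (rule eventually_nhds_x_imp_x)
    from e(2)[OF add_subgroup_diff[OF add_subgroup_period_lattice elim(1) this]] elim(2)
    have "(g z - h z) - (g z0 - h z0) = 0" by (simp add: dist_norm)
    then show ?case by (simp add: algebra_simps)
  qed
qed

text \<open>Two local lifts differ near \<open>z0\<close> by a constant. So the derivative depends
  on \<open>f\<close> alone, which is what allows the derivatives to be glued.\<close>

lemma torus_lift_deriv_unique:
  assumes "Im \<omega> \<noteq> 0" "open U" "z0 \<in> U" "open V" "z0 \<in> V"
    and "g holomorphic_on U" "h holomorphic_on V"
    and "\<And>z. z \<in> U \<Longrightarrow> f z = torus_proj \<omega> (g z)"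
    and "\<And>z. z \<in> V \<Longrightarrow> f z = torus_proj \<omega> (h z)"
  shows "deriv g z0 = deriv h z0"
proof -
  have "\<forall>\<^sub>F z in nhds z0. z \<in> U \<inter> V"
    by (rule eventually_nhds_in_open) (use assms in auto)
  then have "\<forall>\<^sub>F z in nhds z0. g z - h z \<in> period_lattice \<omega>"
    by eventually_elim (use assms(8,9) in \<open>auto simp flip: torus_proj_eq_iff\<close>)
  moreover have cont: "isCont g z0" "isCont h z0"
    using assms by (meson holomorphic_on_imp_continuous_on continuous_on_eq_continuous_at)+
  ultimately have "\<forall>\<^sub>F z in nhds z0. g z = h z + (g z0 - h z0)"
    by (intro eventually_diff_const[OF assms(1)])
  then have "deriv g z0 = deriv (\<lambda>z. h z + (g z0 - h z0)) z0"
    by (intro deriv_cong_ev) auto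
  also have "\<dots> = deriv h z0"
    using assms holomorphic_on_imp_differentiable_at[of h V z0] by simp
  finally show ?thesis .
qed

text \<open>The derivatives of the local lifts glue to an entire doubly periodic function, which is
  constant by Liouville's theorem. So the local lifts are affine with a common slope, and their
  constant terms, taken modulo the lattice, are locally constant on the plane.\<close>

lemma torus_holomorphic_affine_lift:
  assumes \<omega>: "Im \<omega> \<noteq> 0" and f: "torus_holomorphic \<omega> f"
  obtains \<alpha> \<beta> where "\<And>z. f (torus_proj \<omega> z) = torus_proj \<omega> (\<alpha> * z + \<beta>)"
proof -
  obtain U g where U: "\<And>z. open (U z)" "\<And>z. z \<in> U z" and hol: "\<And>z. g z holomorphic_on U z"
    and lift: "\<And>z0 z. z \<in> U z0 \<Longrightarrow> f (torus_proj \<omega> z) = torus_proj \<omega> (g z0 z)"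
    using f unfolding torus_holomorphic_def by metis
  define D where "D z = deriv (g z) z" for z
  have D_eq: "D z = deriv h z"
    if "open V" "z \<in> V" "h holomorphic_on V"
      "\<And>x. x \<in> V \<Longrightarrow> f (torus_proj \<omega> x) = torus_proj \<omega> (h x)" for V h z
    unfolding D_def
    by (rule torus_lift_deriv_unique[where f = "\<lambda>z. f (torus_proj \<omega> z)", OF \<omega> U(1,2) that(1,2)])
       (use hol lift that in auto)
  have D_loc: "D z = deriv (g z0) z" if "z \<in> U z0" for z z0
    using D_eq[OF U(1) that hol lift] .
  have D_hol: "D holomorphic_on UNIV"
  proof -
    have "D holomorphic_on U z0" for z0
      using holomorphic_deriv[OF hol U(1)] by (rule holomorphic_transform) (simp add: D_loc)
    then have "D holomorphic_on (\<Union>z0. U z0)" by (intro holomorphic_on_UN_open U) auto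
    moreover have "(\<Union>z0. U z0) = UNIV" using U(2) by auto
    ultimately show ?thesis by simp
  qed
  have D_period: "D (z + l) = D z" if l: "l \<in> period_lattice \<omega>" for z l
  proof -
    \<comment> \<open>A lift near \<open>z + l\<close>, moved back by the period \<open>l\<close>,
      is a lift of \<open>f\<close> near \<open>z\<close>.\<close>
    let ?h = "\<lambda>x. g (z + l) (x + l)" and ?V = "(\<lambda>x. x + l) -` U (z + l)"
    have "D z = deriv ?h z"
    proof (rule D_eq)
      show "open ?V" by (intro open_vimage U continuous_intros)
      show "z \<in> ?V" using U(2) by simp
      have "(g (z + l) \<circ> (\<lambda>x. x + l)) holomorphic_on ?V"
        by (rule holomorphic_on_compose_gen[OF _ hol]) (auto intro!: holomorphic_intros)
      then show "?h holomorphic_on ?V" by (simp add: o_def)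
      show "f (torus_proj \<omega> x) = torus_proj \<omega> (?h x)" if "x \<in> ?V" for x
      proof -
        have "torus_proj \<omega> x = torus_proj \<omega> (x + l)"
          using add_subgroup_uminus[OF add_subgroup_period_lattice l] by (simp add: torus_proj_eq_iff)
        then show ?thesis using lift that by auto
      qed
    qed
    also have "(?h has_field_derivative deriv (g (z + l)) (z + l)) (at z)"
      using holomorphic_derivI[OF hol U(1) U(2), of "z + l" UNIV] by (simp only: DERIV_shift)
    then have "deriv ?h z = D (z + l)" unfolding D_def by (rule DERIV_imp_deriv)
    finally show ?thesis by simp
  qed
  have "bounded (range D)"
  proof -
    \<comment> \<open>A compact fundamental parallelogram: subtracting the integer parts of the real
      coordinates moves every point into it.\<close>
    define K where "K = (\<lambda>(s, t). of_real s + of_real t * \<omega>) ` ({0..1} \<times> {0..1} :: (real \<times> real) set)"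
    have "compact K"
      unfolding K_def split_beta by (intro compact_continuous_image continuous_intros compact_Times compact_Icc)
    then have "bounded (D ` K)"
      using D_hol by (meson compact_continuous_image compact_imp_bounded continuous_on_subset
          holomorphic_on_imp_continuous_on subset_UNIV)
    moreover have "D z \<in> D ` K" for z
    proof -
      define t where "t = Im z / Im \<omega>"
      define s where "s = Re z - t * Re \<omega>"
      have z: "z = of_real s + of_real t * \<omega>"
        using \<omega> by (simp add: complex_eq_iff s_def t_def)
      define l where "l = of_int (\<lfloor>s\<rfloor>) + of_int (\<lfloor>t\<rfloor>) * \<omega>"
      have "l \<in> period_lattice \<omega>" by (auto simp: l_def period_lattice_def)
      from D_period[OF this, of "z - l"] have "D z = D (z - l)" by simp
      moreover have "z - l = of_real (frac s) + of_real (frac t) * \<omega>"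
        by (simp add: z l_def frac_def algebra_simps)
      then have "z - l \<in> K"
        unfolding K_def
        by (intro image_eqI[of _ _ "(frac s, frac t)"]) (auto simp: frac_lt_1 less_imp_le)
      ultimately show ?thesis by simp
    qed
    ultimately show ?thesis by (meson bounded_subset image_subsetI)
  qed
  then obtain \<alpha> where \<alpha>: "\<And>z. D z = \<alpha>"
    using Liouville_theorem[OF D_hol] by (auto simp: constant_on_def)
  \<comment> \<open>The class of the constant term at \<open>z\<close>. Near \<open>z0\<close> the
    single lift \<open>g z0\<close> may replace every \<open>g z\<close>, because lifts agree at a
    common point modulo the lattice.\<close>
  define B where "B z = torus_proj \<omega> (g z z - \<alpha> * z)" for z
  have "B constant_on UNIV"
  proof (rule locally_constant_imp_constant)
    fix z0 :: complex
    obtain r where r: "r > 0" "ball z0 r \<subseteq> U z0" using U open_contains_ball by metis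
    have "\<exists>c. \<forall>z\<in>ball z0 r. g z0 z - \<alpha> * z = c"
    proof (rule has_field_derivative_zero_constant)
      fix z assume z: "z \<in> ball z0 r"
      then have z': "z \<in> U z0" using r by blast
      have "(g z0 has_field_derivative \<alpha>) (at z within ball z0 r)"
        using holomorphic_derivI[OF hol U(1) z'] D_loc[OF z'] \<alpha> by metis
      then show "((\<lambda>z. g z0 z - \<alpha> * z) has_field_derivative 0) (at z within ball z0 r)"
        using DERIV_diff[OF _ DERIV_cmult_Id[of \<alpha> z "ball z0 r"], of "g z0" \<alpha>] by simp
    qed simp
    then obtain c where c: "\<And>z. z \<in> ball z0 r \<Longrightarrow> g z0 z - \<alpha> * z = c" by blast
    have "B z = torus_proj \<omega> c" if z: "z \<in> ball z0 r" for z
    proof -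
      have "torus_proj \<omega> (g z z) = torus_proj \<omega> (g z0 z)"
        using lift[of z z0] lift[of z z] U(2) z r by auto
      then show ?thesis unfolding B_def c[OF z, symmetric] by (simp add: torus_proj_eq_iff)
    qed
    then show "\<exists>T. openin (top_of_set UNIV) T \<and> z0 \<in> T \<and> (\<forall>x\<in>T. B x = B z0)"
      using r by (intro exI[of _ "ball z0 r"]) auto
  qed (rule connected_UNIV)
  then have "B z = B 0" for z by (auto simp: constant_on_def)
  then have B: "B z = torus_proj \<omega> (g 0 0)" for z using B_def[of 0] by simp
  have "f (torus_proj \<omega> z) = torus_proj \<omega> (\<alpha> * z + g 0 0)" for z
    using lift[OF U(2), of z] B[of z] by (simp add: B_def torus_proj_eq_iff algebra_simps)
  then show ?thesis by (rule that)
qed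

section \<open>Automorphisms as affine maps\<close>

definition lattice_unit :: "complex \<Rightarrow> complex \<Rightarrow> bool" where
  "lattice_unit \<omega> \<alpha> \<longleftrightarrow> (\<lambda>x. \<alpha> * x) ` period_lattice \<omega> = period_lattice \<omega>"

lemma lattice_unit_nonzero: "lattice_unit \<omega> \<alpha> \<Longrightarrow> \<alpha> \<noteq> 0"
proof
  assume *: "lattice_unit \<omega> \<alpha>" "\<alpha> = 0"
  have "1 \<in> period_lattice \<omega>" by (simp add: period_lattice_eq_zspan zspan_gens)
  then obtain x where "1 = \<alpha> * x" using *(1) unfolding lattice_unit_def by blast
  with *(2) show False by simp
qed

lemma lattice_unit_mult_iff: "lattice_unit \<omega> \<alpha> \<Longrightarrow> \<alpha> * x \<in> period_lattice \<omega> \<longleftrightarrow> x \<in> period_lattice \<omega>"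
proof
  assume u: "lattice_unit \<omega> \<alpha>" and "\<alpha> * x \<in> period_lattice \<omega>"
  then obtain y where "\<alpha> * x = \<alpha> * y" "y \<in> period_lattice \<omega>"
    unfolding lattice_unit_def by blast
  with lattice_unit_nonzero[OF u] show "x \<in> period_lattice \<omega>" by simp
qed (auto simp: lattice_unit_def)

lemma lattice_unitI:
  assumes "\<alpha> \<noteq> 0" "\<And>x. x \<in> period_lattice \<omega> \<Longrightarrow> \<alpha> * x \<in> period_lattice \<omega>"
    "\<And>x. x \<in> period_lattice \<omega> \<Longrightarrow> x / \<alpha> \<in> period_lattice \<omega>"
  shows "lattice_unit \<omega> \<alpha>"
  unfolding lattice_unit_def
proof (intro equalityI subsetI)
  fix x assume "x \<in> period_lattice \<omega>"
  then show "x \<in> (\<lambda>x. \<alpha> * x) ` period_lattice \<omega>"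
    using assms by (intro image_eqI[of _ _ "x / \<alpha>"]) auto
qed (use assms in auto)

lemma lattice_unit_1: "lattice_unit \<omega> 1"
  by (simp add: lattice_unit_def)

lemma lattice_unit_mult: "lattice_unit \<omega> \<alpha> \<Longrightarrow> lattice_unit \<omega> \<beta> \<Longrightarrow> lattice_unit \<omega> (\<alpha> * \<beta>)"
proof (rule lattice_unitI)
  assume u: "lattice_unit \<omega> \<alpha>" "lattice_unit \<omega> \<beta>"
  show "\<alpha> * \<beta> \<noteq> 0" using u lattice_unit_nonzero by simp
  show "\<alpha> * \<beta> * x \<in> period_lattice \<omega>" if "x \<in> period_lattice \<omega>" for x
    using that u by (simp add: lattice_unit_mult_iff mult.assoc)
  show "x / (\<alpha> * \<beta>) \<in> period_lattice \<omega>" if "x \<in> period_lattice \<omega>" for x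
    using that u lattice_unit_mult_iff[OF u(1), of "\<beta> * (x / (\<alpha> * \<beta>))"]
      lattice_unit_mult_iff[OF u(2), of "x / (\<alpha> * \<beta>)"] lattice_unit_nonzero
    by (simp add: mult.assoc[symmetric])
qed

lemma lattice_unit_inverse: "lattice_unit \<omega> \<alpha> \<Longrightarrow> lattice_unit \<omega> (inverse \<alpha>)"
  using lattice_unit_nonzero[of \<omega> \<alpha>] lattice_unit_mult_iff[of \<omega> \<alpha> "inverse \<alpha> * x" for x]
    lattice_unit_mult_iff[of \<omega> \<alpha>]
  by (intro lattice_unitI) (auto simp: field_simps)

lemma lattice_unit_power_int: "lattice_unit \<omega> \<alpha> \<Longrightarrow> lattice_unit \<omega> (\<alpha> powi j)"
proof -
  assume a: "lattice_unit \<omega> \<alpha>"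
  have "lattice_unit \<omega> (\<alpha> ^ n)" for n
    by (induction n) (auto intro: lattice_unit_mult lattice_unit_1 a)
  then show ?thesis by (auto simp: power_int_def lattice_unit_inverse power_inverse)
qed

text \<open>The value does not depend on the chosen representative once \<alpha> preserves the
  lattice. The restriction to \<open>torus \<omega>\<close> makes the map extensional, like the
  elements of \<open>BijGroup\<close>.\<close>

definition torus_map :: "complex \<Rightarrow> complex \<Rightarrow> complex \<Rightarrow> complex set \<Rightarrow> complex set" where
  "torus_map \<omega> \<alpha> \<beta> = (\<lambda>C\<in>torus \<omega>. torus_proj \<omega> (\<alpha> * (SOME z. torus_proj \<omega> z = C) + \<beta>))"

lemma torus_proj_in_torus [simp]: "torus_proj \<omega> z \<in> torus \<omega>"
  by (simp add: torus_def)

lemma torus_map_proj: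
  assumes "lattice_unit \<omega> \<alpha>"
  shows "torus_map \<omega> \<alpha> \<beta> (torus_proj \<omega> z) = torus_proj \<omega> (\<alpha> * z + \<beta>)"
proof -
  define w where "w = (SOME w. torus_proj \<omega> w = torus_proj \<omega> z)"
  have "torus_proj \<omega> w = torus_proj \<omega> z" unfolding w_def by (rule someI) simp
  then have "\<alpha> * (w - z) \<in> period_lattice \<omega>"
    using lattice_unit_mult_iff[OF assms] by (simp add: torus_proj_eq_iff)
  then have "torus_proj \<omega> (\<alpha> * w + \<beta>) = torus_proj \<omega> (\<alpha> * z + \<beta>)"
    by (simp add: torus_proj_eq_iff algebra_simps)
  then show ?thesis unfolding w_def by (simp add: torus_map_def)
qed

lemma torus_fun_eqI:
  assumes "f \<in> extensional (torus \<omega>)" "g \<in> extensional (torus \<omega>)"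
    "\<And>z. f (torus_proj \<omega> z) = g (torus_proj \<omega> z)"
  shows "f = g"
  using assms by (intro extensionalityI[of f "torus \<omega>"]) (auto simp: torus_def)

lemma torus_map_extensional: "torus_map \<omega> \<alpha> \<beta> \<in> extensional (torus \<omega>)"
  by (simp add: torus_map_def)

lemma torus_map_inverse:
  assumes "lattice_unit \<omega> \<alpha>"
  shows "torus_map \<omega> (inverse \<alpha>) (- \<beta> / \<alpha>) (torus_map \<omega> \<alpha> \<beta> (torus_proj \<omega> z)) = torus_proj \<omega> z"
    "torus_map \<omega> \<alpha> \<beta> (torus_map \<omega> (inverse \<alpha>) (- \<beta> / \<alpha>) (torus_proj \<omega> z)) = torus_proj \<omega> z"
  using assms lattice_unit_inverse[OF assms] lattice_unit_nonzero[OF assms]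
  by (simp_all add: torus_map_proj field_simps)

lemma torus_map_Bij:
  assumes "lattice_unit \<omega> \<alpha>" shows "torus_map \<omega> \<alpha> \<beta> \<in> Bij (torus \<omega>)"
proof -
  have "bij_betw (torus_map \<omega> \<alpha> \<beta>) (torus \<omega>) (torus \<omega>)"
    by (rule bij_betw_byWitness[of _ "torus_map \<omega> (inverse \<alpha>) (- \<beta> / \<alpha>)"])
       (use torus_map_inverse[OF assms] torus_map_proj[OF assms]
          torus_map_proj[OF lattice_unit_inverse[OF assms]] in \<open>auto simp: torus_def\<close>)
  then show ?thesis by (simp add: Bij_def torus_map_extensional)
qed

lemma torus_holomorphicI:
  assumes "\<And>z. f (torus_proj \<omega> z) = torus_proj \<omega> (\<alpha> * z + \<beta>)"
  shows "torus_holomorphic \<omega> f"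
  unfolding torus_holomorphic_def
  by (intro allI exI[of _ UNIV] exI[of _ "\<lambda>z. \<alpha> * z + \<beta>"]) (auto intro!: holomorphic_intros assms)

lemma torus_map_in_carrier:
  assumes "lattice_unit \<omega> \<alpha>" shows "torus_map \<omega> \<alpha> \<beta> \<in> carrier (torus_aut \<omega>)"
proof -
  have "inv_into (torus \<omega>) (torus_map \<omega> \<alpha> \<beta>) (torus_proj \<omega> z)
      = torus_proj \<omega> (inverse \<alpha> * z + (- \<beta> / \<alpha>))" for z
  proof (rule inv_into_f_eq)
    show "inj_on (torus_map \<omega> \<alpha> \<beta>) (torus \<omega>)"
      using torus_map_Bij[OF assms] by (auto simp: Bij_def bij_betw_def)
    show "torus_map \<omega> \<alpha> \<beta> (torus_proj \<omega> (inverse \<alpha> * z + (- \<beta> / \<alpha>))) = torus_proj \<omega> z"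
      using torus_map_inverse(2)[OF assms, of \<beta> z]
      by (simp add: torus_map_proj[OF lattice_unit_inverse[OF assms]])
  qed simp
  from torus_holomorphicI[OF this] show ?thesis
    using torus_holomorphicI[OF torus_map_proj[OF assms]] torus_map_Bij[OF assms]
    by (simp add: torus_aut_def)
qed

text \<open>The lifts of \<sigma> and of its inverse have slopes \<alpha> and \<gamma>. Their
  composite is the identity modulo the lattice, so \<alpha> \<gamma> = 1. Both slopes map the
  lattice into itself, hence \<alpha> maps it onto itself, which excludes the slopes of isogenies of
  higher degree.\<close>

lemma carrier_torus_autE:
  assumes \<omega>: "Im \<omega> \<noteq> 0" and \<sigma>: "\<sigma> \<in> carrier (torus_aut \<omega>)"
  obtains \<alpha> \<beta> where "lattice_unit \<omega> \<alpha>" "\<sigma> = torus_map \<omega> \<alpha> \<beta>"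
proof -
  let ?\<tau> = "inv_into (torus \<omega>) \<sigma>"
  have bij: "bij_betw \<sigma> (torus \<omega>) (torus \<omega>)" and ext: "\<sigma> \<in> extensional (torus \<omega>)"
    and hol: "torus_holomorphic \<omega> \<sigma>" "torus_holomorphic \<omega> ?\<tau>"
    using \<sigma> by (auto simp: torus_aut_def Bij_def)
  obtain \<alpha> \<beta> where 1: "\<And>z. \<sigma> (torus_proj \<omega> z) = torus_proj \<omega> (\<alpha> * z + \<beta>)"
    using torus_holomorphic_affine_lift[OF \<omega> hol(1)] by metis
  obtain \<gamma> \<delta> where 2: "\<And>z. ?\<tau> (torus_proj \<omega> z) = torus_proj \<omega> (\<gamma> * z + \<delta>)"
    using torus_holomorphic_affine_lift[OF \<omega> hol(2)] by metis
  have preserve: "a * x \<in> period_lattice \<omega>"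
    if "x \<in> period_lattice \<omega>" "\<And>z. f (torus_proj \<omega> z) = torus_proj \<omega> (a * z + b)" for f a b x
  proof -
    have "torus_proj \<omega> x = torus_proj \<omega> 0" using that(1) by (simp add: torus_proj_eq_iff)
    then have "torus_proj \<omega> (a * x + b) = torus_proj \<omega> (a * 0 + b)" using that(2) by metis
    then show ?thesis by (simp add: torus_proj_eq_iff)
  qed
  have "\<alpha> * \<gamma> - 1 = 0"
  proof (rule affine_into_period_lattice[OF \<omega>])
    fix z
    have "\<sigma> (?\<tau> (torus_proj \<omega> z)) = torus_proj \<omega> z"
      using bij by (intro f_inv_into_f) (auto simp: bij_betw_def)
    then show "(\<alpha> * \<gamma> - 1) * z + (\<alpha> * \<delta> + \<beta>) \<in> period_lattice \<omega>"
      by (simp add: 1 2 torus_proj_eq_iff algebra_simps)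
  qed
  then have "\<alpha> * \<gamma> = 1" by simp
  then have \<gamma>: "\<alpha> \<noteq> 0" "\<And>x. x / \<alpha> = \<gamma> * x"
    using inverse_unique[of \<alpha> \<gamma>] by (auto simp: divide_inverse)
  have unit: "lattice_unit \<omega> \<alpha>"
    using \<gamma> preserve[OF _ 1] preserve[OF _ 2] by (intro lattice_unitI) auto
  moreover have "\<sigma> = torus_map \<omega> \<alpha> \<beta>"
    by (rule torus_fun_eqI[OF ext torus_map_extensional]) (simp add: 1 torus_map_proj[OF unit])
  ultimately show ?thesis by (rule that)
qed

lemma torus_map_mult:
  assumes "lattice_unit \<omega> \<alpha>" "lattice_unit \<omega> \<gamma>"
  shows "torus_map \<omega> \<alpha> \<beta> \<otimes>\<^bsub>torus_aut \<omega>\<^esub> torus_map \<omega> \<gamma> \<delta> = torus_map \<omega> (\<alpha> * \<gamma>) (\<alpha> * \<delta> + \<beta>)"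
proof (rule torus_fun_eqI)
  have m: "torus_map \<omega> \<alpha> \<beta> \<otimes>\<^bsub>torus_aut \<omega>\<^esub> torus_map \<omega> \<gamma> \<delta>
      = compose (torus \<omega>) (torus_map \<omega> \<alpha> \<beta>) (torus_map \<omega> \<gamma> \<delta>)"
    using assms by (simp add: torus_aut_def BijGroup_def torus_map_Bij)
  show "torus_map \<omega> \<alpha> \<beta> \<otimes>\<^bsub>torus_aut \<omega>\<^esub> torus_map \<omega> \<gamma> \<delta> \<in> extensional (torus \<omega>)"
    unfolding m by (rule compose_extensional)
  show "(torus_map \<omega> \<alpha> \<beta> \<otimes>\<^bsub>torus_aut \<omega>\<^esub> torus_map \<omega> \<gamma> \<delta>) (torus_proj \<omega> z)
      = torus_map \<omega> (\<alpha> * \<gamma>) (\<alpha> * \<delta> + \<beta>) (torus_proj \<omega> z)" for z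
    unfolding m
    by (simp add: compose_eq torus_map_proj assms lattice_unit_mult algebra_simps)
qed (rule torus_map_extensional)

lemma torus_map_one: "\<one>\<^bsub>torus_aut \<omega>\<^esub> = torus_map \<omega> 1 0"
  by (rule torus_fun_eqI)
    (auto simp: torus_aut_def BijGroup_def torus_map_proj[OF lattice_unit_1] torus_map_extensional)

lemma torus_map_eq_iff:
  assumes "Im \<omega> \<noteq> 0" "lattice_unit \<omega> \<alpha>" "lattice_unit \<omega> \<gamma>"
  shows "torus_map \<omega> \<alpha> \<beta> = torus_map \<omega> \<gamma> \<delta> \<longleftrightarrow> \<alpha> = \<gamma> \<and> \<beta> - \<delta> \<in> period_lattice \<omega>"
proof
  assume eq: "torus_map \<omega> \<alpha> \<beta> = torus_map \<omega> \<gamma> \<delta>"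
  have *: "(\<alpha> - \<gamma>) * z + (\<beta> - \<delta>) \<in> period_lattice \<omega>" for z
    using fun_cong[OF eq, of "torus_proj \<omega> z"] assms
    by (simp add: torus_map_proj torus_proj_eq_iff algebra_simps)
  from affine_into_period_lattice[OF assms(1) this] *[of 0]
  show "\<alpha> = \<gamma> \<and> \<beta> - \<delta> \<in> period_lattice \<omega>" by simp
next
  assume "\<alpha> = \<gamma> \<and> \<beta> - \<delta> \<in> period_lattice \<omega>"
  then show "torus_map \<omega> \<alpha> \<beta> = torus_map \<omega> \<gamma> \<delta>"
    using assms by (intro torus_fun_eqI[OF torus_map_extensional torus_map_extensional])
      (simp add: torus_map_proj torus_proj_eq_iff)
qed

lemma group_torus_aut:
  assumes "Im \<omega> \<noteq> 0" shows "group (torus_aut \<omega>)"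
proof (rule groupI)
  fix x y assume xy: "x \<in> carrier (torus_aut \<omega>)" "y \<in> carrier (torus_aut \<omega>)"
  obtain a b where x: "lattice_unit \<omega> a" "x = torus_map \<omega> a b" using carrier_torus_autE[OF assms xy(1)] .
  obtain c d where y: "lattice_unit \<omega> c" "y = torus_map \<omega> c d" using carrier_torus_autE[OF assms xy(2)] .
  show "x \<otimes>\<^bsub>torus_aut \<omega>\<^esub> y \<in> carrier (torus_aut \<omega>)"
    using x y by (simp add: torus_map_mult torus_map_in_carrier lattice_unit_mult)
  fix z assume z: "z \<in> carrier (torus_aut \<omega>)"
  obtain e f where z: "lattice_unit \<omega> e" "z = torus_map \<omega> e f" using carrier_torus_autE[OF assms z] .
  show "x \<otimes>\<^bsub>torus_aut \<omega>\<^esub> y \<otimes>\<^bsub>torus_aut \<omega>\<^esub> z = x \<otimes>\<^bsub>torus_aut \<omega>\<^esub> (y \<otimes>\<^bsub>torus_aut \<omega>\<^esub> z)"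
    using x y z by (simp add: torus_map_mult lattice_unit_mult algebra_simps)
next
  fix x assume x: "x \<in> carrier (torus_aut \<omega>)"
  obtain a b where x: "lattice_unit \<omega> a" "x = torus_map \<omega> a b" using carrier_torus_autE[OF assms x] .
  show "\<one>\<^bsub>torus_aut \<omega>\<^esub> \<otimes>\<^bsub>torus_aut \<omega>\<^esub> x = x"
    using x by (simp add: torus_map_one torus_map_mult lattice_unit_1)
  show "\<exists>y\<in>carrier (torus_aut \<omega>). y \<otimes>\<^bsub>torus_aut \<omega>\<^esub> x = \<one>\<^bsub>torus_aut \<omega>\<^esub>"
    using x lattice_unit_nonzero[OF x(1)]
    by (intro bexI[of _ "torus_map \<omega> (inverse a) (- b / a)"])
       (simp_all add: torus_map_one torus_map_mult lattice_unit_inverse torus_map_in_carrier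
          divide_inverse mult.commute)
qed (simp add: torus_map_one torus_map_in_carrier lattice_unit_1)

lemma lift_multiplier_torus_map:
  assumes "Im \<omega> \<noteq> 0" "lattice_unit \<omega> \<alpha>"
  shows "lift_multiplier \<omega> (torus_map \<omega> \<alpha> \<beta>) = \<alpha>"
  unfolding lift_multiplier_def
proof (rule the_equality)
  show "\<exists>\<beta>'. \<forall>z. torus_map \<omega> \<alpha> \<beta> (torus_proj \<omega> z) = torus_proj \<omega> (\<alpha> * z + \<beta>')"
    using torus_map_proj[OF assms(2)] by blast
  fix \<gamma> assume "\<exists>\<delta>. \<forall>z. torus_map \<omega> \<alpha> \<beta> (torus_proj \<omega> z) = torus_proj \<omega> (\<gamma> * z + \<delta>)"
  then obtain \<delta> where "torus_proj \<omega> (\<gamma> * z + \<delta>) = torus_proj \<omega> (\<alpha> * z + \<beta>)" for z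
    by (metis torus_map_proj[OF assms(2)])
  then have "(\<gamma> * z + \<delta>) - (\<alpha> * z + \<beta>) \<in> period_lattice \<omega>" for z
    by (simp only: torus_proj_eq_iff)
  then have "(\<gamma> - \<alpha>) * z + (\<delta> - \<beta>) \<in> period_lattice \<omega>" for z
    by (simp add: left_diff_distrib add_diff_add)
  from affine_into_period_lattice[OF assms(1) this] show "\<gamma> = \<alpha>" by simp
qed

section \<open>Extensions of a cyclic group by a quotient of lattices\<close>

text \<open>Two images of the same set with the same fibres are in bijection, and the bijection
  respects products because both maps do. Isomorphisms can thus be checked on integer or complex
  parameters, without normal forms; \<open>op\<close> only has to be a closed operation.\<close>

lemma is_iso_of_common_cover:
  assumes f: "f ` C = carrier G" and g: "g ` C = carrier H"
    and cl: "\<And>x y. x \<in> C \<Longrightarrow> y \<in> C \<Longrightarrow> op x y \<in> C"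
    and f_mult: "\<And>x y. x \<in> C \<Longrightarrow> y \<in> C \<Longrightarrow> f (op x y) = f x \<otimes>\<^bsub>G\<^esub> f y"
    and g_mult: "\<And>x y. x \<in> C \<Longrightarrow> y \<in> C \<Longrightarrow> g (op x y) = g x \<otimes>\<^bsub>H\<^esub> g y"
    and eq: "\<And>x y. x \<in> C \<Longrightarrow> y \<in> C \<Longrightarrow> f x = f y \<longleftrightarrow> g x = g y"
  shows "G \<cong> H"
proof -
  define h where "h a = g (inv_into C f a)" for a
  have h: "h (f x) = g x" if "x \<in> C" for x
    using that eq by (metis h_def f_inv_into_f image_eqI inv_into_into)
  have "h \<in> iso G H"
    unfolding iso_def
  proof (intro CollectI conjI homI)
    show "h a \<in> carrier H" if "a \<in> carrier G" for a
      using that g by (auto simp: h simp flip: f)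
    show "h (a \<otimes>\<^bsub>G\<^esub> b) = h a \<otimes>\<^bsub>H\<^esub> h b" if "a \<in> carrier G" "b \<in> carrier G" for a b
      using that cl by (auto simp: h g_mult simp flip: f f_mult)
    show "bij_betw h (carrier G) (carrier H)"
      unfolding bij_betw_def inj_on_def f[symmetric] g[symmetric]
      by (auto simp: h eq image_iff)
  qed
  then show ?thesis by (rule is_isoI)
qed

section \<open>Roots of unity and the crystallographic restriction\<close>

definition zeta :: "nat \<Rightarrow> complex" where
  "zeta d = cis (2 * pi / real d)"

lemma zeta_nonzero [simp]: "zeta d \<noteq> 0"
  by (simp add: zeta_def)

lemma zeta_powi_add: "zeta d powi (i + j) = zeta d powi i * zeta d powi j"
  by (simp add: power_int_add)

lemma zeta_powi_eq_1_iff: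
  assumes "d > 0" shows "zeta d powi j = 1 \<longleftrightarrow> int d dvd j"
proof
  assume "zeta d powi j = 1"
  then have "cos (of_int j * (2 * pi / real d)) = 1"
    unfolding zeta_def cis_power_int by (metis cis.sel(1) one_complex.sel(1))
  then obtain n :: int where "of_int j * (2 * pi / real d) = of_int n * 2 * pi"
    by (auto simp: cos_one_2pi_int)
  then have "real_of_int j = of_int (n * int d)"
    using assms by (simp add: field_simps)
  then have "j = n * int d" by (simp only: of_int_eq_iff)
  then show "int d dvd j" by simp
next
  assume "int d dvd j"
  then obtain c where "j = int d * c" by (rule dvdE)
  then have "of_int j * (2 * pi / real d) = 2 * pi * of_int c" using assms by simp
  then show "zeta d powi j = 1" unfolding zeta_def cis_power_int by simp
qed

lemma zeta_powi_eq_iff: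
  assumes "d > 0" shows "zeta d powi i = zeta d powi j \<longleftrightarrow> int d dvd i - j"
proof -
  have "zeta d powi i = zeta d powi (i - j) * zeta d powi j" by (simp flip: zeta_powi_add)
  then show ?thesis using zeta_powi_eq_1_iff[OF assms, of "i - j"] by simp
qed

text \<open>The conjugate of \<zeta> is its inverse, and the sum of both is twice the
  cosine.\<close>

lemma zeta_quadratic: "zeta d * zeta d - of_real (2 * cos (2 * pi / real d)) * zeta d + 1 = 0"
proof -
  have "zeta d * (zeta d + cnj (zeta d)) = zeta d * of_real (2 * Re (zeta d))"
    by (simp only: complex_add_cnj)
  moreover have "zeta d * cnj (zeta d) = 1"
    by (simp add: zeta_def cis_cnj cis_mult)
  ultimately show ?thesis by (simp add: zeta_def algebra_simps)
qed

lemma zeta_1: "zeta 1 = 1" and zeta_2: "zeta 2 = - 1"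
  by (simp_all add: zeta_def)

lemma zeta_3: "zeta 3 * zeta 3 = - zeta 3 - 1"
  using zeta_quadratic[of 3] by (simp add: cos_120' algebra_simps eq_neg_iff_add_eq_0)

lemma zeta_4: "zeta 4 * zeta 4 = - 1"
  using zeta_quadratic[of 4] by (simp add: eq_neg_iff_add_eq_0)

lemma zeta_6: "zeta 6 * zeta 6 = zeta 6 - 1"
proof -
  have "2 * pi / real 6 = pi / 3" by simp
  then show ?thesis using zeta_quadratic[of 6] by (simp add: cos_60 algebra_simps)
qed

lemma Im_zeta: "d \<ge> 3 \<Longrightarrow> 0 < Im (zeta d)" "Im (zeta d) \<le> 1"
  by (auto simp: zeta_def field_simps intro!: sin_gt_zero)

text \<open>The trace \<open>2 cos (2 \<pi> / d)\<close> of multiplication by \<open>\<zeta>\<close> on the lattice is an integer.\<close>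

lemma zeta_stable_order:
  assumes nd: "Im (cnj u * v) \<noteq> 0" and "d > 0"
    and st: "\<And>t. t \<in> zspan u v \<Longrightarrow> zeta d * t \<in> zspan u v"
  shows "d \<in> {1, 2, 3, 4, 6}"
proof (rule ccontr)
  assume no: "d \<notin> {1, 2, 3, 4, 6}"
  then have d: "d = 5 \<or> d > 6" using assms(2) by auto
  then have Im: "Im (zeta d) > 0" by (intro Im_zeta) auto
  obtain a b where 1: "zeta d * u = of_int a * u + of_int b * v"
    using st[OF zspan_gens(1)] by (rule zspanE)
  obtain p h where 2: "zeta d * v = of_int p * u + of_int h * v"
    using st[OF zspan_gens(2)] by (rule zspanE)
  \<comment> \<open>The characteristic equation of the integer matrix of \<zeta> in the basis
    \<open>u, v\<close>. Its imaginary part identifies the trace \<open>a + h\<close> with twice the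
    cosine.\<close>
  have "(zeta d - of_int a) * (zeta d - of_int h) * u = of_int (b * p) * u"
  proof -
    have "(zeta d - of_int a) * u = of_int b * v" by (simp add: left_diff_distrib 1)
    moreover have "(zeta d - of_int h) * v = of_int p * u" by (simp add: left_diff_distrib 2)
    ultimately show ?thesis by (metis mult.assoc mult.left_commute of_int_mult)
  qed
  moreover have "u \<noteq> 0" using nd by auto
  ultimately have "(zeta d - of_int a) * (zeta d - of_int h) = of_int (b * p)" by simp
  then have "Im ((zeta d - of_int a) * (zeta d - of_int h)) = 0" by simp
  then have "Im (zeta d) * (2 * Re (zeta d) - of_int (a + h)) = 0" by (simp add: algebra_simps)
  then have int: "2 * cos (2 * pi / real d) = of_int (a + h)"
    using Im by (simp add: zeta_def)
  \<comment> \<open>For these \<open>d\<close> the angle is acute, so the integer 2 cos lies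
    strictly between 0 and 2 and equals 1. The angle would then be pi / 3, which belongs to
    \<open>d = 6\<close>.\<close>
  have "0 < 2 * pi / real d" "2 * pi / real d < pi / 2"
    using d by (auto simp: field_simps)
  then have "0 < 2 * cos (2 * pi / real d)"
    by (intro mult_pos_pos cos_gt_zero_pi) linarith+
  moreover have "2 * cos (2 * pi / real d) < 2"
    using d cos_monotone_0_pi[of 0 "2 * pi / real d"] by (auto simp: field_simps)
  ultimately have eq1: "a + h = 1" unfolding int by linarith
  from d show False
  proof
    assume "d = 5"
    have "cos (2 * pi / 5) < cos (pi / 3)" by (intro cos_monotone_0_pi) auto
    then show False using int eq1 \<open>d = 5\<close> by (simp add: cos_60)
  next
    assume "d > 6"
    then have "cos (pi / 3) < cos (2 * pi / real d)"
      by (intro cos_monotone_0_pi) (auto simp: field_simps)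
    then show False using int eq1 by (simp add: cos_60)
  qed
qed

definition sublattice :: "complex \<Rightarrow> complex \<Rightarrow> nat \<Rightarrow> nat \<Rightarrow> complex set" where
  "sublattice u v m n = zspan (of_nat m * u) (of_nat n * v)"

lemma sublattice_mem_iff:
  assumes "Im (cnj u * v) \<noteq> 0"
  shows "of_int a * u + of_int b * v \<in> sublattice u v m n \<longleftrightarrow> int m dvd a \<and> int n dvd b"
  unfolding sublattice_def
proof
  assume "of_int a * u + of_int b * v \<in> zspan (of_nat m * u) (of_nat n * v)"
  then obtain c e where "of_int a * u + of_int b * v = of_int c * (of_nat m * u) + of_int e * (of_nat n * v)"
    by (rule zspanE)
  then have "of_int a * u + of_int b * v = of_int (c * int m) * u + of_int (e * int n) * v" by simp
  from zspan_coords_unique[OF assms this] show "int m dvd a \<and> int n dvd b" by simp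
next
  assume "int m dvd a \<and> int n dvd b"
  then obtain c e where "a = int m * c" "b = int n * e" unfolding dvd_def by blast
  then show "of_int a * u + of_int b * v \<in> zspan (of_nat m * u) (of_nat n * v)"
    by (intro zspanI[of _ c _ e]) simp
qed

text \<open>The group of the affine maps \<open>P t j = (z \<mapsto> \<zeta>\<^sup>j z + t)\<close> modulo a sublattice of
  the lattice of all \<open>t\<close>, with \<open>\<zeta> = exp (2 \<pi> i / d)\<close>. The basis is adapted to the sublattice.\<close>

locale affine_group = group G for G (structure) +
  fixes P :: "complex \<Rightarrow> int \<Rightarrow> 'a" and u v :: complex and m k d :: nat
  assumes nondegenerate: "Im (cnj u * v) \<noteq> 0"
    and pos: "m > 0" "k > 0" "d > 0"
    and stable: "\<And>t. t \<in> zspan u v \<Longrightarrow> zeta d * t \<in> zspan u v"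
    and P_closed: "\<And>t j. t \<in> zspan u v \<Longrightarrow> P t j \<in> carrier G"
    and P_onto: "\<And>g. g \<in> carrier G \<Longrightarrow> \<exists>t\<in>zspan u v. \<exists>j. g = P t j"
    and P_mult: "\<And>t s i j. t \<in> zspan u v \<Longrightarrow> s \<in> zspan u v \<Longrightarrow>
      P t i \<otimes> P s j = P (t + zeta d powi i * s) (i + j)"
    and P_eq_one: "\<And>t j. t \<in> zspan u v \<Longrightarrow>
      P t j = \<one> \<longleftrightarrow> t \<in> sublattice u v m (m * k) \<and> int d dvd j"
begin

abbreviation lat :: "complex set" where "lat \<equiv> zspan u v"
abbreviation sublat :: "complex set" where "sublat \<equiv> sublattice u v m (m * k)"

section \<open>Calculus of the maps \<open>P t j\<close>\<close>

lemma lat_add: "t \<in> lat \<Longrightarrow> s \<in> lat \<Longrightarrow> t + s \<in> lat"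
  and lat_diff: "t \<in> lat \<Longrightarrow> s \<in> lat \<Longrightarrow> t - s \<in> lat"
  and lat_uminus: "t \<in> lat \<Longrightarrow> - t \<in> lat"
  and lat_zero: "0 \<in> lat"
  and lat_of_int: "t \<in> lat \<Longrightarrow> of_int a * t \<in> lat"
  and lat_comb: "of_int a * u + of_int b * v \<in> lat"
  using add_subgroup_zspan[of u v]
  by (auto intro: add_subgroup_add add_subgroup_diff add_subgroup_uminus add_subgroup_0
      add_subgroup_of_int_mult zspanI)

lemma sublat_add: "t \<in> sublat \<Longrightarrow> s \<in> sublat \<Longrightarrow> t + s \<in> sublat"
  and sublat_diff: "t \<in> sublat \<Longrightarrow> s \<in> sublat \<Longrightarrow> t - s \<in> sublat"
  and sublat_zero: "0 \<in> sublat"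
  using add_subgroup_zspan[of "of_nat m * u" "of_nat (m * k) * v"]
  by (auto simp only: sublattice_def intro: add_subgroup_add add_subgroup_diff add_subgroup_0)

lemma comb_in_sublat_iff:
  "of_int a * u + of_int b * v \<in> sublat \<longleftrightarrow> int m dvd a \<and> int (m * k) dvd b"
  by (rule sublattice_mem_iff[OF nondegenerate])

lemma sublat_subset: "t \<in> sublat \<Longrightarrow> t \<in> lat"
  using zspan_least[OF add_subgroup_zspan, of "of_nat m * u" u v "of_nat (m * k) * v"]
    lat_of_int[OF zspan_gens(1), of "int m"] lat_of_int[OF zspan_gens(2), of "int (m * k)"]
  unfolding sublattice_def by auto

lemma zeta_pow_stable: "t \<in> lat \<Longrightarrow> zeta d ^ n * t \<in> lat"
  by (induction n) (auto simp: mult.assoc stable)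

text \<open>Closure under \<zeta> yields the nonnegative powers; negative ones are reached by
  reducing the exponent modulo \<open>d\<close>.\<close>

lemma zeta_powi_stable:
  assumes "t \<in> lat" shows "zeta d powi j * t \<in> lat"
proof -
  have "zeta d powi (j mod int d) = zeta d powi (j mod int d) * zeta d powi (int d * (j div int d))"
    using zeta_powi_eq_1_iff[OF pos(3), of "int d * (j div int d)"] by simp
  also have "\<dots> = zeta d powi j" by (simp flip: zeta_powi_add)
  finally have "zeta d powi j = zeta d ^ nat (j mod int d)"
    using pos(3) by (simp add: power_int_def)
  then show ?thesis using zeta_pow_stable[OF assms] by simp
qed

lemma P_zero: "P 0 0 = \<one>"
  by (simp add: P_eq_one lat_zero sublat_zero)

text \<open>Cancelling \<open>P s j\<close> on the right leaves the translation part
  \<open>t - zeta d powi (i - j) * s\<close>, which is \<open>t - s\<close> once \<open>d\<close>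
  divides \<open>i - j\<close>.\<close>

lemma P_eq_iff:
  assumes "t \<in> lat" "s \<in> lat"
  shows "P t i = P s j \<longleftrightarrow> t - s \<in> sublat \<and> int d dvd i - j"
proof -
  let ?r = "t - zeta d powi (i - j) * s"
  have r: "?r \<in> lat" by (intro lat_diff zeta_powi_stable assms)
  have "P t i = P ?r (i - j) \<otimes> P s j" using r assms by (simp add: P_mult)
  then have "P t i = P s j \<longleftrightarrow> P ?r (i - j) = \<one>"
    using P_closed r assms by (metis l_one r_cancel_one)
  also have "\<dots> \<longleftrightarrow> t - s \<in> sublat \<and> int d dvd i - j"
    using r zeta_powi_eq_1_iff[OF pos(3), of "i - j"] by (auto simp: P_eq_one)
  finally show ?thesis .
qed

lemma P_inv: "t \<in> lat \<Longrightarrow> inv (P t j) = P (- (zeta d powi (- j) * t)) (- j)"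
  by (rule inv_equality)
    (simp_all add: P_mult P_closed lat_uminus zeta_powi_stable P_zero)

lemma P_translation_pow: "t \<in> lat \<Longrightarrow> P t 0 [^] n = P (of_nat n * t) 0"
proof (induction n)
  case (Suc n)
  then show ?case using lat_of_int[of t "int n"] by (simp add: P_mult algebra_simps)
qed (simp add: P_zero)

lemma P_translation_int_pow: "t \<in> lat \<Longrightarrow> P t 0 [^] (a::int) = P (of_int a * t) 0"
  using lat_of_int[of t "int n" for n]
  by (cases a rule: int_cases2)
    (auto simp: int_pow_int P_translation_pow int_pow_neg_int P_closed P_inv)

lemma P_rotation_pow: "P 0 j [^] n = P 0 (int n * j)"
  by (induction n) (simp_all add: P_zero P_mult lat_zero algebra_simps)

lemma P_rotation_int_pow: "P 0 j [^] (a::int) = P 0 (a * j)"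
  by (cases a rule: int_cases2)
    (auto simp: int_pow_int P_rotation_pow int_pow_neg_int P_closed P_inv lat_zero)

lemma P_decompose: "t \<in> lat \<Longrightarrow> P t j = P t 0 \<otimes> P 0 j"
  by (simp add: P_mult lat_zero)

text \<open>The rotation \<open>P 0 j\<close> conjugates \<open>P t 0\<close> into
  \<open>P (zeta d powi j * t) 0\<close>, and a conjugate of the identity is the identity.\<close>

lemma sublat_stable:
  assumes "t \<in> sublat" shows "zeta d powi j * t \<in> sublat"
proof -
  note t = sublat_subset[OF assms]
  have "P t 0 = \<one>" using assms t by (simp add: P_eq_one)
  then have "P 0 j \<otimes> P t 0 \<otimes> inv (P 0 j) = \<one>" by (simp add: P_closed lat_zero)
  then have "P (zeta d powi j * t) 0 = \<one>"
    using t by (simp add: P_mult P_inv lat_zero zeta_powi_stable)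
  then show ?thesis using t by (simp add: P_eq_one zeta_powi_stable)
qed

text \<open>Rotations must act trivially on translations. With the converse
  \<open>comm_if_sublat\<close>, being abelian becomes the inclusion of (\<zeta> - 1) \<Lambda> in
  the sublattice, an arithmetic condition.\<close>

lemma comm_imp_sublat:
  assumes "comm_group G" "t \<in> lat" shows "zeta d * t - t \<in> sublat"
proof -
  have "P 0 1 \<otimes> P t 0 = P t 0 \<otimes> P 0 1"
    using assms P_closed lat_zero by (simp add: comm_groupE(4))
  then have "P (zeta d * t) 1 = P t 1" using assms(2) by (simp add: P_mult lat_zero)
  then show ?thesis using assms(2) by (simp add: P_eq_iff stable)
qed

lemma zeta_powi_sublat:
  assumes z: "\<And>t. t \<in> lat \<Longrightarrow> zeta d * t - t \<in> sublat" and t: "t \<in> lat"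
  shows "zeta d powi j * t - t \<in> sublat"
proof -
  have *: "zeta d ^ n * t - t \<in> sublat" if t: "t \<in> lat" for n t
  proof (induction n)
    case (Suc n)
    have "zeta d ^ Suc n * t - t = (zeta d * (zeta d ^ n * t) - zeta d ^ n * t) + (zeta d ^ n * t - t)"
      by simp
    then show ?case using sublat_add[OF z[OF zeta_pow_stable[OF t]] Suc] by (simp only:)
  qed (simp add: sublat_zero)
  show ?thesis
  proof (cases "j \<ge> 0")
    case True
    then show ?thesis using *[OF t] by (simp add: power_int_def)
  next
    case False
    \<comment> \<open>The positive power with exponent \<open>- j\<close> is applied to the vector
      \<open>zeta d powi j * t\<close>, which it carries back to \<open>t\<close>.\<close>
    have "t - zeta d powi j * t \<in> sublat"
      using *[OF zeta_powi_stable[OF t, of j], of "nat (- j)"] False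
      by (simp add: power_int_def field_simps)
    from sublat_diff[OF sublat_zero this] show ?thesis by simp
  qed
qed

lemma comm_if_sublat:
  assumes z: "\<And>t. t \<in> lat \<Longrightarrow> zeta d * t - t \<in> sublat"
  shows "comm_group G"
proof (unfold_locales)
  fix x y assume "x \<in> carrier G" "y \<in> carrier G"
  then obtain t i s j where x: "t \<in> lat" "x = P t i" and y: "s \<in> lat" "y = P s j"
    using P_onto by meson
  have "(t + zeta d powi i * s) - (s + zeta d powi j * t) =
      (zeta d powi i * s - s) - (zeta d powi j * t - t)" by simp
  also have "\<dots> \<in> sublat" by (intro sublat_diff zeta_powi_sublat z x y)
  finally show "x \<otimes> y = y \<otimes> x"
    using x y by (simp add: P_mult P_eq_iff lat_add zeta_powi_stable)
qed

lemma P_comb_eq_iff: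
  "P (of_int a * u + of_int b * v) i = P (of_int a' * u + of_int b' * v) j \<longleftrightarrow>
    int m dvd a - a' \<and> int (m * k) dvd b - b' \<and> int d dvd i - j"
proof -
  have "(of_int a * u + of_int b * v) - (of_int a' * u + of_int b' * v)
      = of_int (a - a') * u + of_int (b - b') * v" by (simp add: algebra_simps)
  then show ?thesis using comb_in_sublat_iff[of "a - a'" "b - b'"] by (simp add: P_eq_iff lat_comb)
qed

lemma carrier_eq: "carrier G = (\<lambda>(a, b, j). P (of_int a * u + of_int b * v) j) ` UNIV"
proof (intro equalityI subsetI)
  fix x assume "x \<in> carrier G"
  then obtain t j where "t \<in> lat" "x = P t j" using P_onto by meson
  moreover obtain a b where "t = of_int a * u + of_int b * v" using \<open>t \<in> lat\<close> by (rule zspanE)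
  ultimately show "x \<in> (\<lambda>(a, b, j). P (of_int a * u + of_int b * v) j) ` UNIV"
    by (intro image_eqI[of _ _ "(a, b, j)"]) auto
qed (auto simp: P_closed lat_comb)

lemma carrier_bij:
  "bij_betw (\<lambda>(a, b, j). P (of_int a * u + of_int b * v) j)
    ({0..<int m} \<times> {0..<int (m * k)} \<times> {0..<int d}) (carrier G)"
proof (rule bij_betw_imageI)
  have eq: "x = y" if "int n dvd x - y" "x \<in> {0..<int n}" "y \<in> {0..<int n}" for n x y
    using that by (metis atLeastLessThan_iff mod_eq_dvd_iff mod_pos_pos_trivial)
  show "inj_on (\<lambda>(a, b, j). P (of_int a * u + of_int b * v) j)
      ({0..<int m} \<times> {0..<int (m * k)} \<times> {0..<int d})"
    by (rule inj_onI) (auto simp only: P_comb_eq_iff split_paired_all case_prod_conv mem_Times_iff fst_conv snd_conv dest!: eq)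
  show "(\<lambda>(a, b, j). P (of_int a * u + of_int b * v) j) `
      ({0..<int m} \<times> {0..<int (m * k)} \<times> {0..<int d}) = carrier G"
  proof (intro equalityI subsetI)
    fix x assume "x \<in> carrier G"
    then obtain a b j where x: "x = P (of_int a * u + of_int b * v) j"
      unfolding carrier_eq by auto
    also have "\<dots> = P (of_int (a mod int m) * u + of_int (b mod int (m * k)) * v) (j mod int d)"
      unfolding P_comb_eq_iff by (simp flip: mod_eq_dvd_iff)
    finally show "x \<in> (\<lambda>(a, b, j). P (of_int a * u + of_int b * v) j) `
        ({0..<int m} \<times> {0..<int (m * k)} \<times> {0..<int d})"
      using pos by (intro image_eqI[of _ _ "(a mod int m, b mod int (m * k), j mod int d)"]) auto
  qed (auto simp: P_closed lat_comb)
qed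

lemma finite_carrier: "finite (carrier G)"
  using bij_betw_finite[OF carrier_bij] by simp

lemma order_eq: "order G = m\<^sup>2 * k * d"
  using bij_betw_same_card[OF carrier_bij]
  by (simp add: order_def card_cartesian_product power2_eq_square nat_mult_distrib mult.assoc)

section \<open>Abelian groups\<close>

lemma is_iso_of_int_cover:
  assumes comm: "comm_group G"
    and g_closed: "\<And>a b j. g a b j \<in> carrier H"
    and g_onto: "\<And>x. x \<in> carrier H \<Longrightarrow> \<exists>a b j. g a b j = x"
    and g_mult: "\<And>a b i a' b' j. g (a + a') (b + b') (i + j) = g a b i \<otimes>\<^bsub>H\<^esub> g a' b' j"
    and g_eq: "\<And>a b i a' b' j. g a b i = g a' b' j \<longleftrightarrow>
      int m dvd a - a' \<and> int (m * k) dvd b - b' \<and> int d dvd i - j"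
  shows "G \<cong> H"
proof (rule is_iso_of_common_cover)
  let ?f = "\<lambda>(a, b, j). P (of_int a * u + of_int b * v) j"
  let ?op = "\<lambda>(a, b, i) (a', b', j). (a + a', b + b', i + j) :: int \<times> int \<times> int"
  show "range ?f = carrier G" by (rule carrier_eq[symmetric])
  show "range (\<lambda>(a, b, j). g a b j) = carrier H"
  proof (intro equalityI subsetI)
    fix x assume "x \<in> carrier H"
    then obtain a b j where "g a b j = x" using g_onto by meson
    then show "x \<in> range (\<lambda>(a, b, j). g a b j)" by (intro image_eqI[of _ _ "(a, b, j)"]) auto
  qed (auto simp: g_closed)
  show "?f (?op x y) = ?f x \<otimes> ?f y" for x y
  proof -
    obtain a b i a' b' j where xy: "x = (a, b, i)" "y = (a', b', j)" by (metis prod_cases3)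
    let ?t = "of_int a * u + of_int b * v" and ?s = "of_int a' * u + of_int b' * v"
    \<comment> \<open>In an abelian group the twist by \<open>zeta d powi i\<close> disappears
      modulo the sublattice. So the triples are simply added, and \<open>H\<close> is recognized as
      a quotient of \<int>^3 with the same kernel.\<close>
    have "(?t + zeta d powi i * ?s) - (?t + ?s) \<in> sublat"
      using zeta_powi_sublat[OF comm_imp_sublat[OF comm] lat_comb, of i a' b'] by simp
    then have "P ?t i \<otimes> P ?s j = P (?t + ?s) (i + j)"
      using lat_comb[of a b] lat_comb[of a' b']
      by (simp add: P_mult P_eq_iff lat_add zeta_powi_stable)
    then show ?thesis by (simp add: xy algebra_simps)
  qed
  show "(case ?op x y of (a, b, j) \<Rightarrow> g a b j) =
      (case x of (a, b, j) \<Rightarrow> g a b j) \<otimes>\<^bsub>H\<^esub> (case y of (a, b, j) \<Rightarrow> g a b j)" for x y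
    by (auto simp: g_mult split: prod.splits)
  show "?f x = ?f y \<longleftrightarrow> (case x of (a, b, j) \<Rightarrow> g a b j) = (case y of (a, b, j) \<Rightarrow> g a b j)" for x y
    by (auto simp only: P_comb_eq_iff g_eq split: prod.splits)
qed auto

lemma comm_iso_three:
  assumes "comm_group G"
  shows "G \<cong> integer_mod_group m \<times>\<times> (integer_mod_group (m * k) \<times>\<times> integer_mod_group d)"
proof (rule is_iso_of_int_cover[where g = "\<lambda>a b j. (a mod int m, b mod int (m * k), j mod int d)"])
  show "\<exists>a b j. (\<lambda>a b j. (a mod int m, b mod int (m * k), j mod int d)) a b j = x" if "x \<in> carrier (integer_mod_group m \<times>\<times> (integer_mod_group (m * k) \<times>\<times> integer_mod_group d))" for x
    using that pos by (auto simp: carrier_integer_mod_group) (metis mod_pos_pos_trivial)+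
qed (use pos in \<open>auto simp: assms carrier_integer_mod_group mod_eq_dvd_iff mod_add_eq\<close>)

text \<open>For \<open>m = 1\<close> the first factor is trivial and has to be dropped, as the
  products in \<open>abelian_special_list\<close> have no trivial factors.\<close>

lemma comm_iso_two:
  assumes "comm_group G" "m = 1"
  shows "G \<cong> integer_mod_group k \<times>\<times> integer_mod_group d"
proof (rule is_iso_of_int_cover[where g = "\<lambda>a b j. (b mod int k, j mod int d)"])
  show "\<exists>a b j. (\<lambda>a b j. (b mod int k, j mod int d)) a b j = x" if "x \<in> carrier (integer_mod_group k \<times>\<times> integer_mod_group d)" for x
    using that pos by (auto simp: carrier_integer_mod_group) (metis mod_pos_pos_trivial)+
qed (use pos in \<open>auto simp: assms carrier_integer_mod_group mod_eq_dvd_iff mod_add_eq\<close>)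

lemma comm_iso_one:
  assumes "comm_group G" "m = 1" "k = 1"
  shows "G \<cong> integer_mod_group d"
proof (rule is_iso_of_int_cover[where g = "\<lambda>a b j. j mod int d"])
  show "\<exists>a b j. (\<lambda>a b j. j mod int d) a b j = x" if "x \<in> carrier (integer_mod_group d)" for x
    using that pos by (auto simp: carrier_integer_mod_group) (metis mod_pos_pos_trivial)+
qed (use pos in \<open>auto simp: assms carrier_integer_mod_group mod_eq_dvd_iff mod_add_eq\<close>)

lemma comm_if_order_1:
  assumes "d = 1" shows "comm_group G"
  unfolding assms by (rule comm_if_sublat) (simp add: assms zeta_1[simplified] sublat_zero)

lemma abelian_general_list_if_order_1:
  assumes d: "d = 1" shows "abelian_general_list G"
proof (cases "m = 1")
  case True
  have "G \<cong> integer_mod_group k"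
  proof (rule is_iso_of_int_cover[where g = "\<lambda>a b j. b mod int k"])
    show "\<exists>a b j. (\<lambda>a b j. b mod int k) a b j = x" if "x \<in> carrier (integer_mod_group k)" for x
      using that pos by (auto simp: carrier_integer_mod_group) (metis mod_pos_pos_trivial)+
  qed (use pos in \<open>auto simp: True d comm_if_order_1 carrier_integer_mod_group mod_eq_dvd_iff mod_add_eq\<close>)
  then show ?thesis using pos by (auto simp: abelian_general_list_def Suc_le_eq)
next
  case False
  have "G \<cong> integer_mod_group m \<times>\<times> integer_mod_group (m * k)"
  proof (rule is_iso_of_int_cover[where g = "\<lambda>a b j. (a mod int m, b mod int (m * k))"])
    show "\<exists>a b j. (\<lambda>a b j. (a mod int m, b mod int (m * k))) a b j = x" if "x \<in> carrier (integer_mod_group m \<times>\<times> integer_mod_group (m * k))" for x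
      using that pos by (auto simp: carrier_integer_mod_group) (metis mod_pos_pos_trivial)+
  qed (use pos in \<open>auto simp: d comm_if_order_1 carrier_integer_mod_group mod_eq_dvd_iff mod_add_eq\<close>)
  moreover have "m \<ge> 2" "k \<ge> 1" using False pos by auto
  ultimately show ?thesis unfolding abelian_general_list_def by blast
qed

text \<open>\<open>m * k\<close> is the order of \<open>v\<close> modulo the sublattice, and at the
  same time the exponent of the group of translations.\<close>

lemma mk_dvd_if_scaled:
  assumes "of_nat n * v \<in> sublat" shows "m * k dvd n"
  using comb_in_sublat_iff[of 0 "int n"] assms by (simp flip: of_nat_mult)

text \<open>For \<open>k = 1\<close> the sublattice is m \<Lambda>, so \<zeta> - 1 maps \<Lambda>
  into m \<Lambda>, and its square maps \<Lambda> into m^2 \<Lambda>. As m is a multiple of this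
  square, \<open>m u\<close> lies in m^2 \<Lambda>, and the basis vector \<open>u\<close> would be
  divisible by m. This rules out the full m-torsion for the ramified primes 3 and 2.\<close>

lemma not_square_divides:
  assumes sq: "(zeta d - 1) * (zeta d - 1) * e = of_nat m"
    and e: "\<And>t. t \<in> lat \<Longrightarrow> e * t \<in> lat"
    and z: "\<And>t. t \<in> lat \<Longrightarrow> zeta d * t - t \<in> sublat" and "k = 1"
  shows "m = 1"
proof -
  have *: "\<exists>s\<in>lat. (zeta d - 1) * t = of_nat m * s" if t: "t \<in> lat" for t
  proof -
    have "(zeta d - 1) * t \<in> sublat" using z[OF t] by (simp add: left_diff_distrib)
    then obtain a b where "(zeta d - 1) * t = of_int a * (of_nat m * u) + of_int b * (of_nat m * v)"
      using \<open>k = 1\<close> by (auto simp: sublattice_def elim: zspanE)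
    also have "\<dots> = of_nat m * (of_int a * u + of_int b * v)" by (simp add: algebra_simps)
    finally show ?thesis using lat_comb by blast
  qed
  obtain s where s: "s \<in> lat" "(zeta d - 1) * (e * u) = of_nat m * s"
    using *[OF e[OF zspan_gens(1)]] by blast
  obtain r where r: "r \<in> lat" "(zeta d - 1) * s = of_nat m * r"
    using *[OF s(1)] by blast
  have "of_nat m * u = (zeta d - 1) * ((zeta d - 1) * (e * u))"
    by (simp flip: sq)
  also have "\<dots> = of_nat m * ((zeta d - 1) * s)" unfolding s(2) by (rule mult.left_commute)
  also have "\<dots> = of_nat m * (of_nat m * r)" unfolding r(2) ..
  finally have "u = of_nat m * r" using pos(1) by simp
  moreover obtain a b where "r = of_int a * u + of_int b * v" using r(1) by (rule zspanE)
  ultimately have "of_int 1 * u + of_int 0 * v = of_int (int m * a) * u + of_int (int m * b) * v"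
    by (simp add: algebra_simps)
  from zspan_coords_unique[OF nondegenerate this] have "int m * a = 1" by simp
  then show "m = 1" by (metis dvd_triv_left int_dvd_int_iff nat_dvd_1_iff_1 of_nat_1)
qed

lemma abelian_special_list_if_comm:
  assumes comm: "comm_group G" and "d > 1"
  shows "abelian_special_list G"
proof -
  have z: "\<And>t. t \<in> lat \<Longrightarrow> zeta d * t - t \<in> sublat" using comm_imp_sublat[OF comm] .
  have small_dvd: "m = 1 \<and> k = 1 \<or> m = 1 \<and> k = p \<or> m = p \<and> k = 1"
    if "m * k dvd p" "p = 2 \<or> p = 3" for p
  proof -
    have "m \<le> p" "k \<le> p"
      using that dvd_mult_left[OF that(1)] dvd_mult_right[OF that(1)] by (auto intro!: dvd_imp_le)
    then have "m \<in> {1, 2, 3}" "k \<in> {1, 2, 3}" using pos that(2) by auto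
    then show ?thesis using that by auto
  qed
  consider "d = 2" | "d = 3" | "d = 4" | "d = 6"
    using zeta_stable_order[OF nondegenerate pos(3) stable] \<open>d > 1\<close> by auto
  then show ?thesis
  proof cases
    case 1
    \<comment> \<open>Here \<zeta> - 1 = - 2, applied to \<open>- v\<close>.\<close>
    have "of_nat 2 * v \<in> sublat"
      using z[OF lat_uminus[OF zspan_gens(2)]] 1 by (simp add: zeta_2)
    then have "m * k dvd 2" by (rule mk_dvd_if_scaled)
    from small_dvd[OF this] have "m = 1 \<and> k = 1 \<or> m = 1 \<and> k = 2 \<or> m = 2 \<and> k = 1" by simp
    then show ?thesis
      using comm_iso_one[OF comm] comm_iso_two[OF comm] comm_iso_three[OF comm] 1
      by (auto simp: abelian_special_list_def)
  next
    case 2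
    have q: "zeta d * zeta d = - zeta d - 1" using 2 zeta_3 by simp
    \<comment> \<open>The vector 3 v / (\<zeta> - 1): the cofactor of \<zeta> - 1 in its norm 3 is -
      \<zeta> - 2.\<close>
    define s where "s = - (zeta d * v) - 2 * v"
    have "zeta d * s - s = - (zeta d * zeta d) * v - zeta d * v + 2 * v"
      by (simp add: s_def algebra_simps)
    also have "\<dots> = of_nat 3 * v" unfolding q by (simp add: algebra_simps)
    finally have "of_nat 3 * v = zeta d * s - s" ..
    moreover have "s \<in> lat"
      unfolding s_def using lat_of_int[OF zspan_gens(2), of 2]
      by (intro lat_diff lat_uminus stable zspan_gens) simp
    ultimately have "of_nat 3 * v \<in> sublat" using z by metis
    then have "m * k dvd 3" by (rule mk_dvd_if_scaled)
    from small_dvd[OF this] have "m = 1 \<and> k = 1 \<or> m = 1 \<and> k = 3 \<or> m = 3 \<and> k = 1" by simp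
    moreover have False if mk: "m = 3" "k = 1"
    proof -
      \<comment> \<open>The prime 3 ramifies: (\<zeta> - 1)^2 = - 3 \<zeta>, and the unit \<zeta> +
        1 = - \<zeta>^2 turns this into 3.\<close>
      have "m = 1"
      proof (rule not_square_divides)
        have "(zeta d - 1) * (zeta d - 1) = zeta d * zeta d - 2 * zeta d + 1"
          by (simp add: algebra_simps)
        also have "\<dots> = - 3 * zeta d" unfolding q by simp
        finally have "(zeta d - 1) * (zeta d - 1) * (zeta d + 1) = - 3 * (zeta d * zeta d + zeta d)"
          by (simp only:) (simp add: algebra_simps)
        then show "(zeta d - 1) * (zeta d - 1) * (zeta d + 1) = of_nat m"
          unfolding q mk by simp
        show "(zeta d + 1) * t \<in> lat" if "t \<in> lat" for t
          using lat_add[OF stable[OF that] that] by (simp add: distrib_right)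
      qed (use z mk in auto)
      with mk show False by simp
    qed
    ultimately show ?thesis
      using comm_iso_one[OF comm] comm_iso_two[OF comm] 2
      by (auto simp: abelian_special_list_def)
  next
    case 3
    have q: "zeta d * zeta d = - 1" using 3 zeta_4 by simp
    \<comment> \<open>The vector 2 v / (\<zeta> - 1): the cofactor of \<zeta> - 1 in its norm 2 is -
      \<zeta> - 1.\<close>
    define s where "s = - (zeta d * v) - v"
    have "zeta d * s - s = - (zeta d * zeta d) * v + v"
      by (simp add: s_def algebra_simps)
    also have "\<dots> = of_nat 2 * v" unfolding q by (simp add: algebra_simps)
    finally have "of_nat 2 * v = zeta d * s - s" ..
    moreover have "s \<in> lat"
      unfolding s_def by (intro lat_diff lat_uminus stable zspan_gens)
    ultimately have "of_nat 2 * v \<in> sublat" using z by metis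
    then have "m * k dvd 2" by (rule mk_dvd_if_scaled)
    from small_dvd[OF this] have "m = 1 \<and> k = 1 \<or> m = 1 \<and> k = 2 \<or> m = 2 \<and> k = 1" by simp
    moreover have False if mk: "m = 2" "k = 1"
    proof -
      \<comment> \<open>The prime 2 ramifies in the Gaussian integers: (\<zeta> - 1)^2 = - 2
        \<zeta>, which the unit \<zeta> turns into 2.\<close>
      have "m = 1"
      proof (rule not_square_divides)
        have "(zeta d - 1) * (zeta d - 1) = zeta d * zeta d - 2 * zeta d + 1"
          by (simp add: algebra_simps)
        also have "\<dots> = - 2 * zeta d" unfolding q by simp
        finally have "(zeta d - 1) * (zeta d - 1) * zeta d = - 2 * (zeta d * zeta d)"
          by (simp only:) (simp add: algebra_simps)
        then show "(zeta d - 1) * (zeta d - 1) * zeta d = of_nat m"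
          unfolding q mk by simp
      qed (use z mk stable in auto)
      with mk show False by simp
    qed
    ultimately show ?thesis
      using comm_iso_one[OF comm] comm_iso_two[OF comm] 3
      by (auto simp: abelian_special_list_def)
  next
    case 4
    have q: "zeta d * zeta d = zeta d - 1" using 4 zeta_6 by simp
    \<comment> \<open>For \<open>d = 6\<close> the number \<zeta> - 1 is a unit with inverse -
      \<zeta>, so no nontrivial translation survives.\<close>
    have "zeta d * (- (zeta d * v)) - (- (zeta d * v)) = - (zeta d * zeta d) * v + zeta d * v"
      by (simp add: algebra_simps)
    also have "\<dots> = of_nat 1 * v" unfolding q by (simp add: algebra_simps)
    finally have "of_nat 1 * v = zeta d * (- (zeta d * v)) - (- (zeta d * v))" ..
    moreover have "- (zeta d * v) \<in> lat" by (intro lat_uminus stable zspan_gens)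
    ultimately have "of_nat 1 * v \<in> sublat" using z by metis
    then have "m * k dvd 1" by (rule mk_dvd_if_scaled)
    then have "m = 1" "k = 1" by simp_all
    then show ?thesis
      using comm_iso_one[OF comm] 4 by (auto simp: abelian_special_list_def)
  qed
qed

section \<open>Non-abelian groups with multipliers 1 and -1\<close>

lemma generators:
  assumes "subgroup K G" "P u 0 \<in> K" "P v 0 \<in> K" "P 0 1 \<in> K"
  shows "carrier G = K"
proof (intro equalityI subsetI)
  fix x assume "x \<in> carrier G"
  then obtain a b j where x: "x = P (of_int a * u + of_int b * v) j"
    unfolding carrier_eq by auto
  have "x = P u 0 [^] a \<otimes> P v 0 [^] b \<otimes> P 0 1 [^] j"
    by (simp add: x P_translation_int_pow P_rotation_int_pow P_mult lat_of_int zspan_gens lat_zero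
        lat_comb)
  then show "x \<in> K"
    using assms by (simp add: subgroup.m_closed subgroup_int_pow_closed)
qed (use subgroup.subset[OF assms(1)] in auto)

text \<open>The rotation inverts every translation, so the group is non-abelian iff the exponent
  \<open>m * k\<close> of the translations does not divide 2, that is, \<open>m * k \<ge> 3\<close>.
  Cyclic translations (\<open>m = 1\<close>) give a dihedral group, the others give
  \<open>bidihedral m (m * k)\<close>.\<close>

lemma dihedral_list_if_order_2:
  assumes nc: "\<not> comm_group G" and d: "d = 2"
  shows "dihedral_list G"
proof -
  have no: "\<not> m * k dvd 2"
  proof
    assume "m * k dvd 2"
    moreover from this have "m dvd 2" by (rule dvd_mult_left)
    ultimately have dvd: "int m dvd 2" "int (m * k) dvd 2"
      by (metis int_dvd_int_iff of_nat_numeral)+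
    have "comm_group G"
    proof (rule comm_if_sublat)
      fix t assume "t \<in> lat"
      then obtain a b where "t = of_int a * u + of_int b * v" by (rule zspanE)
      then have "zeta d * t - t = of_int (2 * - a) * u + of_int (2 * - b) * v"
        by (simp add: d zeta_2 algebra_simps)
      moreover have "of_int (2 * - a) * u + of_int (2 * - b) * v \<in> sublat"
        unfolding comb_in_sublat_iff by (intro conjI dvd_mult2 dvd)
      ultimately show "zeta d * t - t \<in> sublat" by (simp only:)
    qed
    with nc show False ..
  qed
  have "m * k \<noteq> 0" "m * k \<noteq> 1" "m * k \<noteq> 2" using no pos by (auto simp del: mult_eq_1_iff nat_mult_eq_1_iff)
  then have mk: "m * k \<ge> 3" by linarith
  have z1: "zeta d powi i = (if odd i then - 1 else 1)" for i
    by (simp add: d zeta_2 power_int_minus_left)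
  show ?thesis
  proof (cases "m = 1")
    case True
    let ?f = "\<lambda>(b, i). P (of_int b * v) i"
    let ?g = "\<lambda>(b, i). (b mod int k, odd i)"
    let ?op = "\<lambda>(b, i) (b', j). (if odd i then b - b' else b + b', i + j) :: int \<times> int"
    have "G \<cong> dihedral_group k"
    proof (rule is_iso_of_common_cover)
      show "range ?f = carrier G"
      proof (intro equalityI subsetI)
        fix x assume "x \<in> carrier G"
        then obtain a b j where x: "x = P (of_int a * u + of_int b * v) j"
          unfolding carrier_eq by auto
        then have "x = P (of_int b * v) j"
          using P_comb_eq_iff[of a b j 0 b j] True by simp
        then show "x \<in> range ?f" by (intro image_eqI[of _ _ "(b, j)"]) auto
      qed (auto simp: P_closed lat_of_int zspan_gens)
      show "range ?g = carrier (dihedral_group k)"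
      proof -
        have "x \<in> range ?g" if "x \<in> {0..<int k} \<times> UNIV" for x
          using that by (intro image_eqI[of _ _ "(fst x, if snd x then 1 else 0)"]) auto
        then show ?thesis using pos by (auto simp: dihedral_group_def)
      qed
      show "?f (?op x y) = ?f x \<otimes> ?f y" for x y
      proof -
        obtain b i b' j where xy: "x = (b, i)" "y = (b', j)" by (metis surj_pair)
        have "?f x \<otimes> ?f y = P (of_int b * v + zeta d powi i * (of_int b' * v)) (i + j)"
          by (simp add: xy P_mult lat_of_int zspan_gens)
        then show ?thesis by (auto simp: xy z1 algebra_simps)
      qed
      show "?g (?op x y) = ?g x \<otimes>\<^bsub>dihedral_group k\<^esub> ?g y" for x y
        by (auto simp: dihedral_group_def mod_add_eq mod_diff_eq split: prod.splits)
      show "?f x = ?f y \<longleftrightarrow> ?g x = ?g y" for x y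
      proof -
        obtain b i b' j where xy: "x = (b, i)" "y = (b', j)" by (metis surj_pair)
        have "even (i - j) \<longleftrightarrow> odd i = odd j" by auto
        then show ?thesis
          using P_comb_eq_iff[of 0 b i 0 b' j] by (simp add: xy True d mod_eq_dvd_iff)
      qed
    qed auto
    moreover have "k \<ge> 3" using mk True by simp
    ultimately show ?thesis by (auto simp: dihedral_list_def)
  next
    case False
    have ord: "ord (P 0 1) = 2" "ord (P u 0) = m" "ord (P v 0) = m * k"
      using P_comb_eq_iff[of "int _" 0 0 0 0 0] P_comb_eq_iff[of 0 "int _" 0 0 0 0]
        P_comb_eq_iff[of 0 0 "int _" 0 0 0]
      by (simp_all add: ord_unique P_closed zspan_gens lat_zero P_translation_pow P_rotation_pow
          P_eq_one sublat_zero d flip: P_zero of_nat_mult)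
    have rel: "P 0 1 \<otimes> P t 0 \<otimes> P 0 1 = inv (P t 0)" if "t \<in> lat" for t
    proof -
      have "P (- t) 2 = P (- t) 0" using that by (simp add: P_eq_iff lat_uminus sublat_zero d)
      then show ?thesis using that
        by (simp add: P_mult lat_zero lat_uminus P_inv d zeta_2)
    qed
    have "generate G {P 0 1, P u 0, P v 0} = carrier G"
      by (rule generators[symmetric])
        (auto intro!: generate_is_subgroup generate.incl P_closed zspan_gens lat_zero)
    moreover have "P u 0 \<otimes> P v 0 = P v 0 \<otimes> P u 0"
      by (simp add: P_mult zspan_gens add.commute)
    ultimately have "bidihedral m (m * k) G"
      unfolding bidihedral_def
      using is_group finite_carrier False pos mk ord rel zspan_gens
      by (intro conjI bexI[of _ "P 0 1"] bexI[of _ "P u 0"] bexI[of _ "P v 0"])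
         (auto simp: P_closed lat_zero)
    then show ?thesis by (auto simp: dihedral_list_def)
  qed
qed

section \<open>Non-abelian groups with more than two multipliers\<close>

definition translation_group :: "'a set" where
  "translation_group = (\<lambda>t. P t 0) ` lat"

definition rotation_group :: "'a set" where
  "rotation_group = range (P 0)"

lemma subgroup_translation_group: "subgroup translation_group G"
  by (rule subgroupI)
    (auto simp: translation_group_def P_closed P_inv P_mult lat_uminus lat_add intro: lat_zero)

lemma subgroup_rotation_group: "subgroup rotation_group G"
  by (rule subgroupI) (auto simp: rotation_group_def P_closed P_inv P_mult lat_zero)

lemma semidirect_translation_rotation: "semidirect_product G translation_group rotation_group"
  unfolding semidirect_product_def
proof (intro conjI)
  show "translation_group \<lhd> G"
    unfolding normal_inv_iff
  proof (intro conjI ballI subgroup_translation_group)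
    fix x h assume "x \<in> carrier G" "h \<in> translation_group"
    then obtain t i s where x: "t \<in> lat" "x = P t i" and h: "s \<in> lat" "h = P s 0"
      using P_onto unfolding translation_group_def by blast
    have "x \<otimes> h \<otimes> inv x = P (zeta d powi i * s) 0"
      using x h by (simp add: P_inv P_mult lat_add lat_uminus zeta_powi_stable
          flip: zeta_powi_add mult.assoc)
    then show "x \<otimes> h \<otimes> inv x \<in> translation_group"
      using h by (simp add: translation_group_def zeta_powi_stable)
  qed
  show "subgroup rotation_group G" by (rule subgroup_rotation_group)
  show "translation_group \<inter> rotation_group = {\<one>}"
  proof -
    have "x = \<one>" if x: "x \<in> translation_group" "x \<in> rotation_group" for x
    proof -
      obtain t j where t: "t \<in> lat" "x = P t 0" "x = P 0 j"
        using x unfolding translation_group_def rotation_group_def by blast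
      then show ?thesis using P_eq_iff[of t 0 0 j] by (simp add: P_eq_one lat_zero)
    qed
    then show ?thesis
      using subgroup.one_closed[OF subgroup_translation_group] subgroup.one_closed[OF subgroup_rotation_group]
      by blast
  qed
  show "translation_group <#> rotation_group = carrier G"
  proof (intro equalityI subsetI)
    fix x assume "x \<in> carrier G"
    then obtain t j where "t \<in> lat" "x = P t j" using P_onto by meson
    then have "x = P t 0 \<otimes> P 0 j" by (simp only: P_decompose[of t j])
    moreover have "P t 0 \<in> translation_group" "P 0 j \<in> rotation_group"
      using \<open>t \<in> lat\<close> by (simp_all add: translation_group_def rotation_group_def)
    ultimately show "x \<in> translation_group <#> rotation_group"
      unfolding set_mult_def by blast
  next
    fix x assume "x \<in> translation_group <#> rotation_group"
    then show "x \<in> carrier G"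
      using subgroup.mem_carrier[OF subgroup_translation_group]
        subgroup.mem_carrier[OF subgroup_rotation_group]
      unfolding set_mult_def by blast
  qed
qed

lemma rotation_group_iso: "G\<lparr>carrier := rotation_group\<rparr> \<cong> integer_mod_group d"
proof (rule is_iso_of_common_cover)
  show "range (P 0) = carrier (G\<lparr>carrier := rotation_group\<rparr>)" by (simp add: rotation_group_def)
  show "range (\<lambda>j. j mod int d) = carrier (integer_mod_group d)"
  proof -
    have "j \<in> range (\<lambda>j. j mod int d)" if "j \<in> {0..<int d}" for j
      using that by (intro image_eqI[of _ _ j]) auto
    then show ?thesis using pos by (auto simp: carrier_integer_mod_group)
  qed
  show "P 0 i = P 0 j \<longleftrightarrow> i mod int d = j mod int d" for i j
    by (simp add: P_eq_iff lat_zero sublat_zero mod_eq_dvd_iff)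
  show "P 0 (i + j) = P 0 i \<otimes>\<^bsub>G\<lparr>carrier := rotation_group\<rparr>\<^esub> P 0 j" for i j
    by (simp add: P_mult lat_zero)
qed (auto simp: mod_add_eq)

lemma translation_group_iso:
  "G\<lparr>carrier := translation_group\<rparr> \<cong> integer_mod_group m \<times>\<times> integer_mod_group (m * k)"
proof (rule is_iso_of_common_cover)
  let ?f = "\<lambda>(a, b). P (of_int a * u + of_int b * v) 0"
  let ?g = "\<lambda>(a, b). (a mod int m, b mod int (m * k))"
  let ?op = "\<lambda>(a, b) (a', b'). (a + a', b + b') :: int \<times> int"
  show "range ?f = carrier (G\<lparr>carrier := translation_group\<rparr>)"
    by (auto simp: translation_group_def lat_comb image_iff elim!: zspanE)
  show "range ?g = carrier (integer_mod_group m \<times>\<times> integer_mod_group (m * k))"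
  proof -
    have "x \<in> range ?g" if "x \<in> {0..<int m} \<times> {0..<int (m * k)}" for x
      using that by (intro image_eqI[of _ _ x]) auto
    then show ?thesis using pos by (auto simp: carrier_integer_mod_group)
  qed
  show "?f (?op x y) = ?f x \<otimes>\<^bsub>G\<lparr>carrier := translation_group\<rparr>\<^esub> ?f y" for x y
  proof -
    obtain a b a' b' where xy: "x = (a, b)" "y = (a', b')" by (metis surj_pair)
    have "?f x \<otimes> ?f y = P ((of_int a * u + of_int b * v) + (of_int a' * u + of_int b' * v)) 0"
      by (simp add: xy P_mult lat_comb)
    then show ?thesis by (simp add: xy algebra_simps)
  qed
  show "?f x = ?f y \<longleftrightarrow> ?g x = ?g y" for x y
    by (auto simp: P_comb_eq_iff mod_eq_dvd_iff split: prod.splits)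
qed (auto simp: mod_add_eq split: prod.splits)

lemma conj_by_rotation: "t \<in> lat \<Longrightarrow> conj_by G (P 0 j) (P t 0) = P (zeta d powi j * t) 0"
  by (simp add: conj_by_def P_inv P_mult lat_zero zeta_powi_stable)

text \<open>The relation is the minimal polynomial of \<zeta>, with \<open>e\<close> its linear
  coefficient. The single generating orbit is that of a \<int>[\<zeta>]-generator \<open>w\<close>
  of the lattice, supplied by \<open>zspan_principal\<close>.\<close>

lemma root_of_unity_action_rotation_group:
  assumes d: "d \<in> {3, 4, 6}"
  shows "root_of_unity_action d G translation_group rotation_group"
proof -
  define e :: int where "e = (if d = 3 then 1 else if d = 4 then 0 else - 1)"
  have e: "zeta d * zeta d + of_int e * zeta d + 1 = 0"
    using d zeta_3 zeta_4 zeta_6 by (auto simp: e_def)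
  have gen: "generate G {P 0 1} = rotation_group"
    using generate_pow[OF P_closed[OF lat_zero], of 1]
    by (auto simp: rotation_group_def P_rotation_int_pow)
  have "conj_by G (P 0 1) (conj_by G (P 0 1) y) \<otimes> (conj_by G (P 0 1) y [^] e) \<otimes> y = \<one>"
    if y: "y \<in> translation_group" for y
  proof -
    obtain t where t: "t \<in> lat" "y = P t 0" using y unfolding translation_group_def by blast
    have "zeta d * (zeta d * t) + of_int e * (zeta d * t) + t
        = (zeta d * zeta d + of_int e * zeta d + 1) * t" by (simp add: algebra_simps)
    then have "zeta d * (zeta d * t) + of_int e * (zeta d * t) + t = 0" unfolding e by simp
    then show ?thesis
      using t by (simp add: conj_by_rotation stable P_translation_int_pow P_mult lat_of_int lat_add P_zero)
  qed
  moreover have "\<exists>x\<in>translation_group. generate G ((\<lambda>g. conj_by G g x) ` rotation_group) = translation_group"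
  proof -
    have "d \<ge> 3" using d by auto
    then obtain w where w: "lat = zspan w (zeta d * w)"
      using zspan_principal[OF nondegenerate Im_zeta stable] by metis
    then have wl: "w \<in> lat" using zspan_gens by metis
    let ?O = "(\<lambda>g. conj_by G g (P w 0)) ` rotation_group"
    have O: "?O = range (\<lambda>j. P (zeta d powi j * w) 0)"
      by (auto simp: rotation_group_def conj_by_rotation wl image_image)
    have "generate G ?O = translation_group"
    proof
      show "generate G ?O \<subseteq> translation_group"
        by (rule generate_subgroup_incl[OF _ subgroup_translation_group])
           (auto simp: O translation_group_def zeta_powi_stable wl)
      have sub: "subgroup (generate G ?O) G"
        by (rule generate_is_subgroup) (auto simp: O P_closed zeta_powi_stable wl)
      \<comment> \<open>The rotations with exponents 0 and 1 already carry \<open>w\<close> to the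
        basis \<open>w, zeta d * w\<close>.\<close>
      have in1: "P w 0 \<in> generate G ?O"
        by (rule generate.incl) (auto simp: O intro!: image_eqI[of _ _ 0])
      have in2: "P (zeta d * w) 0 \<in> generate G ?O"
        by (rule generate.incl) (auto simp: O intro!: image_eqI[of _ _ 1])
      show "translation_group \<subseteq> generate G ?O"
      proof
        fix x assume "x \<in> translation_group"
        then obtain t where t: "t \<in> lat" "x = P t 0" by (auto simp: translation_group_def)
        from t(1) obtain a b where "t = of_int a * w + of_int b * (zeta d * w)"
          unfolding w by (rule zspanE)
        then have "x = P w 0 [^] a \<otimes> P (zeta d * w) 0 [^] b"
          using t(2) wl by (simp add: P_translation_int_pow stable P_mult lat_of_int)
        then show "x \<in> generate G ?O"
          using in1 in2 subgroup.m_closed[OF sub] subgroup_int_pow_closed[OF sub] by simp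
      qed
    qed
    then show ?thesis using wl by (auto simp: translation_group_def)
  qed
  moreover have "P 0 1 \<in> rotation_group" by (simp add: rotation_group_def)
  ultimately show ?thesis
    unfolding root_of_unity_action_def Let_def e_def[symmetric] using gen by blast
qed

text \<open>Since \<zeta> preserves the sublattice, it maps \<open>m u\<close> to a vector whose
  \<open>v\<close>-coordinate \<open>m b\<close> is divisible by \<open>m k\<close>; so
  \<open>k\<close> divides \<open>b\<close>. Comparing the coefficients of \<open>v\<close> in the
  quadratic equation applied to \<open>v\<close> gives h^2 + e h + 1 = - p b.\<close>

lemma norm_form_divisibility:
  assumes e: "zeta d * zeta d + of_int e * zeta d + 1 = 0"
  shows "\<exists>h. int k dvd h\<^sup>2 + e * h + 1"
proof -
  obtain a b where 1: "zeta d * u = of_int a * u + of_int b * v"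
    using stable[OF zspan_gens(1)] by (rule zspanE)
  obtain p h where 2: "zeta d * v = of_int p * u + of_int h * v"
    using stable[OF zspan_gens(2)] by (rule zspanE)
  have mu: "of_nat m * u \<in> sublat"
    using comb_in_sublat_iff[of "int m" 0] by simp
  have "zeta d * (of_nat m * u) \<in> sublat"
    using sublat_stable[OF mu, of 1] by simp
  also have "zeta d * (of_nat m * u) = of_int (int m * a) * u + of_int (int m * b) * v"
    using 1 by (simp add: mult.left_commute[of "zeta d"]) (simp add: algebra_simps)
  finally have "int (m * k) dvd int m * b" unfolding comb_in_sublat_iff by simp
  then have kb: "int k dvd b" using pos by simp
  have "(zeta d * zeta d + of_int e * zeta d + 1) * v
      = zeta d * (zeta d * v) + of_int e * (zeta d * v) + v" by (simp add: algebra_simps)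
  also have "\<dots> = of_int p * (zeta d * u) + of_int h * (zeta d * v) + of_int e * (zeta d * v) + v"
    by (subst 2) (simp add: algebra_simps)
  also have "\<dots> = of_int (p * a + h * p + e * p) * u + of_int (p * b + h * h + e * h + 1) * v"
    unfolding 1 2 by (simp add: algebra_simps)
  finally have "of_int (p * a + h * p + e * p) * u + of_int (p * b + h * h + e * h + 1) * v
      = of_int 0 * u + of_int 0 * v"
    by (simp only: e) simp
  from zspan_coords_unique[OF nondegenerate this] have "h\<^sup>2 + e * h + 1 = - p * b"
    by (simp add: power2_eq_square algebra_simps)
  then have "int k dvd h\<^sup>2 + e * h + 1" using kb by simp
  then show ?thesis ..
qed

text \<open>The semidirect product of translations and rotations is the required structure. The form
  with two generators also covers \<open>m = 1\<close>, where the first factor is trivial.\<close>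

lemma exceptional_list_if_order_gt_2:
  assumes nc: "\<not> comm_group G" and "d > 2"
  shows "exceptional_list G"
proof -
  have d: "d \<in> {3, 4, 6}"
    using zeta_stable_order[OF nondegenerate pos(3) stable] \<open>d > 2\<close> by auto
  have "\<exists>h::int. int k dvd h\<^sup>2 + (if d = 4 then 0 else 1) * h + 1"
  proof (cases "d = 6")
    \<comment> \<open>For \<open>d = 6\<close> the minimal polynomial has linear coefficient -1,
      while the condition on \<open>k\<close> is stated with +1; negating \<open>h\<close>
      reconciles them.\<close>
    case True
    then obtain h where "int k dvd h\<^sup>2 + (- 1) * h + 1"
      using norm_form_divisibility[of "- 1"] zeta_6 by auto
    then show ?thesis using True by (intro exI[of _ "- h"]) simp
  next
    case False
    then show ?thesis
      using norm_form_divisibility[of "if d = 4 then 0 else 1"] zeta_3 zeta_4 d by auto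
  qed
  then have "exceptional_elliptic m k d G translation_group"
    unfolding exceptional_elliptic_def
    using is_group finite_carrier nc order_eq semidirect_translation_rotation rotation_group_iso
      root_of_unity_action_rotation_group[OF d] d pos by blast
  then show ?thesis
    using translation_group_iso unfolding exceptional_list_def exceptional_elliptic_two_def by blast
qed

end

section \<open>Finite groups of automorphisms\<close>

text \<open>Division by \<open>c = m u\<close> turns the sublattice into the span of 1 and
  \<open>\<tau> = k v / u\<close>. Replacing \<tau> by its negative keeps this span, so \<omega> may
  be taken in the upper half-plane. The element \<open>P t j\<close> then acts on the torus by z
  \<mapsto> \<zeta>^j z + t / c.\<close>

lemma (in affine_group) embeds_in_torus_aut:
  "\<exists>\<omega> S. Im \<omega> > 0 \<and> subgroup S (torus_aut \<omega>) \<and> G \<cong> torus_aut \<omega>\<lparr>carrier := S\<rparr>"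
proof -
  define c where "c = of_nat m * u"
  have u: "u \<noteq> 0" using nondegenerate by auto
  have c: "c \<noteq> 0" using u pos by (simp add: c_def)
  define \<tau> where "\<tau> = of_nat k * v / u"
  have "Im \<tau> \<noteq> 0"
  proof
    assume "Im \<tau> = 0"
    then have "\<tau> = of_real (Re \<tau>)" by (simp add: complex_eq_iff)
    moreover have "of_nat k * v = \<tau> * u" using u by (simp add: \<tau>_def)
    ultimately have "of_nat k * v = of_real (Re \<tau>) * u" by simp
    then have "Im (cnj u * (of_nat k * v)) = 0" by (simp only:) (simp add: algebra_simps)
    then have "of_nat k * Im (cnj u * v) = 0" by (simp add: algebra_simps)
    then show False using nondegenerate pos by simp
  qed
  define \<omega> where "\<omega> = (if Im \<tau> > 0 then \<tau> else - \<tau>)"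
  have \<omega>: "Im \<omega> > 0" using \<open>Im \<tau> \<noteq> 0\<close> by (auto simp: \<omega>_def)
  then have \<omega>0: "Im \<omega> \<noteq> 0" by simp
  have "sublat = zspan (c * 1) (c * \<tau>)"
    using u by (simp add: sublattice_def c_def \<tau>_def mult_ac)
  also have "\<dots> = (\<lambda>x. c * x) ` period_lattice \<omega>"
    unfolding zspan_scale period_lattice_eq_zspan by (simp add: \<omega>_def zspan_uminus)
  finally have sub: "t \<in> sublat \<longleftrightarrow> t / c \<in> period_lattice \<omega>" for t
    using c by (auto simp: image_iff) (metis nonzero_mult_div_cancel_left times_divide_eq_right)
  have unit: "lattice_unit \<omega> (zeta d powi j)" for j
  proof (intro lattice_unit_power_int lattice_unitI zeta_nonzero)
    fix x assume "x \<in> period_lattice \<omega>"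
    then have x: "c * x \<in> sublat" using sub[of "c * x"] c by simp
    show "zeta d * x \<in> period_lattice \<omega>"
      using sublat_stable[OF x, of 1] sub[of "zeta d * (c * x)"] c by (simp add: field_simps)
    show "x / zeta d \<in> period_lattice \<omega>"
      using sublat_stable[OF x, of "- 1"] sub[of "inverse (zeta d) * (c * x)"] c
      by (simp add: field_simps power_int_minus)
  qed
  define g where "g = (\<lambda>(t, j). torus_map \<omega> (zeta d powi j) (t / c))"
  define C where "C = lat \<times> (UNIV :: int set)"
  define op where "op = (\<lambda>(t, i) (s, j). (t + zeta d powi i * s, i + j :: int))"
  have op: "op x y \<in> C" if "x \<in> C" "y \<in> C" for x y
    using that by (auto simp: op_def C_def lat_add zeta_powi_stable split: prod.splits)
  have g_mult: "g (op x y) = g x \<otimes>\<^bsub>torus_aut \<omega>\<^esub> g y" for x y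
    using c by (auto simp: g_def op_def torus_map_mult[OF unit unit] zeta_powi_add field_simps
        split: prod.splits)
  have g_closed: "g x \<in> carrier (torus_aut \<omega>)" for x
    by (auto simp: g_def torus_map_in_carrier[OF unit] split: prod.splits)
  have "subgroup (g ` C) (torus_aut \<omega>)"
  proof (rule group.subgroupI[OF group_torus_aut[OF \<omega>0]])
    show "g ` C \<subseteq> carrier (torus_aut \<omega>)" using g_closed by auto
    show "g ` C \<noteq> {}" using lat_zero by (auto simp: C_def)
    show "x \<otimes>\<^bsub>torus_aut \<omega>\<^esub> y \<in> g ` C" if "x \<in> g ` C" "y \<in> g ` C" for x y
      using that op by (auto simp flip: g_mult)
    show "inv\<^bsub>torus_aut \<omega>\<^esub> x \<in> g ` C" if x: "x \<in> g ` C" for x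
    proof -
      obtain t j where t: "t \<in> lat" "x = g (t, j)" using x by (auto simp: C_def)
      define y where "y = (- (zeta d powi (- j) * t), - j)"
      have "g y \<otimes>\<^bsub>torus_aut \<omega>\<^esub> x = \<one>\<^bsub>torus_aut \<omega>\<^esub>"
        by (simp add: t(2) flip: g_mult) (simp add: y_def op_def g_def torus_map_one)
      then have "inv\<^bsub>torus_aut \<omega>\<^esub> x = g y"
        by (rule group.inv_equality[OF group_torus_aut[OF \<omega>0]]) (auto simp: t(2) g_closed)
      moreover have "y \<in> C" using t by (simp add: y_def C_def lat_uminus zeta_powi_stable)
      ultimately show ?thesis by simp
    qed
  qed
  moreover have "G \<cong> torus_aut \<omega>\<lparr>carrier := g ` C\<rparr>"
  proof (rule is_iso_of_common_cover[where op = op])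
    let ?f = "\<lambda>(t, j). P t j"
    show "?f ` C = carrier G"
    proof (intro equalityI subsetI)
      fix x assume "x \<in> carrier G"
      then obtain t j where "t \<in> lat" "x = P t j" using P_onto by meson
      then show "x \<in> ?f ` C" by (intro image_eqI[of _ _ "(t, j)"]) (auto simp: C_def)
    qed (auto simp: C_def P_closed)
    show "?f (op x y) = ?f x \<otimes> ?f y" if "x \<in> C" "y \<in> C" for x y
      using that by (auto simp: C_def op_def P_mult)
    show "?f x = ?f y \<longleftrightarrow> g x = g y" if "x \<in> C" "y \<in> C" for x y
      using that
      by (auto simp: C_def g_def P_eq_iff torus_map_eq_iff[OF \<omega>0 unit unit] sub
          zeta_powi_eq_iff[OF pos(3)] diff_divide_distrib)
  qed (auto simp: op g_mult)
  ultimately show ?thesis using \<omega> by blast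
qed

text \<open>Composing \<open>P\<close> with the isomorphism transports the presentation, so each
  listed group may be treated on a concrete model.\<close>

lemma affine_group_iso:
  assumes "affine_group G P u v m k d" "G \<cong> H" "group H"
  shows "\<exists>Q. affine_group H Q u v m k d"
proof -
  interpret affine_group G P u v m k d by fact
  interpret H: group H by fact
  obtain h where h: "h \<in> iso G H" using \<open>G \<cong> H\<close> by (auto simp: is_iso_def)
  then have hom: "h \<in> hom G H" and bij: "bij_betw h (carrier G) (carrier H)"
    by (auto simp: iso_def)
  have "affine_group H (\<lambda>t j. h (P t j)) u v m k d"
  proof unfold_locales
    show "h (P t j) \<in> carrier H" if "t \<in> lat" for t j
      using hom P_closed[OF that] by (auto simp: hom_def)
    show "\<exists>t\<in>lat. \<exists>j. y = h (P t j)" if y: "y \<in> carrier H" for y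
    proof -
      obtain x where x: "x \<in> carrier G" "y = h x"
        using bij_betw_imp_surj_on[OF bij] y by blast
      obtain t j where "t \<in> lat" "x = P t j" using P_onto[OF x(1)] by meson
      then show ?thesis unfolding x(2) by (intro bexI[of _ t] exI[of _ j]) simp
    qed
    show "h (P t i) \<otimes>\<^bsub>H\<^esub> h (P s j) = h (P (t + zeta d powi i * s) (i + j))"
      if "t \<in> lat" "s \<in> lat" for t s i j
      using hom_mult[OF hom P_closed[OF that(1)] P_closed[OF that(2)]] that by (simp add: P_mult)
    show "h (P t j) = \<one>\<^bsub>H\<^esub> \<longleftrightarrow> t \<in> sublat \<and> int d dvd j" if "t \<in> lat" for t j
    proof -
      have "h \<one>\<^bsub>G\<^esub> = \<one>\<^bsub>H\<^esub>" using hom_one[OF hom is_group assms(3)] .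
      then have "h (P t j) = \<one>\<^bsub>H\<^esub> \<longleftrightarrow> P t j = \<one>\<^bsub>G\<^esub>"
        using bij P_closed[OF that, of j] by (metis bij_betw_imp_inj_on inj_on_eq_iff one_closed)
      then show ?thesis by (simp add: P_eq_one[OF that])
    qed
  qed (use nondegenerate pos stable in auto)
  then show ?thesis by blast
qed

text \<open>Multiplication by an element \<open>x\<close> permutes \<open>A\<close>, and comparing
  the products over \<open>A\<close> gives \<open>x ^ card A = 1\<close>. So \<open>A\<close> lies
  in the set of \<open>card A\<close>-th roots of unity and fills it by counting.\<close>

lemma finite_mult_closed_roots:
  fixes A :: "complex set"
  assumes "finite A" "A \<noteq> {}" "0 \<notin> A" and cl: "\<And>x y. x \<in> A \<Longrightarrow> y \<in> A \<Longrightarrow> x * y \<in> A"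
  shows "zeta (card A) \<in> A" "\<And>x. x \<in> A \<Longrightarrow> \<exists>j. x = zeta (card A) powi j"
proof -
  have n: "card A > 0" using assms by (simp add: card_gt_0_iff)
  have "x ^ card A = 1" if "x \<in> A" for x
  proof -
    have inj: "inj_on (\<lambda>y. x * y) A" using that assms by (auto intro: inj_onI)
    moreover have "(\<lambda>y. x * y) ` A \<subseteq> A" using cl that by auto
    ultimately have "(\<lambda>y. x * y) ` A = A" using assms(1) by (simp add: endo_inj_surj)
    then have "prod id A = prod (\<lambda>y. x * y) A"
      using prod.reindex[OF inj, of id] by simp
    also have "\<dots> = x ^ card A * prod id A" by (simp add: prod.distrib)
    finally show ?thesis using assms by simp
  qed
  then have "A \<subseteq> {z. z ^ card A = 1}" by blast
  then have A: "A = {z. z ^ card A = 1}"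
    using n by (intro card_subset_eq finite_roots_unity) (simp_all add: card_roots_unity_eq)
  have A_iff: "x \<in> A \<longleftrightarrow> x ^ card A = 1" for x
    using arg_cong[OF A, of "\<lambda>B. x \<in> B"] by (simp only: mem_Collect_eq)
  have "zeta (card A) powi int (card A) = 1" using zeta_powi_eq_1_iff[OF n, of "int (card A)"] by simp
  then have "zeta (card A) ^ card A = 1" by simp
  then show "zeta (card A) \<in> A" by (simp only: A_iff)
  show "\<exists>j. x = zeta (card A) powi j" if "x \<in> A" for x
  proof -
    have "x \<in> {z. z ^ card A = 1}" using that by (simp only: A_iff mem_Collect_eq)
    then obtain i where "x = cis (2 * pi * real i / real (card A))"
      using Complex.bij_betw_roots_unity[OF n] by (auto simp: bij_betw_def)
    then have "x = zeta (card A) powi int i"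
      unfolding zeta_def cis_power_int by (simp add: field_simps)
    then show ?thesis by blast
  qed
qed

text \<open>A maximal rotation in \<open>S\<close> fixes a point \<open>p\<close>. With \<open>p\<close> as the new origin it becomes
  \<open>z \<mapsto> \<zeta> z\<close>, and it splits off from the translations.\<close>

lemma affine_group_of_finite_subgroup:
  assumes \<omega>: "Im \<omega> > 0" and S: "subgroup S (torus_aut \<omega>)" and fin: "finite S"
  shows "\<exists>P u v m k. affine_group (torus_aut \<omega>\<lparr>carrier := S\<rparr>) P u v m k (card (lift_multiplier \<omega> ` S))"
proof -
  have \<omega>0: "Im \<omega> \<noteq> 0" using \<omega> by simp
  let ?A = "torus_aut \<omega>"
  interpret A: group ?A by (rule group_torus_aut[OF \<omega>0])
  interpret S: subgroup S ?A by (rule S)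
  interpret AS: group "?A\<lparr>carrier := S\<rparr>" by (rule S.subgroup_is_group[OF A.is_group])
  have S_ne: "S \<noteq> {}" using S.one_closed by blast
  define n where "n = card (lift_multiplier \<omega> ` S)"
  have elem: "\<exists>\<beta>. \<sigma> = torus_map \<omega> (lift_multiplier \<omega> \<sigma>) \<beta> \<and> lattice_unit \<omega> (lift_multiplier \<omega> \<sigma>)"
    if "\<sigma> \<in> S" for \<sigma>
    using carrier_torus_autE[OF \<omega>0 S.mem_carrier[OF that]] lift_multiplier_torus_map[OF \<omega>0] by metis
  have mult: "x * y \<in> lift_multiplier \<omega> ` S"
      if xy: "x \<in> lift_multiplier \<omega> ` S" "y \<in> lift_multiplier \<omega> ` S" for x y
    proof -
      obtain \<sigma> \<tau> where st: "\<sigma> \<in> S" "x = lift_multiplier \<omega> \<sigma>" "\<tau> \<in> S" "y = lift_multiplier \<omega> \<tau>"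
        using xy by blast
      obtain b c where "\<sigma> = torus_map \<omega> x b" "lattice_unit \<omega> x" "\<tau> = torus_map \<omega> y c" "lattice_unit \<omega> y"
        using elem[OF st(1)] elem[OF st(3)] st by blast
      then have "lift_multiplier \<omega> (\<sigma> \<otimes>\<^bsub>?A\<^esub> \<tau>) = x * y"
        by (simp add: torus_map_mult lift_multiplier_torus_map[OF \<omega>0] lattice_unit_mult)
      then show ?thesis using S.m_closed[OF st(1,3)] by (metis imageI)
    qed
  have "0 \<notin> lift_multiplier \<omega> ` S" using elem lattice_unit_nonzero by force
  note roots = finite_mult_closed_roots[OF _ _ this mult, folded n_def]
  have roots: "zeta n \<in> lift_multiplier \<omega> ` S"
    "\<And>x. x \<in> lift_multiplier \<omega> ` S \<Longrightarrow> \<exists>j. x = zeta n powi j"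
    using roots fin S.one_closed by blast+
  have n: "n > 0" unfolding n_def using fin S_ne by (auto simp: card_gt_0_iff)
  obtain \<sigma> where \<sigma>: "\<sigma> \<in> S" "lift_multiplier \<omega> \<sigma> = zeta n" using roots(1) by auto
  obtain \<beta> where \<beta>: "\<sigma> = torus_map \<omega> (zeta n) \<beta>" "lattice_unit \<omega> (zeta n)"
    using elem[OF \<sigma>(1)] \<sigma>(2) by auto
  have unit: "lattice_unit \<omega> (zeta n powi j)" for j by (rule lattice_unit_power_int[OF \<beta>(2)])
  \<comment> \<open>The fixed point of z \<mapsto> \<zeta> z + \<beta> is \<beta> / (1 - \<zeta>).
    If \<zeta> = 1 there is no rotation to centre, and any \<open>p\<close> serves.\<close>
  obtain p where p: "torus_map \<omega> (zeta n) ((1 - zeta n) * p) \<in> S"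
  proof (cases "zeta n = 1")
    case True
    then show ?thesis using S.one_closed that[of 0] by (simp add: torus_map_one)
  next
    case False
    then show ?thesis using that[of "\<beta> / (1 - zeta n)"] \<sigma> \<beta> by simp
  qed
  \<comment> \<open>The rotation about \<open>p\<close> by \<open>zeta n powi j\<close>, followed by
    the translation by \<open>t\<close>.\<close>
  define Q where "Q t j = torus_map \<omega> (zeta n powi j) (t + (1 - zeta n powi j) * p)" for t j
  have Q_mult: "Q t i \<otimes>\<^bsub>?A\<^esub> Q s j = Q (t + zeta n powi i * s) (i + j)" for t s i j
    by (simp add: Q_def torus_map_mult[OF unit unit] zeta_powi_add algebra_simps)
  have Q_carrier: "Q t j \<in> carrier ?A" for t j
    by (simp add: Q_def torus_map_in_carrier[OF unit])
  have Q_one: "Q t j = \<one>\<^bsub>?A\<^esub> \<longleftrightarrow> t \<in> period_lattice \<omega> \<and> int n dvd j" for t j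
    using zeta_powi_eq_1_iff[OF n, of j]
    by (auto simp: Q_def torus_map_one torus_map_eq_iff[OF \<omega>0 unit lattice_unit_1])
  have L0: "0 \<in> period_lattice \<omega>" by (rule add_subgroup_0[OF add_subgroup_period_lattice])
  have Q_zero: "Q 0 0 = \<one>\<^bsub>?A\<^esub>" using Q_one L0 by simp
  have Q_inv: "inv\<^bsub>?A\<^esub> (Q t j) = Q (- (zeta n powi (- j) * t)) (- j)" for t j
    by (rule A.inv_equality) (simp_all add: Q_mult Q_carrier Q_zero)
  have rot: "Q 0 j \<in> S" for j
  proof (induction j rule: int_induct[of _ 0])
    case base
    show ?case using S.one_closed by (simp add: Q_zero)
  next
    case (step1 i)
    have "Q 0 1 \<in> S" using p by (simp add: Q_def)
    from S.m_closed[OF step1(2) this] show ?case by (simp add: Q_mult)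
  next
    case (step2 i)
    have "Q 0 1 \<in> S" using p by (simp add: Q_def)
    from S.m_closed[OF step2(2) S.m_inv_closed[OF this]] show ?case by (simp add: Q_mult Q_inv)
  qed
  \<comment> \<open>The lifts of the translations in \<open>S\<close>. As \<open>S\<close> contains
    all rotations \<open>Q 0 j\<close>, membership of \<open>Q t j\<close> in \<open>S\<close>
    depends on \<open>t\<close> alone.\<close>
  define M where "M = {t. Q t 0 \<in> S}"
  have trans: "Q t j \<in> S \<longleftrightarrow> t \<in> M" for t j
  proof
    assume "Q t j \<in> S"
    from S.m_closed[OF this rot[of "- j"]] show "t \<in> M" by (simp add: M_def Q_mult)
  next
    assume "t \<in> M"
    then have "Q t 0 \<otimes>\<^bsub>?A\<^esub> Q 0 j \<in> S" by (intro S.m_closed rot) (simp add: M_def)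
    then show "Q t j \<in> S" by (simp add: Q_mult)
  qed
  have LM: "period_lattice \<omega> \<subseteq> M"
  proof
    fix t assume "t \<in> period_lattice \<omega>"
    then have "Q t 0 = \<one>\<^bsub>?A\<^esub>" by (simp add: Q_one)
    then show "t \<in> M" using S.one_closed by (simp add: M_def)
  qed
  have M_sub: "add_subgroup M"
    unfolding add_subgroup_def
  proof (intro conjI ballI)
    show "0 \<in> M" using L0 LM by auto
    fix x y assume xy: "x \<in> M" "y \<in> M"
    then have "Q x 0 \<otimes>\<^bsub>?A\<^esub> inv\<^bsub>?A\<^esub> (Q y 0) \<in> S"
      by (intro S.m_closed S.m_inv_closed) (simp_all add: M_def)
    then show "x - y \<in> M" by (simp add: M_def Q_inv Q_mult)
  qed
  define N where "N = card S"
  have N: "N > 0" using fin S_ne by (auto simp: N_def card_gt_0_iff)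
  have NM: "of_nat N * t \<in> period_lattice \<omega>" if t: "t \<in> M" for t
  proof -
    have "Q t 0 [^]\<^bsub>?A\<lparr>carrier := S\<rparr>\<^esub> i = Q (of_nat i * t) 0" for i :: nat
      by (induction i) (simp_all add: Q_zero Q_mult algebra_simps)
    moreover have "Q t 0 [^]\<^bsub>?A\<lparr>carrier := S\<rparr>\<^esub> N = \<one>\<^bsub>?A\<^esub>"
      using AS.pow_order_eq_1[of "Q t 0"] t fin by (simp add: order_def N_def M_def)
    ultimately show ?thesis using Q_one by metis
  qed
  have M_stable: "zeta n * t \<in> M" if "t \<in> M" for t
  proof -
    have "Q 0 1 \<otimes>\<^bsub>?A\<^esub> Q t 0 \<in> S" using that by (intro S.m_closed rot) (simp add: M_def)
    then show ?thesis by (simp add: Q_mult trans)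
  qed
  \<comment> \<open>By Lagrange's theorem \<open>M\<close> lies between the period lattice and 1/N
    times that lattice. This application only serves to find some basis of \<open>M\<close>; a
    second one, to the period lattice inside \<open>M\<close>, yields the adapted basis
    \<open>u, v\<close>.\<close>
  obtain u1 v1 m1 k1 where 1: "Im (cnj u1 * v1) \<noteq> 0" "m1 > 0" "k1 > 0"
    "M = zspan (of_nat m1 * u1) (of_nat (m1 * k1) * v1)"
  proof (rule zspan_elementary_divisors[of "1 / of_nat N" "\<omega> / of_nat N" M N])
    show "Im (cnj (1 / of_nat N) * (\<omega> / of_nat N)) \<noteq> 0"
      using \<omega> N by (simp add: Im_divide_of_nat)
    have sp: "zspan 1 \<omega> = (\<lambda>x. of_nat N * x) ` zspan (1 / of_nat N) (\<omega> / of_nat N)"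
      using N by (simp flip: zspan_scale)
    show "M \<subseteq> zspan (1 / of_nat N) (\<omega> / of_nat N)"
    proof
      fix t assume "t \<in> M"
      from NM[OF this] show "t \<in> zspan (1 / of_nat N) (\<omega> / of_nat N)"
        unfolding period_lattice_eq_zspan sp using N by auto
    qed
    show "of_nat N * x \<in> M" if "x \<in> zspan (1 / of_nat N) (\<omega> / of_nat N)" for x
      using that LM sp by (auto simp: period_lattice_eq_zspan)
  qed (use M_sub N in auto)
  let ?u = "of_nat m1 * u1" and ?v = "of_nat (m1 * k1) * v1"
  have nd: "Im (cnj ?u * ?v) \<noteq> 0"
  proof -
    have "cnj ?u * ?v = of_nat (m1 * (m1 * k1)) * (cnj u1 * v1)" by (simp add: mult_ac)
    moreover have "Im (of_nat q * z) = of_nat q * Im z" for q z by simp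
    ultimately have "Im (cnj ?u * ?v) = of_nat (m1 * (m1 * k1)) * Im (cnj u1 * v1)"
      by (simp only:)
    then show ?thesis using 1 by simp
  qed
  obtain u v m k where 2: "Im (cnj u * v) \<noteq> 0" "zspan u v = M" "m > 0" "k > 0"
    "period_lattice \<omega> = zspan (of_nat m * u) (of_nat (m * k) * v)"
    using zspan_elementary_divisors[OF nd add_subgroup_period_lattice, of \<omega> N] LM NM N 1(4) by metis
  have "affine_group (?A\<lparr>carrier := S\<rparr>) Q u v m k n"
  proof unfold_locales
    show "\<exists>t\<in>zspan u v. \<exists>j. g = Q t j" if "g \<in> carrier (?A\<lparr>carrier := S\<rparr>)" for g
    proof -
      have g: "g \<in> S" using that by simp
      obtain b where b: "g = torus_map \<omega> (lift_multiplier \<omega> g) b" using elem[OF g] by blast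
      obtain j where "lift_multiplier \<omega> g = zeta n powi j" using roots(2) g by blast
      then have "g = Q (b - (1 - zeta n powi j) * p) j" using b by (simp add: Q_def)
      then show ?thesis using g trans 2(2) by blast
    qed
    show "Q t j = \<one>\<^bsub>?A\<lparr>carrier := S\<rparr>\<^esub> \<longleftrightarrow> t \<in> sublattice u v m (m * k) \<and> int n dvd j" for t j
      using Q_one[of t j] 2(5) by (simp add: sublattice_def)
  qed (use 2 n trans M_stable in \<open>auto simp: Q_mult\<close>)
  then show ?thesis unfolding n_def by blast
qed

section \<open>Realization of the listed groups\<close>

text \<open>The real coordinates of \<open>t\<close> with respect to 1 and \<theta>. On
  \<open>zspan 1 \<theta>\<close> they are integers, and the floor merely changes the type.\<close>

definition coord1 :: "complex \<Rightarrow> complex \<Rightarrow> int" where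
  "coord1 \<theta> t = \<lfloor>Re t - Im t / Im \<theta> * Re \<theta>\<rfloor>"

definition coord2 :: "complex \<Rightarrow> complex \<Rightarrow> int" where
  "coord2 \<theta> t = \<lfloor>Im t / Im \<theta>\<rfloor>"

lemma coord_comb:
  assumes "Im \<theta> \<noteq> 0"
  shows "coord1 \<theta> (of_int a + of_int b * \<theta>) = a" "coord2 \<theta> (of_int a + of_int b * \<theta>) = b"
  using assms by (simp_all add: coord1_def coord2_def)

lemma zspan_1_coords:
  assumes "Im \<theta> \<noteq> 0" "t \<in> zspan 1 \<theta>"
  shows "t = of_int (coord1 \<theta> t) + of_int (coord2 \<theta> t) * \<theta>"
proof -
  obtain a b where "t = of_int a * 1 + of_int b * \<theta>" using assms(2) by (rule zspanE)
  then show ?thesis using coord_comb[OF assms(1), of a b] by simp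
qed

lemma comb_in_zspan_1: "of_int a + of_int b * \<theta> \<in> zspan 1 \<theta>"
  by (rule zspanI[of _ a _ b]) simp

text \<open>For \<open>d \<le> 2\<close> the rotation acts by a sign and preserves every lattice, so
  \<int>[\<i>] can serve as the model. The conditions are then stated in integer coordinates
  alone.\<close>

lemma affine_group_of_int_model:
  fixes g :: "int \<Rightarrow> int \<Rightarrow> int \<Rightarrow> 'a"
  assumes G: "group G" and pos: "m > 0" "k > 0" and d: "d = 1 \<or> d = 2"
    and g_closed: "\<And>a b j. g a b j \<in> carrier G"
    and g_onto: "\<And>x. x \<in> carrier G \<Longrightarrow> \<exists>a b j. x = g a b j"
    and g_mult: "\<And>a b i a' b' j. g a b i \<otimes>\<^bsub>G\<^esub> g a' b' j =
      (if d = 2 \<and> odd i then g (a - a') (b - b') (i + j) else g (a + a') (b + b') (i + j))"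
    and g_one: "\<And>a b j. g a b j = \<one>\<^bsub>G\<^esub> \<longleftrightarrow> int m dvd a \<and> int (m * k) dvd b \<and> int d dvd j"
  shows "\<exists>P u v. affine_group G P u v m k d"
proof -
  interpret group G by fact
  define c1 where "c1 = coord1 \<i>"
  define c2 where "c2 = coord2 \<i>"
  have c: "c1 (of_int a + of_int b * \<i>) = a" "c2 (of_int a + of_int b * \<i>) = b" for a b
    using coord_comb[of \<i>] by (simp_all add: c1_def c2_def)
  have E: "\<exists>a b. t = of_int a + of_int b * \<i>" if "t \<in> zspan 1 \<i>" for t
    using zspan_1_coords[OF _ that] by auto
  have z: "zeta d powi i = (if d = 2 \<and> odd i then - 1 else 1)" for i
    using d zeta_1 by (auto simp: zeta_2 power_int_minus_left)
  have "affine_group G (\<lambda>t j. g (c1 t) (c2 t) j) 1 \<i> m k d"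
  proof unfold_locales
    show "zeta d * t \<in> zspan 1 \<i>" if "t \<in> zspan 1 \<i>" for t
      using that d zeta_1 add_subgroup_uminus[OF add_subgroup_zspan that] by (auto simp: zeta_2)
    show "\<exists>t\<in>zspan 1 \<i>. \<exists>j. x = g (c1 t) (c2 t) j" if x: "x \<in> carrier G" for x
    proof -
      obtain a b j where "x = g a b j" using g_onto[OF x] by blast
      then show ?thesis
        using comb_in_zspan_1[of a b \<i>] c by (intro bexI[of _ "of_int a + of_int b * \<i>"]) auto
    qed
    show "g (c1 t) (c2 t) i \<otimes>\<^bsub>G\<^esub> g (c1 s) (c2 s) j =
        g (c1 (t + zeta d powi i * s)) (c2 (t + zeta d powi i * s)) (i + j)"
      if ts: "t \<in> zspan 1 \<i>" "s \<in> zspan 1 \<i>" for t s i j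
    proof -
      obtain a b where t: "t = of_int a + of_int b * \<i>" using E[OF ts(1)] by blast
      obtain a' b' where s: "s = of_int a' + of_int b' * \<i>" using E[OF ts(2)] by blast
      have "t + s = of_int (a + a') + of_int (b + b') * \<i>" "t - s = of_int (a - a') + of_int (b - b') * \<i>"
        by (simp_all add: t s algebra_simps)
      then have "c1 (t + s) = a + a'" "c2 (t + s) = b + b'" "c1 (t - s) = a - a'" "c2 (t - s) = b - b'"
        by (simp_all only: c)
      moreover have "c1 t = a" "c2 t = b" "c1 s = a'" "c2 s = b'" by (simp_all add: t s c)
      ultimately show ?thesis by (auto simp: z g_mult)
    qed
    show "g (c1 t) (c2 t) j = \<one>\<^bsub>G\<^esub> \<longleftrightarrow> t \<in> sublattice 1 \<i> m (m * k) \<and> int d dvd j"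
      if t: "t \<in> zspan 1 \<i>" for t j
    proof -
      obtain a b where "t = of_int a + of_int b * \<i>" using E[OF t] by blast
      then show ?thesis
        using sublattice_mem_iff[of 1 \<i> a b m "m * k"] by (simp add: c g_one)
    qed
  qed (use pos d g_closed in auto)
  then show ?thesis by blast
qed

section \<open>Abelian and dihedral groups\<close>

lemma abelian_general_list_affine_group:
  assumes "group G" "abelian_general_list G"
  shows "\<exists>P u v m k d. affine_group G P u v m k d"
proof -
  from assms(2) consider (one) m where "m \<ge> 1" "G \<cong> integer_mod_group m"
    | (two) m n where "m \<ge> 2" "n \<ge> 1" "G \<cong> integer_mod_group m \<times>\<times> integer_mod_group (m * n)"
    by (auto simp: abelian_general_list_def)
  then show ?thesis
  proof cases
    case one
    have "\<exists>P u v. affine_group (integer_mod_group m) P u v 1 m 1"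
    proof (rule affine_group_of_int_model[where g = "\<lambda>a b j. b mod int m"])
      show "\<exists>(a :: int) b (j :: int). x = b mod int m" if "x \<in> carrier (integer_mod_group m)" for x
        using that one(1) by (intro exI[of _ 0] exI[of _ x]) (auto simp: carrier_integer_mod_group)
    qed (use one(1) in \<open>auto simp: carrier_integer_mod_group mod_add_eq mod_eq_0_iff_dvd\<close>)
    then show ?thesis
      using affine_group_iso[OF _ group.iso_sym[OF assms(1) one(2)] assms(1)] by blast
  next
    case two
    let ?H = "integer_mod_group m \<times>\<times> integer_mod_group (m * n)"
    have "\<exists>P u v. affine_group ?H P u v m n 1"
    proof (rule affine_group_of_int_model[where g = "\<lambda>a b j. (a mod int m, b mod int (m * n))"])
      show "group ?H" by (simp add: DirProd_group)
      show "\<exists>a b j :: int. x = (a mod int m, b mod int (m * n))" if "x \<in> carrier ?H" for x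
        using that two(1,2) by (intro exI[of _ "fst x"] exI[of _ "snd x"])
          (auto simp: carrier_integer_mod_group)
    qed (use two(1,2) in \<open>auto simp: carrier_integer_mod_group mod_add_eq mod_eq_0_iff_dvd\<close>)
    then show ?thesis
      using affine_group_iso[OF _ group.iso_sym[OF assms(1) two(3)] assms(1)] by blast
  qed
qed

lemma abelian_special_list_affine_group:
  assumes G: "group G" and "abelian_special_list G"
  shows "\<exists>P u v m k d. affine_group G P u v m k d"
proof -
  let ?Z = integer_mod_group
  let ?H = "?Z 2 \<times>\<times> (?Z 2 \<times>\<times> ?Z 2)"
  have cyclic: "abelian_general_list G" if "G \<cong> ?Z m" "m \<ge> 1" for m
    using that by (auto simp: abelian_general_list_def)
  have two: "abelian_general_list G" if "G \<cong> ?Z m \<times>\<times> ?Z (m * n)" "m \<ge> 2" "n \<ge> 1" for m n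
    using that by (auto simp: abelian_general_list_def)
  \<comment> \<open>All entries but the last elementary abelian 2-group need at most two generators,
    so they are realized by translations. The remaining one consists of the 2-torsion translations
    together with z \<mapsto> - z.\<close>
  have "abelian_general_list G \<or> G \<cong> ?H"
    using assms(2) cyclic[of 2] cyclic[of 3] cyclic[of 4] cyclic[of 6]
      two[of 2 1] two[of 3 1] two[of 2 2]
    unfolding abelian_special_list_def by (elim disjE) simp_all
  then show ?thesis
  proof
    assume three: "G \<cong> ?H"
    have H: "group ?H" by (simp add: DirProd_group)
    have "\<exists>P u v. affine_group ?H P u v 2 1 2"
    proof (rule affine_group_of_int_model[where g = "\<lambda>a b j. (a mod 2, b mod 2, j mod 2)"])
      show "\<exists>a b j :: int. x = (a mod 2, b mod 2, j mod 2)" if "x \<in> carrier ?H" for x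
        using that by (intro exI[of _ "fst x"] exI[of _ "fst (snd x)"] exI[of _ "snd (snd x)"])
          (auto simp: carrier_integer_mod_group)
      \<comment> \<open>The sign introduced by an odd rotation is invisible modulo 2.\<close>
      show "(a mod 2, b mod 2, i mod 2) \<otimes>\<^bsub>?H\<^esub> (a' mod 2, b' mod 2, j mod 2) =
        (if 2 = 2 \<and> odd i then ((a - a') mod 2, (b - b') mod 2, (i + j) mod 2)
         else ((a + a') mod 2, (b + b') mod 2, (i + j) mod 2))" for a b i a' b' j :: int
        by (simp add: mod_add_eq) presburger
    qed (use H in \<open>auto simp: carrier_integer_mod_group mod_eq_0_iff_dvd\<close>)
    then show ?thesis
      using affine_group_iso[OF _ group.iso_sym[OF G three] G] by blast
  qed (rule abelian_general_list_affine_group[OF G])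
qed

lemma dihedral_group_affine_group:
  assumes G: "group G" and n: "n \<ge> 3" and iso: "G \<cong> dihedral_group n"
  shows "\<exists>P u v m k d. affine_group G P u v m k d"
proof -
  let ?D = "dihedral_group n"
  \<comment> \<open>The monoid laws suffice here: inverses are inherited from \<open>G\<close> along
    the isomorphism.\<close>
  have D: "monoid ?D"
  proof (rule monoidI)
    show "x \<otimes>\<^bsub>?D\<^esub> y \<otimes>\<^bsub>?D\<^esub> z = x \<otimes>\<^bsub>?D\<^esub> (y \<otimes>\<^bsub>?D\<^esub> z)" for x y z
      by (cases x; cases y; cases z) (auto simp: dihedral_group_def mod_simps
        add.assoc add_diff_eq diff_diff_eq diff_add_eq diff_diff_eq2)
  qed (use n in \<open>auto simp: dihedral_group_def\<close>)
  have "\<exists>P u v. affine_group ?D P u v 1 n 2"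
  proof (rule affine_group_of_int_model[where g = "\<lambda>a b j. (b mod int n, odd j)"])
    show "group ?D" by (rule group.iso_imp_group[OF G iso D])
    show "\<exists>(a :: int) b (j :: int). x = (b mod int n, odd j)" if "x \<in> carrier ?D" for x
      using that by (intro exI[of _ 0] exI[of _ "fst x"] exI[of _ "if snd x then 1 else 0"])
        (auto simp: dihedral_group_def)
  qed (use n in \<open>auto simp: dihedral_group_def mod_simps mod_eq_0_iff_dvd\<close>)
  then show ?thesis
    using affine_group_iso[OF _ group.iso_sym[OF G iso] G] by blast
qed

section \<open>Groups given by generators and relations\<close>

lemma (in group) conj_by_hom:
  assumes s: "s \<in> carrier G" shows "conj_by G s \<in> hom G G"
proof (rule homI)
  fix a b assume ab: "a \<in> carrier G" "b \<in> carrier G"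
  then have "conj_by G s a \<otimes> conj_by G s b = s \<otimes> (a \<otimes> ((inv s \<otimes> s) \<otimes> (b \<otimes> inv s)))"
    using s by (simp only: conj_by_def m_assoc m_closed inv_closed)
  then show "conj_by G s (a \<otimes> b) = conj_by G s a \<otimes> conj_by G s b"
    using ab s by (simp add: conj_by_def m_assoc)
qed (use s in \<open>simp add: conj_by_def\<close>)

lemma (in group) conj_by_int_pow:
  assumes "s \<in> carrier G" "x \<in> carrier G"
  shows "conj_by G s (x [^] (i :: int)) = conj_by G s x [^] i"
  using hom_int_pow[OF conj_by_hom[OF assms(1)] assms(2) is_group is_group] .

lemma (in group) conj_by_mult:
  assumes "s \<in> carrier G" "x \<in> carrier G" "y \<in> carrier G"
  shows "conj_by G s (x \<otimes> y) = conj_by G s x \<otimes> conj_by G s y"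
  using hom_mult[OF conj_by_hom] assms by blast

lemma (in group) conj_by_eq_iff:
  assumes "s \<in> carrier G" "x \<in> carrier G" "y \<in> carrier G"
  shows "conj_by G s x = y \<longleftrightarrow> s \<otimes> x = y \<otimes> s"
  using assms inv_solve_right[of y "s \<otimes> x" s] unfolding conj_by_def by auto

text \<open>Conjugation by \<open>w\<close> is a homomorphism that fixes \<open>z\<close>, hence
  also its powers.\<close>

lemma (in group) int_pow_commute:
  assumes "z \<in> carrier G" "w \<in> carrier G" "z \<otimes> w = w \<otimes> z"
  shows "z [^] (i :: int) \<otimes> w = w \<otimes> z [^] i"
proof -
  have "conj_by G w z = z" using assms by (simp add: conj_by_eq_iff)
  then have "conj_by G w (z [^] i) = z [^] i" using assms by (simp add: conj_by_int_pow)
  then show ?thesis using assms by (simp add: conj_by_eq_iff)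
qed

text \<open>Sending a + b \<theta> to x^a y^b is a homomorphism \<open>E\<close> from the lattice to
  \<open>G\<close>, and the hypothesis on conjugation says that \<open>s\<close> acts on its image
  as \<zeta> acts on the lattice. The kernel of \<open>E\<close> becomes the sublattice. The last
  hypothesis keeps the powers of \<open>s\<close> apart from the image of \<open>E\<close>, so that
  the extension splits.\<close>

lemma affine_group_of_generators:
  assumes G: "group G" and fin: "finite (carrier G)"
    and xys: "x \<in> carrier G" "y \<in> carrier G" "s \<in> carrier G" and xy: "x \<otimes>\<^bsub>G\<^esub> y = y \<otimes>\<^bsub>G\<^esub> x"
    and gen: "generate G {x, y, s} = carrier G"
    and \<theta>: "Im \<theta> \<noteq> 0" and d: "d > 0" and st: "\<And>t. t \<in> zspan 1 \<theta> \<Longrightarrow> zeta d * t \<in> zspan 1 \<theta>"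
    and conj: "\<And>a b a' b'. zeta d * (of_int a + of_int b * \<theta>) = of_int a' + of_int b' * \<theta> \<Longrightarrow>
      s \<otimes>\<^bsub>G\<^esub> (x [^]\<^bsub>G\<^esub> (a::int) \<otimes>\<^bsub>G\<^esub> y [^]\<^bsub>G\<^esub> (b::int)) = x [^]\<^bsub>G\<^esub> (a'::int) \<otimes>\<^bsub>G\<^esub> y [^]\<^bsub>G\<^esub> (b'::int) \<otimes>\<^bsub>G\<^esub> s"
    and sd: "group.ord G s = d"
    and ker: "\<And>a b j. x [^]\<^bsub>G\<^esub> (a::int) \<otimes>\<^bsub>G\<^esub> y [^]\<^bsub>G\<^esub> (b::int) \<otimes>\<^bsub>G\<^esub> s [^]\<^bsub>G\<^esub> (j::int) = \<one>\<^bsub>G\<^esub> \<Longrightarrow>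
      s [^]\<^bsub>G\<^esub> (j::int) = \<one>\<^bsub>G\<^esub>"
  shows "\<exists>P u v m k. affine_group G P u v m k d"
proof -
  interpret group G by fact
  let ?\<Lambda> = "zspan 1 \<theta>"
  define E where "E t = x [^]\<^bsub>G\<^esub> coord1 \<theta> t \<otimes>\<^bsub>G\<^esub> y [^]\<^bsub>G\<^esub> coord2 \<theta> t" for t
  have E_comb: "E (of_int a + of_int b * \<theta>) = x [^]\<^bsub>G\<^esub> a \<otimes>\<^bsub>G\<^esub> y [^]\<^bsub>G\<^esub> b" for a b
    by (simp add: E_def coord_comb[OF \<theta>])
  have E_closed: "E t \<in> carrier G" for t using xys by (simp add: E_def)
  have elim: "\<exists>a b. t = of_int a + of_int b * \<theta>" if "t \<in> ?\<Lambda>" for t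
    using zspan_1_coords[OF \<theta> that] by blast
  note add = add_subgroup_add[OF add_subgroup_zspan[of 1 \<theta>]]
    and um = add_subgroup_uminus[OF add_subgroup_zspan[of 1 \<theta>]]
    and zero = add_subgroup_0[OF add_subgroup_zspan[of 1 \<theta>]]
  have comm: "x [^]\<^bsub>G\<^esub> (a::int) \<otimes>\<^bsub>G\<^esub> y [^]\<^bsub>G\<^esub> (b::int) = y [^]\<^bsub>G\<^esub> b \<otimes>\<^bsub>G\<^esub> x [^]\<^bsub>G\<^esub> a" for a b
  proof -
    have "y [^]\<^bsub>G\<^esub> b \<otimes>\<^bsub>G\<^esub> x = x \<otimes>\<^bsub>G\<^esub> y [^]\<^bsub>G\<^esub> b"
      using int_pow_commute xys xy by simp
    then show ?thesis using int_pow_commute[of x "y [^]\<^bsub>G\<^esub> b" a] xys by simp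
  qed
  have E_add: "E (t + r) = E t \<otimes>\<^bsub>G\<^esub> E r" if tr: "t \<in> ?\<Lambda>" "r \<in> ?\<Lambda>" for t r
  proof -
    obtain a b where t: "t = of_int a + of_int b * \<theta>" using elim[OF tr(1)] by blast
    obtain a' b' where r: "r = of_int a' + of_int b' * \<theta>" using elim[OF tr(2)] by blast
    have "t + r = of_int (a + a') + of_int (b + b') * \<theta>" by (simp add: t r algebra_simps)
    then have "E (t + r) = x [^]\<^bsub>G\<^esub> (a + a') \<otimes>\<^bsub>G\<^esub> y [^]\<^bsub>G\<^esub> (b + b')" by (simp only: E_comb)
    also have "\<dots> = x [^]\<^bsub>G\<^esub> a \<otimes>\<^bsub>G\<^esub> (x [^]\<^bsub>G\<^esub> a' \<otimes>\<^bsub>G\<^esub> y [^]\<^bsub>G\<^esub> b) \<otimes>\<^bsub>G\<^esub> y [^]\<^bsub>G\<^esub> b'"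
      using xys by (simp add: int_pow_mult m_assoc)
    also have "\<dots> = E t \<otimes>\<^bsub>G\<^esub> E r"
      unfolding comm[of a' b] t r E_comb using xys by (simp add: m_assoc)
    finally show ?thesis .
  qed
  have E_zero: "E 0 = \<one>\<^bsub>G\<^esub>" using E_comb[of 0 0] by simp
  have zst: "zeta d powi j * t \<in> ?\<Lambda>" if t: "t \<in> ?\<Lambda>" for t j
  proof -
    have p: "zeta d ^ n * t \<in> ?\<Lambda>" for n by (induction n) (auto simp: mult.assoc st t)
    define n where "n = nat (j mod int d)"
    have "int d dvd j - int n" using d by (simp add: n_def minus_mod_eq_mult_div)
    then have "zeta d powi j = zeta d powi int n" using zeta_powi_eq_iff[OF d] by blast
    then have "zeta d powi j = zeta d ^ n" by simp
    then show ?thesis using p by simp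
  qed
  have s_nat: "s [^]\<^bsub>G\<^esub> n \<otimes>\<^bsub>G\<^esub> E t = E (zeta d ^ n * t) \<otimes>\<^bsub>G\<^esub> s [^]\<^bsub>G\<^esub> n" if t: "t \<in> ?\<Lambda>" for t and n :: nat
    using t
  proof (induction n arbitrary: t)
    case (Suc n)
    obtain a b where t: "t = of_int a + of_int b * \<theta>" using elim[OF Suc.prems] by blast
    obtain a' b' where z: "zeta d * t = of_int a' + of_int b' * \<theta>" using elim[OF st[OF Suc.prems]] by blast
    have "s \<otimes>\<^bsub>G\<^esub> E t = E (zeta d * t) \<otimes>\<^bsub>G\<^esub> s"
      using conj[of a b a' b'] z by (simp add: E_comb t)
    then have "s [^]\<^bsub>G\<^esub> Suc n \<otimes>\<^bsub>G\<^esub> E t = (s [^]\<^bsub>G\<^esub> n \<otimes>\<^bsub>G\<^esub> E (zeta d * t)) \<otimes>\<^bsub>G\<^esub> s"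
      using xys E_closed by (simp add: m_assoc)
    also have "\<dots> = E (zeta d ^ Suc n * t) \<otimes>\<^bsub>G\<^esub> s [^]\<^bsub>G\<^esub> Suc n"
      using Suc.IH[OF st[OF Suc.prems]] xys E_closed by (simp add: m_assoc mult_ac)
    finally show ?case .
  qed (use E_closed in simp)
  have s_int: "s [^]\<^bsub>G\<^esub> j \<otimes>\<^bsub>G\<^esub> E t = E (zeta d powi j * t) \<otimes>\<^bsub>G\<^esub> s [^]\<^bsub>G\<^esub> j" if t: "t \<in> ?\<Lambda>" for t and j :: int
  proof -
    \<comment> \<open>Both \<open>zeta d\<close> and \<open>s\<close> have order \<open>d\<close>,
      so the exponent can be reduced to a natural number, for which the claim was shown by
      induction.\<close>
    define n where "n = nat (j mod int d)"
    have dvd: "int d dvd j - int n" using d by (simp add: n_def minus_mod_eq_mult_div)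
    have "zeta d powi j = zeta d powi int n" using zeta_powi_eq_iff[OF d] dvd by blast
    then have z: "zeta d powi j = zeta d ^ n" by simp
    have "s [^]\<^bsub>G\<^esub> (j - int n) = \<one>\<^bsub>G\<^esub>" using dvd sd xys by (simp add: int_pow_eq_id)
    then have "s [^]\<^bsub>G\<^esub> j = s [^]\<^bsub>G\<^esub> n"
      using xys by (metis diff_add_cancel int_pow_int int_pow_mult l_one nat_pow_closed)
    then show ?thesis using s_nat[OF t] z by simp
  qed
  define P where "P t j = E t \<otimes>\<^bsub>G\<^esub> s [^]\<^bsub>G\<^esub> j" for t and j :: int
  have P_closed: "P t j \<in> carrier G" for t j using E_closed xys by (simp add: P_def)
  have P_mult: "P t i \<otimes>\<^bsub>G\<^esub> P r j = P (t + zeta d powi i * r) (i + j)"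
    if tr: "t \<in> ?\<Lambda>" "r \<in> ?\<Lambda>" for t r i j
  proof -
    have "P t i \<otimes>\<^bsub>G\<^esub> P r j = E t \<otimes>\<^bsub>G\<^esub> (s [^]\<^bsub>G\<^esub> i \<otimes>\<^bsub>G\<^esub> E r) \<otimes>\<^bsub>G\<^esub> s [^]\<^bsub>G\<^esub> j"
      using xys E_closed by (simp add: P_def m_assoc)
    also have "\<dots> = E t \<otimes>\<^bsub>G\<^esub> E (zeta d powi i * r) \<otimes>\<^bsub>G\<^esub> (s [^]\<^bsub>G\<^esub> i \<otimes>\<^bsub>G\<^esub> s [^]\<^bsub>G\<^esub> j)"
      unfolding s_int[OF tr(2)] using xys E_closed by (simp add: m_assoc)
    finally show ?thesis using tr zst xys by (simp add: P_def E_add int_pow_mult)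
  qed
  \<comment> \<open>The lattice of relations between \<open>x\<close> and \<open>y\<close>. By
    Lagrange's theorem it contains \<open>order G\<close> times the whole lattice, hence it has rank
    2.\<close>
  define M where "M = {t \<in> ?\<Lambda>. E t = \<one>\<^bsub>G\<^esub>}"
  have E_uminus: "E (- t) = inv\<^bsub>G\<^esub> (E t)" if "t \<in> ?\<Lambda>" for t
    using E_add[OF um[OF that] that] E_zero E_closed by (metis add.left_inverse inv_equality)
  have M_sub: "add_subgroup M"
    unfolding add_subgroup_def
  proof (intro conjI ballI)
    show "0 \<in> M" by (simp add: M_def zero E_zero)
    fix t r assume "t \<in> M" "r \<in> M"
    then show "t - r \<in> M"
      using E_add[OF _ um, of t r] add[OF _ um, of t r] by (simp add: M_def E_uminus)
  qed
  have M_le: "M \<subseteq> ?\<Lambda>" by (auto simp: M_def)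
  define N where "N = order G"
  have N: "N > 0" using fin one_closed by (auto simp: N_def order_gt_0_iff_finite)
  have NM: "of_nat N * t \<in> M" if t: "t \<in> ?\<Lambda>" for t
  proof -
    have "of_nat n * t \<in> ?\<Lambda> \<and> E (of_nat n * t) = E t [^]\<^bsub>G\<^esub> n" for n :: nat
    proof (induction n)
      case (Suc n)
      then show ?case using E_add[OF _ t, of "of_nat n * t"] add[OF _ t, of "of_nat n * t"]
        by (simp add: distrib_right add.commute)
    qed (simp add: zero E_zero)
    then show ?thesis using pow_order_eq_1[OF E_closed, of t] by (simp add: M_def N_def)
  qed
  have nd: "Im (cnj 1 * \<theta>) \<noteq> 0" using \<theta> by simp
  obtain u v m k where uv: "Im (cnj u * v) \<noteq> 0" "zspan u v = ?\<Lambda>" "m > 0" "k > 0"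
    "M = zspan (of_nat m * u) (of_nat (m * k) * v)"
    using zspan_elementary_divisors[OF nd M_sub _ N NM] M_le by metis
  have "affine_group G P u v m k d"
  proof unfold_locales
    show "\<exists>t\<in>zspan u v. \<exists>j. g = P t j" if g: "g \<in> carrier G" for g
    proof -
      \<comment> \<open>The values of \<open>P\<close> form a subgroup containing the three
        generators.\<close>
      define K where "K = {P t j | t j. t \<in> ?\<Lambda>}"
      have KI: "P t j \<in> K" if "t \<in> ?\<Lambda>" for t j using that by (auto simp: K_def)
      have "subgroup K G"
      proof (rule subgroupI)
        show "K \<subseteq> carrier G" using P_closed by (auto simp: K_def)
        show "K \<noteq> {}" using KI[OF zero] by auto
        show "inv\<^bsub>G\<^esub> a \<in> K" if a: "a \<in> K" for a
        proof -
          obtain t j where t: "t \<in> ?\<Lambda>" "a = P t j" using a by (auto simp: K_def)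
          let ?b = "P (- (zeta d powi (- j) * t)) (- j)"
          have "?b \<otimes>\<^bsub>G\<^esub> a = P 0 0" using t zst um by (simp add: P_mult)
          then have "?b \<otimes>\<^bsub>G\<^esub> a = \<one>\<^bsub>G\<^esub>" by (simp add: P_def E_zero)
          then have "inv\<^bsub>G\<^esub> a = ?b" using P_closed t by (simp add: inv_equality)
          then show ?thesis using t zst um KI by simp
        qed
        show "a \<otimes>\<^bsub>G\<^esub> b \<in> K" if ab: "a \<in> K" "b \<in> K" for a b
        proof -
          obtain t i where t: "t \<in> ?\<Lambda>" "a = P t i" using ab(1) by (auto simp: K_def)
          obtain r j where r: "r \<in> ?\<Lambda>" "b = P r j" using ab(2) by (auto simp: K_def)
          show ?thesis using t r zst add KI by (simp add: P_mult)
        qed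
      qed
      moreover have "x \<in> K"
        using KI[OF comb_in_zspan_1, of 1 0 0] E_comb[of 1 0] xys by (simp add: P_def)
      moreover have "y \<in> K"
        using KI[OF comb_in_zspan_1, of 0 1 0] E_comb[of 0 1] xys by (simp add: P_def)
      moreover have "s \<in> K"
        using KI[OF zero, of 1] xys by (simp add: P_def E_zero)
      ultimately have "carrier G \<subseteq> K"
        unfolding gen[symmetric] by (intro generate_subgroup_incl) auto
      then show ?thesis using g uv(2) by (auto simp: K_def)
    qed
    show "P t j = \<one>\<^bsub>G\<^esub> \<longleftrightarrow> t \<in> sublattice u v m (m * k) \<and> int d dvd j" if t: "t \<in> zspan u v" for t j
    proof -
      have "s [^]\<^bsub>G\<^esub> j = \<one>\<^bsub>G\<^esub>" if "P t j = \<one>\<^bsub>G\<^esub>"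
        using that ker unfolding P_def E_def by blast
      then have "P t j = \<one>\<^bsub>G\<^esub> \<longleftrightarrow> E t = \<one>\<^bsub>G\<^esub> \<and> s [^]\<^bsub>G\<^esub> j = \<one>\<^bsub>G\<^esub>"
        using E_closed by (auto simp: P_def)
      then show ?thesis
        using t uv(2,5) xys sd by (auto simp: sublattice_def M_def int_pow_eq_id)
    qed
  qed (use uv d st P_closed P_mult in auto)
  then show ?thesis by blast
qed

text \<open>The cyclic groups generated by \<open>b\<close> and \<open>c\<close> may intersect, so
  the invariants of the sublattice are taken from the relations between \<open>b\<close> and
  \<open>c\<close> and not from their orders. What has to be shown is that \<open>a\<close> is not a
  product of powers of \<open>b\<close> and \<open>c\<close>.\<close>

lemma bidihedral_affine_group:
  assumes "bidihedral m n G"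
  shows "\<exists>P u v m k d. affine_group G P u v m k d"
proof -
  from assms obtain a b c where G: "group G" "finite (carrier G)" and n: "n \<ge> 3"
    and abc: "a \<in> carrier G" "b \<in> carrier G" "c \<in> carrier G" "generate G {a, b, c} = carrier G"
    and ord: "group.ord G a = 2" "group.ord G c = n"
    and rel: "a \<otimes>\<^bsub>G\<^esub> b \<otimes>\<^bsub>G\<^esub> a = inv\<^bsub>G\<^esub> b" "a \<otimes>\<^bsub>G\<^esub> c \<otimes>\<^bsub>G\<^esub> a = inv\<^bsub>G\<^esub> c"
      "b \<otimes>\<^bsub>G\<^esub> c = c \<otimes>\<^bsub>G\<^esub> b"
    by (auto simp: bidihedral_def)
  interpret group G by fact
  have aa: "a \<otimes>\<^bsub>G\<^esub> a = \<one>\<^bsub>G\<^esub>"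
    using pow_ord_eq_1[OF abc(1)] abc(1) by (simp add: ord numeral_2_eq_2)
  then have inv_a: "inv\<^bsub>G\<^esub> a = a" using abc by (simp add: inv_equality)
  have conj_pow: "conj_by G a (x [^]\<^bsub>G\<^esub> i) = x [^]\<^bsub>G\<^esub> (- i)"
    if "x \<in> carrier G" "a \<otimes>\<^bsub>G\<^esub> x \<otimes>\<^bsub>G\<^esub> a = inv\<^bsub>G\<^esub> x" for x and i :: int
  proof -
    have "conj_by G a x = inv\<^bsub>G\<^esub> x" using that by (simp add: conj_by_def inv_a)
    then show ?thesis using that abc(1) by (simp add: conj_by_int_pow int_pow_inv int_pow_neg)
  qed
  have z: "zeta 2 * (of_int i + of_int j * \<i>) = of_int (- i) + of_int (- j) * \<i>" for i j
    by (simp add: zeta_2 algebra_simps)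
  have "\<exists>P u v m k. affine_group G P u v m k 2"
  proof (rule affine_group_of_generators[where x = b and y = c and s = a and \<theta> = \<i>])
    show "generate G {b, c, a} = carrier G" using abc(4) by (simp add: insert_commute)
    show "zeta 2 * t \<in> zspan 1 \<i>" if "t \<in> zspan 1 \<i>" for t
      using add_subgroup_uminus[OF add_subgroup_zspan that] by (simp add: zeta_2)
    show "a \<otimes>\<^bsub>G\<^esub> (b [^]\<^bsub>G\<^esub> i \<otimes>\<^bsub>G\<^esub> c [^]\<^bsub>G\<^esub> j) = b [^]\<^bsub>G\<^esub> i' \<otimes>\<^bsub>G\<^esub> c [^]\<^bsub>G\<^esub> j' \<otimes>\<^bsub>G\<^esub> a"
      if "zeta 2 * (of_int i + of_int j * \<i>) = of_int i' + of_int j' * \<i>" for i j i' j' :: int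
    proof -
      have "i' = - i" "j' = - j" using that unfolding z by (auto simp: complex_eq_iff)
      then have "conj_by G a (b [^]\<^bsub>G\<^esub> i \<otimes>\<^bsub>G\<^esub> c [^]\<^bsub>G\<^esub> j) = b [^]\<^bsub>G\<^esub> i' \<otimes>\<^bsub>G\<^esub> c [^]\<^bsub>G\<^esub> j'"
        using abc rel conj_pow by (simp add: conj_by_mult)
      then show ?thesis using abc by (simp add: conj_by_eq_iff)
    qed
    show "a [^]\<^bsub>G\<^esub> l = \<one>\<^bsub>G\<^esub>" if eq: "b [^]\<^bsub>G\<^esub> i \<otimes>\<^bsub>G\<^esub> c [^]\<^bsub>G\<^esub> j \<otimes>\<^bsub>G\<^esub> a [^]\<^bsub>G\<^esub> l = \<one>\<^bsub>G\<^esub>" for i j l :: int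
    \<comment> \<open>Otherwise \<open>a\<close> lies in the abelian group generated by
      \<open>b\<close> and \<open>c\<close>. It then commutes with \<open>c\<close> as well as
      inverting it, so c^2 = 1, contrary to \<open>n \<ge> 3\<close>.\<close>
    proof (rule ccontr)
      assume no: "a [^]\<^bsub>G\<^esub> l \<noteq> \<one>\<^bsub>G\<^esub>"
      then have "odd l" using abc by (simp add: int_pow_eq_id ord)
      then obtain q where "l = 2 * q + 1" by (rule oddE)
      moreover have "a [^]\<^bsub>G\<^esub> (2 * q) = \<one>\<^bsub>G\<^esub>" using abc by (simp add: int_pow_eq_id ord)
      ultimately have al: "a [^]\<^bsub>G\<^esub> l = a" using abc by (simp add: int_pow_mult)
      let ?h = "b [^]\<^bsub>G\<^esub> i \<otimes>\<^bsub>G\<^esub> c [^]\<^bsub>G\<^esub> j"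
      have "inv\<^bsub>G\<^esub> a = ?h" using eq abc unfolding al by (intro inv_equality) simp_all
      then have h: "?h = a" by (simp add: inv_a)
      have "b [^]\<^bsub>G\<^esub> i \<otimes>\<^bsub>G\<^esub> c = c \<otimes>\<^bsub>G\<^esub> b [^]\<^bsub>G\<^esub> i" "c [^]\<^bsub>G\<^esub> j \<otimes>\<^bsub>G\<^esub> c = c \<otimes>\<^bsub>G\<^esub> c [^]\<^bsub>G\<^esub> j"
        using abc rel(3) by (simp_all add: int_pow_commute)
      then have "?h \<otimes>\<^bsub>G\<^esub> c = c \<otimes>\<^bsub>G\<^esub> ?h"
        using abc by (metis int_pow_closed m_assoc)
      then have "a \<otimes>\<^bsub>G\<^esub> c = c \<otimes>\<^bsub>G\<^esub> a" unfolding h .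
      then have "inv\<^bsub>G\<^esub> c = c" using rel(2) abc by (simp add: m_assoc aa)
      then have "c [^]\<^bsub>G\<^esub> (2::nat) = \<one>\<^bsub>G\<^esub>" using abc by (metis numeral_2_eq_2 nat_pow_Suc nat_pow_0 l_one r_inv)
      then have "n dvd 2" using abc by (simp add: pow_eq_id ord)
      then show False using n by (auto dest: dvd_imp_le)
    qed
  qed (use G abc rel ord in auto)
  then show ?thesis by blast
qed

text \<open>An element \<open>x\<close> whose orbit generates \<open>H\<close> makes
  \<open>H\<close> a quotient of \<int>[\<zeta>], with 1 sent to \<open>x\<close> and \<zeta> to its
  conjugate \<open>y\<close> by \<open>s\<close>. The relation imposed on the action is exactly the
  multiplication rule of \<int>[\<zeta>].\<close>

lemma exceptional_elliptic_affine_group: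
  assumes G: "exceptional_elliptic m k l G H" and H: "comm_group (G\<lparr>carrier := H\<rparr>)"
  shows "\<exists>P u v m k d. affine_group G P u v m k d"
proof -
  from G obtain K where grp: "group G" and fin: "finite (carrier G)" and l: "l \<in> {3, 4, 6}"
    and sd: "semidirect_product G H K" and K: "G\<lparr>carrier := K\<rparr> \<cong> integer_mod_group l"
    and act: "root_of_unity_action l G H K"
    unfolding exceptional_elliptic_def by blast
  interpret group G by fact
  have HN: "H \<lhd> G" and HG: "subgroup H G" and KG: "subgroup K G" and HK: "H \<inter> K = {\<one>\<^bsub>G\<^esub>}"
    and HKG: "H <#>\<^bsub>G\<^esub> K = carrier G"
    using sd by (auto simp: semidirect_product_def normal_imp_subgroup)
  interpret H: subgroup H G by fact
  interpret K: subgroup K G by fact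
  define e :: int where "e = (if l = 3 then 1 else if l = 4 then 0 else - 1)"
  obtain s x where s: "s \<in> K" "generate G {s} = K"
    and cyc: "\<And>y. y \<in> H \<Longrightarrow>
      conj_by G s (conj_by G s y) \<otimes>\<^bsub>G\<^esub> (conj_by G s y [^]\<^bsub>G\<^esub> e) \<otimes>\<^bsub>G\<^esub> y = \<one>\<^bsub>G\<^esub>"
    and x: "x \<in> H" "generate G ((\<lambda>g. conj_by G g x) ` K) = H"
    using act unfolding root_of_unity_action_def Let_def e_def[symmetric] by blast
  have sG: "s \<in> carrier G" and xG: "x \<in> carrier G" using s x by auto
  have conjH: "conj_by G g h \<in> H" if "g \<in> carrier G" "h \<in> H" for g h
    using HN that unfolding conj_by_def normal_inv_iff by blast
  have Hcomm: "h \<otimes>\<^bsub>G\<^esub> h' = h' \<otimes>\<^bsub>G\<^esub> h" if "h \<in> H" "h' \<in> H" for h h'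
    using comm_groupE(4)[OF H] that by simp
  define y where "y = conj_by G s x"
  define w where "w = conj_by G s y"
  have y: "y \<in> H" "y \<in> carrier G" using conjH[OF sG x(1)] by (auto simp: y_def)
  have w: "w \<in> H" "w \<in> carrier G" using conjH[OF sG y(1)] by (auto simp: w_def)
  have pow_H: "h [^]\<^bsub>G\<^esub> i \<in> H" if "h \<in> H" for h and i :: int
    using subgroup_int_pow_closed[OF HG that] .
  \<comment> \<open>The relation \<open>cyc\<close> at \<open>x\<close>, solved for
    \<open>w\<close>. It mirrors \<zeta>^2 = - 1 - e \<zeta>, with \<open>x, y, w\<close> in the
    roles of 1, \<zeta>, \<zeta>^2.\<close>
  have w_eq: "w = x [^]\<^bsub>G\<^esub> (- 1 :: int) \<otimes>\<^bsub>G\<^esub> y [^]\<^bsub>G\<^esub> (- e)"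
  proof -
    have "w \<otimes>\<^bsub>G\<^esub> (y [^]\<^bsub>G\<^esub> e \<otimes>\<^bsub>G\<^esub> x) = \<one>\<^bsub>G\<^esub>"
      using cyc[OF x(1)] w y xG by (simp add: w_def[symmetric] y_def[symmetric] m_assoc)
    then have "w = inv\<^bsub>G\<^esub> (y [^]\<^bsub>G\<^esub> e \<otimes>\<^bsub>G\<^esub> x)"
      using w y xG by (metis int_pow_closed inv_equality inv_inv m_closed)
    then show ?thesis using y xG by (simp add: inv_mult_group int_pow_neg)
  qed
  have z: "zeta l * zeta l = - (of_int e * zeta l) - 1"
    using l zeta_3 zeta_4 zeta_6 by (auto simp: e_def)
  have Im0: "Im (zeta l) \<noteq> 0" using l Im_zeta(1)[of l] by auto
  have zc: "zeta l * (of_int a + of_int b * zeta l) = of_int (- b) + of_int (a - e * b) * zeta l" for a b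
  proof -
    have "zeta l * (of_int a + of_int b * zeta l) = of_int a * zeta l + of_int b * (zeta l * zeta l)"
      by (simp add: algebra_simps)
    then show ?thesis unfolding z by (simp add: algebra_simps)
  qed
  have ord_s: "ord s = l"
  proof -
    have "card K = card (carrier (integer_mod_group l))"
      using iso_same_card[OF K] by simp
    then show ?thesis using l generate_pow_card[OF sG] s by (auto simp: carrier_integer_mod_group)
  qed
  have "\<exists>P u v m k. affine_group G P u v m k l"
  proof (rule affine_group_of_generators[where x = x and y = y and s = s and \<theta> = "zeta l"])
    show "generate G {x, y, s} = carrier G"
    proof
      let ?N = "generate G {x, y, s}"
      have N: "subgroup ?N G" using generate_is_subgroup[of "{x, y, s}"] xG y sG by simp
      interpret N: subgroup ?N G by fact
      have in_N: "x \<in> ?N" "s \<in> ?N" by (auto intro: generate.incl)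
      have KN: "K \<subseteq> ?N"
        using generate_subgroup_incl[of "{s}" ?N] in_N N s(2) by simp
      \<comment> \<open>\<open>H\<close> is generated by the conjugates of \<open>x\<close> under
        \<open>K\<close>, and these are words in \<open>x\<close> and \<open>s\<close>.\<close>
      have HN': "H \<subseteq> ?N"
        unfolding x(2)[symmetric]
      proof (rule generate_subgroup_incl[OF _ N])
        show "(\<lambda>g. conj_by G g x) ` K \<subseteq> ?N"
          using KN in_N by (auto simp: conj_by_def intro!: N.m_closed N.m_inv_closed)
      qed
      show "carrier G \<subseteq> ?N"
      proof
        fix g assume "g \<in> carrier G"
        then obtain h k' where "h \<in> H" "k' \<in> K" "g = h \<otimes>\<^bsub>G\<^esub> k'"
          unfolding HKG[symmetric] set_mult_def by blast
        then show "g \<in> ?N" using KN HN' N.m_closed by blast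
      qed
    qed (use generate_incl xG y sG in auto)
    show "zeta l * t \<in> zspan 1 (zeta l)" if t: "t \<in> zspan 1 (zeta l)" for t
    proof -
      obtain a b where "t = of_int a * 1 + of_int b * zeta l" using t by (rule zspanE)
      then have "zeta l * t = of_int (- b) + of_int (a - e * b) * zeta l" using zc by simp
      then show ?thesis using comb_in_zspan_1 by metis
    qed
    show "s \<otimes>\<^bsub>G\<^esub> (x [^]\<^bsub>G\<^esub> a \<otimes>\<^bsub>G\<^esub> y [^]\<^bsub>G\<^esub> b) = x [^]\<^bsub>G\<^esub> a' \<otimes>\<^bsub>G\<^esub> y [^]\<^bsub>G\<^esub> b' \<otimes>\<^bsub>G\<^esub> s"
      if eq: "zeta l * (of_int a + of_int b * zeta l) = of_int a' + of_int b' * zeta l"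
      for a b a' b' :: int
    proof -
      have "a' = - b" "b' = a - e * b"
        using coord_comb[OF Im0, of a' b'] coord_comb[OF Im0, of "- b" "a - e * b"]
        unfolding eq[symmetric] zc by simp_all
      have "conj_by G s (x [^]\<^bsub>G\<^esub> a \<otimes>\<^bsub>G\<^esub> y [^]\<^bsub>G\<^esub> b) = y [^]\<^bsub>G\<^esub> a \<otimes>\<^bsub>G\<^esub> w [^]\<^bsub>G\<^esub> b"
        using xG y sG by (simp add: conj_by_mult conj_by_int_pow flip: y_def w_def)
      also have "w [^]\<^bsub>G\<^esub> b = x [^]\<^bsub>G\<^esub> a' \<otimes>\<^bsub>G\<^esub> y [^]\<^bsub>G\<^esub> (- e * b)"
        unfolding w_eq using Hcomm[OF pow_H[OF x(1)] pow_H[OF y(1)]] xG y \<open>a' = - b\<close>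
        by (simp add: int_pow_mult_distrib int_pow_pow)
      also have "y [^]\<^bsub>G\<^esub> a \<otimes>\<^bsub>G\<^esub> (x [^]\<^bsub>G\<^esub> a' \<otimes>\<^bsub>G\<^esub> y [^]\<^bsub>G\<^esub> (- e * b))
          = x [^]\<^bsub>G\<^esub> a' \<otimes>\<^bsub>G\<^esub> (y [^]\<^bsub>G\<^esub> a \<otimes>\<^bsub>G\<^esub> y [^]\<^bsub>G\<^esub> (- e * b))"
        using Hcomm[OF pow_H[OF x(1), of a'] pow_H[OF y(1), of a]] xG y
        by (metis int_pow_closed m_assoc)
      also have "y [^]\<^bsub>G\<^esub> a \<otimes>\<^bsub>G\<^esub> y [^]\<^bsub>G\<^esub> (- e * b) = y [^]\<^bsub>G\<^esub> b'"
        using y by (simp add: \<open>b' = a - e * b\<close> flip: int_pow_mult)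
      finally show ?thesis using xG y sG by (simp add: conj_by_eq_iff)
    qed
    show "s [^]\<^bsub>G\<^esub> j = \<one>\<^bsub>G\<^esub>" if eq: "x [^]\<^bsub>G\<^esub> a \<otimes>\<^bsub>G\<^esub> y [^]\<^bsub>G\<^esub> b \<otimes>\<^bsub>G\<^esub> s [^]\<^bsub>G\<^esub> j = \<one>\<^bsub>G\<^esub>" for a b j :: int
    proof -
      let ?h = "x [^]\<^bsub>G\<^esub> a \<otimes>\<^bsub>G\<^esub> y [^]\<^bsub>G\<^esub> b"
      have h: "?h \<in> H" by (intro H.m_closed pow_H x y)
      \<comment> \<open>The equation places a power of \<open>s\<close> in both \<open>H\<close> and
        \<open>K\<close>, which meet trivially.\<close>
      have "inv\<^bsub>G\<^esub> (s [^]\<^bsub>G\<^esub> j) = ?h" using eq sG h by (intro inv_equality) auto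
      then have "s [^]\<^bsub>G\<^esub> j = inv\<^bsub>G\<^esub> ?h" using sG by (metis int_pow_closed inv_inv)
      then have "s [^]\<^bsub>G\<^esub> j \<in> H" using h by simp
      moreover have "s [^]\<^bsub>G\<^esub> j \<in> K" by (rule subgroup_int_pow_closed[OF KG s(1)])
      ultimately show ?thesis using HK by blast
    qed
  qed (use grp fin xG y sG Hcomm[OF x(1) y(1)] Im0 l ord_s in auto)
  then show ?thesis by blast
qed

lemma exceptional_list_affine_group:
  assumes "exceptional_list G"
  shows "\<exists>P u v m k d. affine_group G P u v m k d"
proof -
  obtain m k l H where G: "exceptional_elliptic m k l G H"
    and H: "G\<lparr>carrier := H\<rparr> \<cong> integer_mod_group k \<or>
      G\<lparr>carrier := H\<rparr> \<cong> integer_mod_group m \<times>\<times> integer_mod_group (m * k)"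
    using assms
    by (auto simp: exceptional_list_def exceptional_elliptic_one_def exceptional_elliptic_two_def)
  have "group G" "subgroup H G"
    using G by (auto simp: exceptional_elliptic_def semidirect_product_def normal_imp_subgroup)
  then have HG: "group (G\<lparr>carrier := H\<rparr>)" by (simp add: subgroup.subgroup_is_group)
  have comm: "comm_group (integer_mod_group m \<times>\<times> integer_mod_group (m * k))"
    by (rule group.group_comm_groupI)
      (auto simp: DirProd_group add.commute)
  have "comm_group (G\<lparr>carrier := H\<rparr>)"
    using H
  proof
    assume "G\<lparr>carrier := H\<rparr> \<cong> integer_mod_group k"
    from group.iso_sym[OF HG this] show ?thesis
      using HG by (intro comm_group.iso_imp_comm_group[OF abelian_integer_mod_group]) (auto intro: group.is_monoid)
  next
    assume "G\<lparr>carrier := H\<rparr> \<cong> integer_mod_group m \<times>\<times> integer_mod_group (m * k)"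
    from group.iso_sym[OF HG this] show ?thesis
      using HG by (intro comm_group.iso_imp_comm_group[OF comm]) (auto intro: group.is_monoid)
  qed
  with G show ?thesis by (rule exceptional_elliptic_affine_group)
qed

section \<open>The classification\<close>

lemma affine_group_classification:
  assumes "affine_group G P u v m k d"
  shows "d = 1 \<Longrightarrow> abelian_general_list G"
    "comm_group G \<Longrightarrow> d > 1 \<Longrightarrow> abelian_special_list G"
    "\<not> comm_group G \<Longrightarrow> d = 2 \<Longrightarrow> dihedral_list G"
    "\<not> comm_group G \<Longrightarrow> d > 2 \<Longrightarrow> exceptional_list G"
    "abelian_general_list G \<or> abelian_special_list G \<or> dihedral_list G \<or> exceptional_list G"
proof -
  interpret affine_group G P u v m k d by fact
  show "d = 1 \<Longrightarrow> abelian_general_list G" by (rule abelian_general_list_if_order_1)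
  show "comm_group G \<Longrightarrow> d > 1 \<Longrightarrow> abelian_special_list G" by (rule abelian_special_list_if_comm)
  show "\<not> comm_group G \<Longrightarrow> d = 2 \<Longrightarrow> dihedral_list G" by (rule dihedral_list_if_order_2)
  show "\<not> comm_group G \<Longrightarrow> d > 2 \<Longrightarrow> exceptional_list G" by (rule exceptional_list_if_order_gt_2)
  \<comment> \<open>A group with \<open>d = 1\<close> consists of translations and is abelian, so
    these cases are exhaustive.\<close>
  consider "d = 1" | "comm_group G" "d > 1" | "\<not> comm_group G" "d = 2" | "\<not> comm_group G" "d > 2"
    using pos(3) comm_if_order_1 by linarith
  then show "abelian_general_list G \<or> abelian_special_list G \<or> dihedral_list G \<or> exceptional_list G"
    by cases (auto simp: abelian_general_list_if_order_1 abelian_special_list_if_comm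
        dihedral_list_if_order_2 exceptional_list_if_order_gt_2)
qed

theorem theorem3:
  fixes G :: "('a, 'b) monoid_scheme"
  shows
    "(group G \<and> finite (carrier G) \<longrightarrow>
       ((\<exists>\<omega> S. Im \<omega> > 0 \<and> subgroup S (torus_aut \<omega>) \<and> G \<cong> torus_aut \<omega>\<lparr>carrier := S\<rparr>) \<longleftrightarrow>
        abelian_general_list G \<or> abelian_special_list G \<or> dihedral_list G \<or> exceptional_list G))
     \<and>
     (\<forall>\<omega> S. Im \<omega> > 0 \<and> subgroup S (torus_aut \<omega>) \<and> finite S \<longrightarrow>
       (let A = torus_aut \<omega>\<lparr>carrier := S\<rparr>; S0 = lift_multiplier \<omega> ` S in
         (card S0 = 1 \<longrightarrow> abelian_general_list A) \<and>
         (comm_group A \<and> card S0 > 1 \<longrightarrow> abelian_special_list A) \<and>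
         (\<not> comm_group A \<and> card S0 = 2 \<longrightarrow> dihedral_list A) \<and>
         (\<not> comm_group A \<and> card S0 > 2 \<longrightarrow> exceptional_list A)))"
proof (intro conjI impI allI iffI)
  assume G: "group G \<and> finite (carrier G)"
  assume "\<exists>\<omega> S. Im \<omega> > 0 \<and> subgroup S (torus_aut \<omega>) \<and> G \<cong> torus_aut \<omega>\<lparr>carrier := S\<rparr>"
  then obtain \<omega> S where S: "Im \<omega> > 0" "subgroup S (torus_aut \<omega>)" "G \<cong> torus_aut \<omega>\<lparr>carrier := S\<rparr>"
    by blast
  have "finite S" using iso_finite[OF S(3)] G by simp
  then obtain P u v m k d where "affine_group (torus_aut \<omega>\<lparr>carrier := S\<rparr>) P u v m k d"
    using affine_group_of_finite_subgroup[OF S(1,2)] by blast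
  moreover have "torus_aut \<omega>\<lparr>carrier := S\<rparr> \<cong> G" using group.iso_sym[OF _ S(3)] G by blast
  ultimately obtain Q where "affine_group G Q u v m k d" using affine_group_iso G by blast
  then show "abelian_general_list G \<or> abelian_special_list G \<or> dihedral_list G \<or> exceptional_list G"
    by (rule affine_group_classification(5))
next
  assume G: "group G \<and> finite (carrier G)"
  assume "abelian_general_list G \<or> abelian_special_list G \<or> dihedral_list G \<or> exceptional_list G"
  then have "\<exists>P u v m k d. affine_group G P u v m k d"
    using G abelian_general_list_affine_group abelian_special_list_affine_group
      dihedral_group_affine_group bidihedral_affine_group exceptional_list_affine_group
    unfolding dihedral_list_def by metis
  then show "\<exists>\<omega> S. Im \<omega> > 0 \<and> subgroup S (torus_aut \<omega>) \<and> G \<cong> torus_aut \<omega>\<lparr>carrier := S\<rparr>"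
    using affine_group.embeds_in_torus_aut by blast
next
  fix \<omega> S assume S: "Im \<omega> > 0 \<and> subgroup S (torus_aut \<omega>) \<and> finite S"
  then obtain P u v m k where
    "affine_group (torus_aut \<omega>\<lparr>carrier := S\<rparr>) P u v m k (card (lift_multiplier \<omega> ` S))"
    using affine_group_of_finite_subgroup by blast
  \<comment> \<open>The parameter \<open>d\<close> is here the number of multipliers of
    \<open>S\<close>, so the cases on \<open>d\<close> are the cases on
    \<open>card S0\<close>.\<close>
  from affine_group_classification[OF this]
  show "let A = torus_aut \<omega>\<lparr>carrier := S\<rparr>; S0 = lift_multiplier \<omega> ` S in
         (card S0 = 1 \<longrightarrow> abelian_general_list A) \<and>
         (comm_group A \<and> card S0 > 1 \<longrightarrow> abelian_special_list A) \<and>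
         (\<not> comm_group A \<and> card S0 = 2 \<longrightarrow> dihedral_list A) \<and>
         (\<not> comm_group A \<and> card S0 > 2 \<longrightarrow> exceptional_list A)"
    unfolding Let_def by blast
qed

end
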